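(* Let $T$ be a dependent rosy theory, and let $p(x,a)\in S(Aa)$ be a stable type (in a model of $T$) such that its restriction $p(x):=p(x,a)\upharpoonright_A$ is unstable. Then $p(x,a)$ thorn-forks over $A$.
   Context: Dependent means NIP. A formula $\delta(x,a)$ strongly divides over $A$ if $\mathrm{tp}(a/A)$ is non-algebraic and $\{\delta(x,a'):a'\models\mathrm{tp}(a/A)\}$ is $k$-inconsistent for some $k$; it thorn-divides over $A$ if it strongly divides over $Ac$ for some $c$; it thorn-forks over $A$ if it implies a finite disjunction of formulas thorn-dividing over $A$; a type thorn-forks over $A$ if it contains a formula that thorn-forks over $A$. $T$ is rosy if non-thorn-forking (thorn-independence) is a symmetric, transitive independence relation with local character. A type $p$ is stable if there is no formula $\phi(x,y)$ and infinite indiscernible sequences $(a_i)_{i\in I}$ of realizations of $p$ and $(b_i)_{i\in I}$ with $\models\phi(a_i,b_j)$ iff $i<j$; otherwise it is unstable. *)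

theory Defs
  imports Main
begin

unbundle cardinal_syntax

section \<open>Many-sorted first-order logic\<close>

text \<open>
  Logic is many-sorted because thorn-forking lives in the many-sorted structure of imaginaries
  of a model. A one-sorted theory is the case of a single sort.

  Variables are de Bruijn indices: a formula is read in a context (a list of sorts), it is
  evaluated at a tuple of elements of these sorts, and \<open>Ex s\<close> puts a new variable of
  sort \<open>s\<close> at position 0. Hence \<open>\<phi>(x,y)\<close> with \<open>x\<close> of sorts
  \<open>xs\<close> and \<open>y\<close> of sorts \<open>ys\<close> is a formula in context \<open>xs @ ys\<close>.
\<close>

datatype 'f tm = Var nat | App 'f "'f tm list"

datatype ('s, 'f, 'r) fm =
    Fls
  | Eq "'f tm" "'f tm"
  | Rel 'r "'f tm list"
  | Imp "('s, 'f, 'r) fm" "('s, 'f, 'r) fm"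
  | Ex 's "('s, 'f, 'r) fm"

abbreviation Neg :: "('s, 'f, 'r) fm \<Rightarrow> ('s, 'f, 'r) fm" where
  "Neg \<phi> \<equiv> Imp \<phi> Fls"

record ('s, 'f, 'r) lang =
  Sorts :: "'s set"
  Funs :: "'f set"
  Rels :: "'r set"
  farity :: "'f \<Rightarrow> 's list \<times> 's"
  rarity :: "'r \<Rightarrow> 's list"

record ('s, 'f, 'r, 'm) struct =
  dom :: "'s \<Rightarrow> 'm set"
  funI :: "'f \<Rightarrow> 'm list \<Rightarrow> 'm"
  relI :: "'r \<Rightarrow> 'm list \<Rightarrow> bool"

inductive tm_sort :: "('s, 'f, 'r) lang \<Rightarrow> 's list \<Rightarrow> 'f tm \<Rightarrow> 's \<Rightarrow> bool"
  for L :: "('s, 'f, 'r) lang" and \<Gamma> :: "'s list" where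
  "i < length \<Gamma> \<Longrightarrow> tm_sort L \<Gamma> (Var i) (\<Gamma> ! i)"
| "f \<in> Funs L \<Longrightarrow> list_all2 (tm_sort L \<Gamma>) ts (fst (farity L f)) \<Longrightarrow>
     tm_sort L \<Gamma> (App f ts) (snd (farity L f))"

primrec wf_fm :: "('s, 'f, 'r) lang \<Rightarrow> 's list \<Rightarrow> ('s, 'f, 'r) fm \<Rightarrow> bool" where
  "wf_fm L \<Gamma> Fls \<longleftrightarrow> True"
| "wf_fm L \<Gamma> (Eq t u) \<longleftrightarrow> (\<exists>s. tm_sort L \<Gamma> t s \<and> tm_sort L \<Gamma> u s)"
| "wf_fm L \<Gamma> (Rel r ts) \<longleftrightarrow> r \<in> Rels L \<and> list_all2 (tm_sort L \<Gamma>) ts (rarity L r)"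
| "wf_fm L \<Gamma> (Imp \<phi> \<psi>) \<longleftrightarrow> wf_fm L \<Gamma> \<phi> \<and> wf_fm L \<Gamma> \<psi>"
| "wf_fm L \<Gamma> (Ex s \<phi>) \<longleftrightarrow> s \<in> Sorts L \<and> wf_fm L (s # \<Gamma>) \<phi>"

definition formula :: "('s, 'f, 'r) lang \<Rightarrow> 's list \<Rightarrow> ('s, 'f, 'r) fm \<Rightarrow> bool" where
  "formula L \<Gamma> \<phi> \<longleftrightarrow> set \<Gamma> \<subseteq> Sorts L \<and> wf_fm L \<Gamma> \<phi>"

definition formulas :: "('s, 'f, 'r) lang \<Rightarrow> ('s, 'f, 'r) fm set" where
  "formulas L = {\<phi>. \<exists>\<Gamma>. formula L \<Gamma> \<phi>}"

primrec eval_tm :: "('s, 'f, 'r, 'm) struct \<Rightarrow> 'm list \<Rightarrow> 'f tm \<Rightarrow> 'm" where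
  "eval_tm M e (Var i) = e ! i"
| "eval_tm M e (App f ts) = funI M f (map (eval_tm M e) ts)"

primrec sat :: "('s, 'f, 'r, 'm) struct \<Rightarrow> ('s, 'f, 'r) fm \<Rightarrow> 'm list \<Rightarrow> bool" where
  "sat M Fls e \<longleftrightarrow> False"
| "sat M (Eq t u) e \<longleftrightarrow> eval_tm M e t = eval_tm M e u"
| "sat M (Rel r ts) e \<longleftrightarrow> relI M r (map (eval_tm M e) ts)"
| "sat M (Imp \<phi> \<psi>) e \<longleftrightarrow> (sat M \<phi> e \<longrightarrow> sat M \<psi> e)"
| "sat M (Ex s \<phi>) e \<longleftrightarrow> (\<exists>m\<in>dom M s. sat M \<phi> (m # e))"

definition tup :: "('s, 'f, 'r, 'm) struct \<Rightarrow> 's list \<Rightarrow> 'm list set" where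
  "tup M ss = {as. list_all2 (\<lambda>a s. a \<in> dom M s) as ss}"

definition universe :: "('s, 'f, 'r) lang \<Rightarrow> ('s, 'f, 'r, 'm) struct \<Rightarrow> 'm set" where
  "universe L M = (\<Union>s\<in>Sorts L. dom M s)"

definition struct_of :: "('s, 'f, 'r) lang \<Rightarrow> ('s, 'f, 'r, 'm) struct \<Rightarrow> bool" where
  "struct_of L M \<longleftrightarrow>
     (\<forall>f\<in>Funs L. set (fst (farity L f)) \<subseteq> Sorts L \<and> snd (farity L f) \<in> Sorts L) \<and>
     (\<forall>r\<in>Rels L. set (rarity L r) \<subseteq> Sorts L) \<and>
     (\<forall>s\<in>Sorts L. dom M s \<noteq> {}) \<and>
     (\<forall>s\<in>Sorts L. \<forall>t\<in>Sorts L. s \<noteq> t \<longrightarrow> dom M s \<inter> dom M t = {}) \<and>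
     (\<forall>f\<in>Funs L. \<forall>as\<in>tup M (fst (farity L f)). funI M f as \<in> dom M (snd (farity L f)))"

definition theory_of ::
  "('s, 'f, 'r) lang \<Rightarrow> ('s, 'f, 'r, 'm) struct \<Rightarrow> ('s, 'f, 'r) fm set" where
  "theory_of L M = {\<phi>. formula L [] \<phi> \<and> sat M \<phi> []}"

section \<open>Types\<close>

text \<open>
  A formula with parameters \<open>\<phi>(x,b)\<close> is a pair \<open>(\<phi>, b)\<close>; it holds of
  \<open>a\<close> iff \<open>sat M \<phi> (a @ b)\<close>.
\<close>

type_synonym ('s, 'f, 'r, 'm) pfm = "('s, 'f, 'r) fm \<times> 'm list"

definition pformulas :: "('s, 'f, 'r) lang \<Rightarrow> ('s, 'f, 'r, 'm) struct \<Rightarrow> 's list \<Rightarrow> 'm set \<Rightarrow>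
    ('s, 'f, 'r, 'm) pfm set" where
  "pformulas L M xs A =
     {(\<phi>, b). set b \<subseteq> A \<and> (\<exists>ys. b \<in> tup M ys \<and> formula L (xs @ ys) \<phi>)}"

definition realizations :: "('s, 'f, 'r, 'm) struct \<Rightarrow> 's list \<Rightarrow> ('s, 'f, 'r, 'm) pfm set \<Rightarrow>
    'm list set" where
  "realizations M xs q = {a \<in> tup M xs. \<forall>(\<phi>, b)\<in>q. sat M \<phi> (a @ b)}"

definition tp :: "('s, 'f, 'r) lang \<Rightarrow> ('s, 'f, 'r, 'm) struct \<Rightarrow> 's list \<Rightarrow> 'm list \<Rightarrow> 'm set \<Rightarrow>
    ('s, 'f, 'r, 'm) pfm set" where
  "tp L M xs a A = {(\<phi>, b) \<in> pformulas L M xs A. sat M \<phi> (a @ b)}"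

definition fin_sat :: "('s, 'f, 'r, 'm) struct \<Rightarrow> 's list \<Rightarrow> ('s, 'f, 'r, 'm) pfm set \<Rightarrow> bool" where
  "fin_sat M xs q \<longleftrightarrow> (\<forall>F\<subseteq>q. finite F \<longrightarrow> realizations M xs F \<noteq> {})"

definition complete_types :: "('s, 'f, 'r) lang \<Rightarrow> ('s, 'f, 'r, 'm) struct \<Rightarrow> 's list \<Rightarrow> 'm set \<Rightarrow>
    ('s, 'f, 'r, 'm) pfm set set" where
  "complete_types L M xs A = {p. p \<subseteq> pformulas L M xs A \<and> fin_sat M xs p \<and>
     (\<forall>(\<phi>, b)\<in>pformulas L M xs A. (\<phi>, b) \<in> p \<or> (Neg \<phi>, b) \<in> p)}"

definition restrict_type :: "('s, 'f, 'r) lang \<Rightarrow> ('s, 'f, 'r, 'm) struct \<Rightarrow> 's list \<Rightarrow>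
    ('s, 'f, 'r, 'm) pfm set \<Rightarrow> 'm set \<Rightarrow> ('s, 'f, 'r, 'm) pfm set" where
  "restrict_type L M xs p A = p \<inter> pformulas L M xs A"

section \<open>Monster models\<close>

definition small :: "('s, 'f, 'r) lang \<Rightarrow> 'k rel \<Rightarrow> ('s, 'f, 'r, 'm) struct \<Rightarrow> 'm set \<Rightarrow> bool" where
  "small L \<kappa> M A \<longleftrightarrow> A \<subseteq> universe L M \<and> |A| <o \<kappa>"

definition saturated :: "('s, 'f, 'r) lang \<Rightarrow> 'k rel \<Rightarrow> ('s, 'f, 'r, 'm) struct \<Rightarrow> bool" where
  "saturated L \<kappa> M \<longleftrightarrow> (\<forall>A s q. small L \<kappa> M A \<and> s \<in> Sorts L \<and> q \<subseteq> pformulas L M [s] A \<and>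
     fin_sat M [s] q \<longrightarrow> realizations M [s] q \<noteq> {})"

definition automorphism ::
  "('s, 'f, 'r) lang \<Rightarrow> ('s, 'f, 'r, 'm) struct \<Rightarrow> ('m \<Rightarrow> 'm) \<Rightarrow> bool" where
  "automorphism L M \<sigma> \<longleftrightarrow>
     (\<forall>s\<in>Sorts L. bij_betw \<sigma> (dom M s) (dom M s)) \<and>
     (\<forall>f\<in>Funs L. \<forall>as\<in>tup M (fst (farity L f)). \<sigma> (funI M f as) = funI M f (map \<sigma> as)) \<and>
     (\<forall>r\<in>Rels L. \<forall>as\<in>tup M (rarity L r). relI M r (map \<sigma> as) \<longleftrightarrow> relI M r as)"

definition partial_elementary ::
  "('s, 'f, 'r) lang \<Rightarrow> ('s, 'f, 'r, 'm) struct \<Rightarrow> 'm set \<Rightarrow> ('m \<Rightarrow> 'm) \<Rightarrow> bool" where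
  "partial_elementary L M A h \<longleftrightarrow>
     (\<forall>\<Gamma> \<phi>. \<forall>as\<in>tup M \<Gamma>. formula L \<Gamma> \<phi> \<and> set as \<subseteq> A \<longrightarrow>
        map h as \<in> tup M \<Gamma> \<and> (sat M \<phi> (map h as) \<longleftrightarrow> sat M \<phi> as))"

definition strongly_homogeneous ::
  "('s, 'f, 'r) lang \<Rightarrow> 'k rel \<Rightarrow> ('s, 'f, 'r, 'm) struct \<Rightarrow> bool" where
  "strongly_homogeneous L \<kappa> M \<longleftrightarrow> (\<forall>A h. small L \<kappa> M A \<and> partial_elementary L M A h \<longrightarrow>
     (\<exists>\<sigma>. automorphism L M \<sigma> \<and> (\<forall>m\<in>A. \<sigma> m = h m)))"

text \<open>
  The complete theory \<open>T\<close>, taken to be closed under consequences, is studied inside a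
  \<open>\<kappa>\<close>-saturated and strongly \<open>\<kappa>\<close>-homogeneous model. The bound
  \<open>2\<^bsup>|T|\<^esup> < \<kappa>\<close> ensures that there are small sets of cardinality greater
  than \<open>|T|\<close>, so that local character below is not vacuous.
\<close>

definition monster_model :: "('s, 'f, 'r) lang \<Rightarrow> ('s, 'f, 'r) fm set \<Rightarrow> 'k rel \<Rightarrow>
    ('s, 'f, 'r, 'm) struct \<Rightarrow> bool" where
  "monster_model L T \<kappa> M \<longleftrightarrow> struct_of L M \<and> theory_of L M = T \<and>
     Card_order \<kappa> \<and> |Pow (formulas L)| <o \<kappa> \<and>
     saturated L \<kappa> M \<and> strongly_homogeneous L \<kappa> M"

section \<open>Imaginaries\<close>

definition defines_equiv :: "('s, 'f, 'r) lang \<Rightarrow> ('s, 'f, 'r, 'm) struct \<Rightarrow> 's list \<Rightarrow>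
    ('s, 'f, 'r) fm \<Rightarrow> bool" where
  "defines_equiv L M ss E \<longleftrightarrow> formula L (ss @ ss) E \<and>
     equiv (tup M ss) {(a, b). a \<in> tup M ss \<and> b \<in> tup M ss \<and> sat M E (a @ b)}"

text \<open>
  The language of \<open>M\<^sup>e\<^sup>q\<close> has one sort \<open>(ss, E)\<close> for each
  formula \<open>E\<close> that defines an equivalence relation on the tuples of sorts \<open>ss\<close>,
  with the projection \<open>Proj ss E\<close> onto it. A sort \<open>s\<close> of the original structure
  becomes the quotient of \<open>s\<close> by equality.
\<close>

type_synonym ('s, 'f, 'r) eq_sort = "'s list \<times> ('s, 'f, 'r) fm"

datatype ('s, 'f, 'r) eq_fun = Old 'f | Proj "'s list" "('s, 'f, 'r) fm"

type_synonym ('s, 'f, 'r, 'm) eq_elem = "('s, 'f, 'r) eq_sort \<times> 'm list set"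

definition home :: "'s \<Rightarrow> ('s, 'f, 'r) eq_sort" where
  "home s = ([s], Eq (Var 0) (Var 1))"

definition eq_lang :: "('s, 'f, 'r) lang \<Rightarrow> ('s, 'f, 'r, 'm) struct \<Rightarrow>
    (('s, 'f, 'r) eq_sort, ('s, 'f, 'r) eq_fun, 'r) lang" where
  "eq_lang L M =
     \<lparr> Sorts = {(ss, E). defines_equiv L M ss E},
       Funs = Old ` Funs L \<union> {Proj ss E |ss E. defines_equiv L M ss E},
       Rels = Rels L,
       farity = (\<lambda>g. case g of
           Old f \<Rightarrow> (map home (fst (farity L f)), home (snd (farity L f)))
         | Proj ss E \<Rightarrow> (map home ss, (ss, E))),
       rarity = (\<lambda>r. map home (rarity L r)) \<rparr>"

definition eq_class :: "('s, 'f, 'r, 'm) struct \<Rightarrow> ('s, 'f, 'r) eq_sort \<Rightarrow> 'm list \<Rightarrow>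
    ('s, 'f, 'r, 'm) eq_elem" where
  "eq_class M S a = (S, {b \<in> tup M (fst S). sat M (snd S) (a @ b)})"

text \<open>
  The element of \<open>home s\<close> that corresponds to \<open>m\<close> is \<open>(home s, {[m]})\<close>.
\<close>

definition the_real :: "('s, 'f, 'r, 'm) eq_elem \<Rightarrow> 'm" where
  "the_real e = (THE m. snd e = {[m]})"

definition eq_struct :: "('s, 'f, 'r) lang \<Rightarrow> ('s, 'f, 'r, 'm) struct \<Rightarrow>
    (('s, 'f, 'r) eq_sort, ('s, 'f, 'r) eq_fun, 'r, ('s, 'f, 'r, 'm) eq_elem) struct" where
  "eq_struct L M =
     \<lparr> dom = (\<lambda>S. eq_class M S ` tup M (fst S)),
       funI = (\<lambda>g es. case g of
           Old f \<Rightarrow> (home (snd (farity L f)), {[funI M f (map the_real es)]})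
         | Proj ss E \<Rightarrow> eq_class M (ss, E) (map the_real es)),
       relI = (\<lambda>r es. relI M r (map the_real es)) \<rparr>"

section \<open>Dependence and stability\<close>

definition has_IP :: "('s, 'f, 'r, 'm) struct \<Rightarrow> 's list \<Rightarrow> 's list \<Rightarrow> ('s, 'f, 'r) fm \<Rightarrow> bool" where
  "has_IP M xs ys \<phi> \<longleftrightarrow> (\<exists>(a :: nat \<Rightarrow> 'm list) (b :: nat set \<Rightarrow> 'm list).
     (\<forall>i. a i \<in> tup M xs) \<and> (\<forall>S. b S \<in> tup M ys) \<and>
     (\<forall>i S. sat M \<phi> (a i @ b S) \<longleftrightarrow> i \<in> S))"

definition dependent :: "('s, 'f, 'r) lang \<Rightarrow> ('s, 'f, 'r, 'm) struct \<Rightarrow> bool" where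
  "dependent L M \<longleftrightarrow> (\<forall>xs ys \<phi>. formula L (xs @ ys) \<phi> \<longrightarrow> \<not> has_IP M xs ys \<phi>)"

definition indiscernible :: "('s, 'f, 'r) lang \<Rightarrow> ('s, 'f, 'r, 'm) struct \<Rightarrow> 's list \<Rightarrow>
    'i rel \<Rightarrow> ('i \<Rightarrow> 'm list) \<Rightarrow> bool" where
  "indiscernible L M xs r a \<longleftrightarrow> (\<forall>i. a i \<in> tup M xs) \<and>
     (\<forall>n \<phi> is js. formula L (concat (replicate n xs)) \<phi> \<and> length is = n \<and> length js = n \<and>
        sorted_wrt (\<lambda>i j. (i, j) \<in> r - Id) is \<and> sorted_wrt (\<lambda>i j. (i, j) \<in> r - Id) js \<longrightarrow>
        (sat M \<phi> (concat (map a is)) \<longleftrightarrow> sat M \<phi> (concat (map a js))))"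

text \<open>
  Since the restriction of an indiscernible sequence to a subset of its index set is
  indiscernible, it suffices to consider countably infinite index sets, i.e. all linear orders
  \<open>r\<close> on the set of natural numbers.
\<close>

definition stable_type :: "('s, 'f, 'r) lang \<Rightarrow> ('s, 'f, 'r, 'm) struct \<Rightarrow> 's list \<Rightarrow>
    ('s, 'f, 'r, 'm) pfm set \<Rightarrow> bool" where
  "stable_type L M xs p \<longleftrightarrow> \<not> (\<exists>ys \<phi> (r :: nat rel) a b.
     formula L (xs @ ys) \<phi> \<and> linear_order r \<and>
     indiscernible L M xs r a \<and> (\<forall>i. a i \<in> realizations M xs p) \<and>
     indiscernible L M ys r b \<and>
     (\<forall>i j. sat M \<phi> (a i @ b j) \<longleftrightarrow> (i, j) \<in> r - Id))"

section \<open>Thorn-forking\<close>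

definition k_inconsistent :: "('s, 'f, 'r, 'm) struct \<Rightarrow> 's list \<Rightarrow> nat \<Rightarrow>
    ('s, 'f, 'r, 'm) pfm set \<Rightarrow> bool" where
  "k_inconsistent M xs k Q \<longleftrightarrow> (\<forall>F\<subseteq>Q. finite F \<and> card F = k \<longrightarrow> realizations M xs F = {})"

definition strongly_divides :: "('s, 'f, 'r) lang \<Rightarrow> ('s, 'f, 'r, 'm) struct \<Rightarrow> 's list \<Rightarrow>
    'm set \<Rightarrow> ('s, 'f, 'r, 'm) pfm \<Rightarrow> bool" where
  "strongly_divides L M xs A = (\<lambda>(\<delta>, a). \<exists>ys. set ys \<subseteq> Sorts L \<and> a \<in> tup M ys \<and>
     formula L (xs @ ys) \<delta> \<and>
     infinite (realizations M ys (tp L M ys a A)) \<and>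
     (\<exists>k\<ge>1. k_inconsistent M xs k ((\<lambda>a'. (\<delta>, a')) ` realizations M ys (tp L M ys a A))))"

definition thorn_divides :: "('s, 'f, 'r) lang \<Rightarrow> ('s, 'f, 'r, 'm) struct \<Rightarrow> 's list \<Rightarrow>
    'm set \<Rightarrow> ('s, 'f, 'r, 'm) pfm \<Rightarrow> bool" where
  "thorn_divides L M xs A \<delta> \<longleftrightarrow>
     (\<exists>c. set c \<subseteq> universe L M \<and> strongly_divides L M xs (A \<union> set c) \<delta>)"

definition thorn_forks :: "('s, 'f, 'r) lang \<Rightarrow> ('s, 'f, 'r, 'm) struct \<Rightarrow> 's list \<Rightarrow>
    'm set \<Rightarrow> ('s, 'f, 'r, 'm) pfm \<Rightarrow> bool" where
  "thorn_forks L M xs A \<phi> \<longleftrightarrow>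
     (\<exists>D. finite D \<and> (\<forall>\<delta>\<in>D. thorn_divides L M xs A \<delta>) \<and>
        realizations M xs {\<phi>} \<subseteq> (\<Union>\<delta>\<in>D. realizations M xs {\<delta>}))"

definition type_thorn_forks :: "('s, 'f, 'r) lang \<Rightarrow> ('s, 'f, 'r, 'm) struct \<Rightarrow> 's list \<Rightarrow>
    'm set \<Rightarrow> ('s, 'f, 'r, 'm) pfm set \<Rightarrow> bool" where
  "type_thorn_forks L M xs A p \<longleftrightarrow> (\<exists>\<phi>\<in>p. thorn_forks L M xs A \<phi>)"

text \<open>\<open>thorn_indep L M A C B\<close>: the set \<open>A\<close> is independent from \<open>B\<close> over \<open>C\<close>.\<close>

definition thorn_indep :: "('s, 'f, 'r) lang \<Rightarrow> ('s, 'f, 'r, 'm) struct \<Rightarrow>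
    'm set \<Rightarrow> 'm set \<Rightarrow> 'm set \<Rightarrow> bool" where
  "thorn_indep L M A C B \<longleftrightarrow> (\<forall>xs a. set xs \<subseteq> Sorts L \<and> a \<in> tup M xs \<and> set a \<subseteq> A \<longrightarrow>
     \<not> type_thorn_forks L M xs C (tp L M xs a (B \<union> C)))"

section \<open>Independence relations and rosiness\<close>

definition independence_relation :: "('s, 'f, 'r) lang \<Rightarrow> 'k rel \<Rightarrow> ('s, 'f, 'r, 'm) struct \<Rightarrow>
    ('m set \<Rightarrow> 'm set \<Rightarrow> 'm set \<Rightarrow> bool) \<Rightarrow> bool" where
  "independence_relation L \<kappa> M ind \<longleftrightarrow>
     \<comment> \<open>invariance\<close>
     (\<forall>A B C \<sigma>. small L \<kappa> M A \<and> small L \<kappa> M B \<and> small L \<kappa> M C \<and> automorphism L M \<sigma> \<and>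
        ind A C B \<longrightarrow> ind (\<sigma> ` A) (\<sigma> ` C) (\<sigma> ` B)) \<and>
     \<comment> \<open>monotonicity\<close>
     (\<forall>A A' B B' C. small L \<kappa> M A \<and> small L \<kappa> M B \<and> small L \<kappa> M C \<and>
        A' \<subseteq> A \<and> B' \<subseteq> B \<and> ind A C B \<longrightarrow> ind A' C B') \<and>
     \<comment> \<open>finite character\<close>
     (\<forall>A B C. small L \<kappa> M A \<and> small L \<kappa> M B \<and> small L \<kappa> M C \<and>
        (\<forall>A' B'. A' \<subseteq> A \<and> finite A' \<and> B' \<subseteq> B \<and> finite B' \<longrightarrow> ind A' C B') \<longrightarrow> ind A C B) \<and>
     \<comment> \<open>extension\<close>
     (\<forall>xs a B B' C. set xs \<subseteq> Sorts L \<and> a \<in> tup M xs \<and> small L \<kappa> M B' \<and> small L \<kappa> M C \<and>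
        B \<subseteq> B' \<and> ind (set a) C B \<longrightarrow>
        (\<exists>a'\<in>tup M xs. tp L M xs a' (B \<union> C) = tp L M xs a (B \<union> C) \<and> ind (set a') C B'))"

definition symmetric_relation :: "('s, 'f, 'r) lang \<Rightarrow> 'k rel \<Rightarrow> ('s, 'f, 'r, 'm) struct \<Rightarrow>
    ('m set \<Rightarrow> 'm set \<Rightarrow> 'm set \<Rightarrow> bool) \<Rightarrow> bool" where
  "symmetric_relation L \<kappa> M ind \<longleftrightarrow>
     (\<forall>A B C. small L \<kappa> M A \<and> small L \<kappa> M B \<and> small L \<kappa> M C \<and> ind A C B \<longrightarrow> ind B C A)"

definition transitive_relation :: "('s, 'f, 'r) lang \<Rightarrow> 'k rel \<Rightarrow> ('s, 'f, 'r, 'm) struct \<Rightarrow>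
    ('m set \<Rightarrow> 'm set \<Rightarrow> 'm set \<Rightarrow> bool) \<Rightarrow> bool" where
  "transitive_relation L \<kappa> M ind \<longleftrightarrow>
     (\<forall>A B C D. small L \<kappa> M A \<and> small L \<kappa> M B \<and> C \<subseteq> D \<and> D \<subseteq> B \<longrightarrow>
        (ind A C B \<longleftrightarrow> ind A C D \<and> ind A D B))"

definition local_character :: "('s, 'f, 'r) lang \<Rightarrow> 'k rel \<Rightarrow> ('s, 'f, 'r, 'm) struct \<Rightarrow>
    ('m set \<Rightarrow> 'm set \<Rightarrow> 'm set \<Rightarrow> bool) \<Rightarrow> bool" where
  "local_character L \<kappa> M ind \<longleftrightarrow>
     (\<forall>A B. A \<subseteq> universe L M \<and> finite A \<and> small L \<kappa> M B \<longrightarrow>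
        (\<exists>B0\<subseteq>B. |B0| \<le>o |formulas L| \<and> ind A B0 B))"

text \<open>
  As usual for thorn-forking, imaginary elements are allowed everywhere, in particular as the
  parameters of thorn-dividing formulas.
\<close>

definition rosy :: "('s, 'f, 'r) lang \<Rightarrow> 'k rel \<Rightarrow> ('s, 'f, 'r, 'm) struct \<Rightarrow> bool" where
  "rosy L \<kappa> M \<longleftrightarrow> (let Leq = eq_lang L M; Meq = eq_struct L M; ind = thorn_indep Leq Meq in
     independence_relation Leq \<kappa> Meq ind \<and> symmetric_relation Leq \<kappa> Meq ind \<and>
     transitive_relation Leq \<kappa> Meq ind \<and> local_character Leq \<kappa> Meq ind)"

end

theory Submission
  imports Defs "HOL-Library.Countable_Set" "HOL-Library.Ramsey"
begin

text \<open>
  Suppose that \<open>p(x,a)\<close> does not thorn-fork over \<open>A\<close> although its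
  restriction to \<open>A\<close> is unstable. By Ramsey's theorem there are realizations
  \<open>al i\<close> of the restriction all of whose increasing subsequences are ordered by
  \<open>\<phi>\<close>. Moving them by a conjugation over \<open>A\<close>, we may assume that a
  realization \<open>b\<close> of \<open>p\<close> realizes the average type (along a nonprincipal
  ultrafilter) of this sequence over \<open>C = A \<union> al\<close>. By extension and
  transitivity, a conjugate \<open>a'\<close> of \<open>a\<close> over \<open>Ab\<close> is
  independent from \<open>Cb\<close>, and then \<open>b\<close> has copies \<open>bs i\<close>
  over \<open>Ca'\<close> that are independent over \<open>C\<close>. Iterating the average type of the
  \<open>bs i\<close> gives an indiscernible sequence \<open>g\<close> that is independent over
  \<open>C\<close> and realizes a stable type. Stability makes the average type of \<open>g\<close>
  definable by majority among finitely many terms. The imaginary that codes this definition lies in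
  the algebraic closure of two independent parts of \<open>g\<close>, hence in \<open>acl C\<close>.
  Therefore the average types of \<open>al\<close> and of \<open>g\<close> commute, so that every
  formula over \<open>C\<close> that holds of all increasing tuples from \<open>al\<close> holds of
  \<open>g\<close>. Thus \<open>\<phi>\<close> orders \<open>g\<close> as well, which contradicts
  stability.
\<close>

section \<open>Renaming of variables and blocks of variables\<close>

text \<open>The obstacle is an exchange of limits. \<open>al\<close> carries an order pattern but
  need not be indiscernible, and \<open>g 0\<close> realizes its average type over \<open>C\<close>
  only, not over the later entries of \<open>g\<close>. Passing to limits along \<open>al\<close>
  from the last variable backwards leaves conditions with one entry \<open>al i\<close> followed by
  entries of \<open>g\<close>, and the limit in \<open>i\<close> must still be taken. A definition
  over \<open>acl C\<close> of the average type of \<open>g\<close> absorbs the later entries and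
  leaves a condition on the first one alone, where \<open>g 0\<close> agrees with the limit of
  \<open>al\<close>.

  Two sequences are built after \<open>al\<close> because the \<open>bs i\<close> are independent
  but not necessarily indiscernible. Their average is finitely satisfiable in them, which yields
  indiscernibility, while independence over \<open>C\<close> survives: a formula of the average type
  holds of some \<open>bs i\<close> with \<open>i\<close> beyond all its parameters.

  Stability is used in the form that certain finite order patterns do not occur. Such patterns are
  definable, so they pass along elementary equivalence, and compactness makes them infinite only
  where instability of a type is concluded.\<close>

primrec ren_tm :: "(nat \<Rightarrow> nat) \<Rightarrow> 'f tm \<Rightarrow> 'f tm" where
  "ren_tm f (Var i) = Var (f i)"
| "ren_tm f (App g ts) = App g (map (ren_tm f) ts)"

primrec ren :: "(nat \<Rightarrow> nat) \<Rightarrow> ('s, 'f, 'r) fm \<Rightarrow> ('s, 'f, 'r) fm" where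
  "ren f Fls = Fls"
| "ren f (Eq t u) = Eq (ren_tm f t) (ren_tm f u)"
| "ren f (Rel r ts) = Rel r (map (ren_tm f) ts)"
| "ren f (Imp \<phi> \<psi>) = Imp (ren f \<phi>) (ren f \<psi>)"
| "ren f (Ex s \<phi>) = Ex s (ren (case_nat 0 (\<lambda>i. Suc (f i))) \<phi>)"

lemma tm_sort_ren:
  assumes "tm_sort L \<Gamma> t s" and "\<forall>i<length \<Gamma>. f i < length \<Delta> \<and> \<Delta> ! f i = \<Gamma> ! i"
  shows "tm_sort L \<Delta> (ren_tm f t) s"
  using assms(1)
proof (induction rule: tm_sort.induct)
  case (1 i)
  then show ?case using assms(2) tm_sort.intros(1)[of "f i" \<Delta> L] by simp
next
  case (2 g ts)
  then have "list_all2 (tm_sort L \<Delta>) (map (ren_tm f) ts) (fst (farity L g))"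
    by (simp add: list_all2_conv_all_nth)
  with 2(1) show ?case by (simp add: tm_sort.intros(2))
qed

lemma eval_ren:
  assumes "tm_sort L \<Gamma> t s" and "\<forall>i<length \<Gamma>. e ! f i = e' ! i"
  shows "eval_tm M e (ren_tm f t) = eval_tm M e' t"
  using assms(1)
proof (induction rule: tm_sort.induct)
  case (1 i)
  then show ?case using assms(2) by simp
next
  case (2 g ts)
  then have "map (\<lambda>t. eval_tm M e (ren_tm f t)) ts = map (eval_tm M e') ts"
    by (intro nth_equalityI) (auto simp: list_all2_conv_all_nth)
  then show ?case by (simp add: comp_def del: map_eq_conv)
qed

lemma wf_ren:
  assumes "wf_fm L \<Gamma> \<phi>" and "\<forall>i<length \<Gamma>. f i < length \<Delta> \<and> \<Delta> ! f i = \<Gamma> ! i"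
  shows "wf_fm L \<Delta> (ren f \<phi>)"
  using assms
proof (induction \<phi> arbitrary: \<Gamma> \<Delta> f)
  case (Eq t u)
  then show ?case by (auto intro: tm_sort_ren)
next
  case (Rel r ts)
  then show ?case by (auto simp: list_all2_conv_all_nth intro: tm_sort_ren)
next
  case (Ex s \<phi>)
  have "\<forall>i<length (s # \<Gamma>). case_nat 0 (\<lambda>i. Suc (f i)) i < length (s # \<Delta>) \<and>
      (s # \<Delta>) ! case_nat 0 (\<lambda>i. Suc (f i)) i = (s # \<Gamma>) ! i"
    using Ex.prems(2) by (auto split: nat.split)
  with Ex show ?case by auto
qed auto

lemma sat_ren:
  assumes "wf_fm L \<Gamma> \<phi>" and "\<forall>i<length \<Gamma>. e ! f i = e' ! i"
  shows "sat M (ren f \<phi>) e \<longleftrightarrow> sat M \<phi> e'"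
  using assms
proof (induction \<phi> arbitrary: \<Gamma> e e' f)
  case (Eq t u)
  then obtain s where s: "tm_sort L \<Gamma> t s" "tm_sort L \<Gamma> u s" by auto
  show ?case using s[THEN eval_ren[OF _ Eq.prems(2), where M = M]] by simp
next
  case (Rel r ts)
  then have "list_all2 (tm_sort L \<Gamma>) ts (rarity L r)" by simp
  then have "\<forall>t\<in>set ts. \<exists>s. tm_sort L \<Gamma> t s"
    by (metis list_all2_conv_all_nth in_set_conv_nth)
  then have "map (eval_tm M e) (map (ren_tm f) ts) = map (eval_tm M e') ts"
    using eval_ren[OF _ Rel.prems(2), where M = M] by (auto simp del: eval_tm.simps)
  then show ?case by (simp only: ren.simps sat.simps)
next
  case (Ex s \<phi>)
  have "sat M (ren (case_nat 0 (\<lambda>i. Suc (f i))) \<phi>) (m # e) \<longleftrightarrow> sat M \<phi> (m # e')" for m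
  proof (rule Ex.IH)
    show "wf_fm L (s # \<Gamma>) \<phi>" using Ex.prems by simp
    show "\<forall>i<length (s # \<Gamma>). (m # e) ! case_nat 0 (\<lambda>i. Suc (f i)) i = (m # e') ! i"
      using Ex.prems(2) by (auto split: nat.split)
  qed
  then show ?case by simp
next
  case (Imp \<phi>1 \<phi>2)
  have "sat M (ren f \<phi>1) e \<longleftrightarrow> sat M \<phi>1 e'" "sat M (ren f \<phi>2) e \<longleftrightarrow> sat M \<phi>2 e'"
    using Imp.prems by (auto intro!: Imp.IH)
  then show ?case by simp
qed simp

text \<open>One index map serves the sorts and all environments at once, because a block takes up
  exactly \<open>length (\<sigma> v)\<close> positions whatever it is filled with. Several copies of
  a block in \<open>vs\<close> may be sent to the same copy in \<open>ws\<close>, so identification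
  of variables is covered as well as permutation and weakening.\<close>

lemma block_index:
  fixes \<sigma> :: "'v \<Rightarrow> 's list"
  assumes "set vs \<subseteq> set ws"
  shows "\<exists>f. (\<forall>i<length (concat (map \<sigma> vs)). f i < length (concat (map \<sigma> ws)) \<and>
      concat (map \<sigma> ws) ! f i = concat (map \<sigma> vs) ! i) \<and>
    (\<forall>\<rho> :: 'v \<Rightarrow> 'm list. (\<forall>v. length (\<rho> v) = length (\<sigma> v)) \<longrightarrow>
      (\<forall>i<length (concat (map \<sigma> vs)). concat (map \<rho> ws) ! f i = concat (map \<rho> vs) ! i))"
  using assms
proof (induction vs)
  case Nil
  then show ?case by simp
next
  case (Cons v vs)
  then obtain f where f1: "\<forall>i<length (concat (map \<sigma> vs)). f i < length (concat (map \<sigma> ws)) \<and>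
      concat (map \<sigma> ws) ! f i = concat (map \<sigma> vs) ! i"
    and f2: "\<forall>\<rho> :: 'v \<Rightarrow> 'm list. (\<forall>v. length (\<rho> v) = length (\<sigma> v)) \<longrightarrow>
      (\<forall>i<length (concat (map \<sigma> vs)). concat (map \<rho> ws) ! f i = concat (map \<rho> vs) ! i)"
    by auto
  from Cons.prems obtain pre post where ws: "ws = pre @ v # post"
    by (metis list.set_intros(1) split_list subsetD)
  \<comment> \<open>\<open>k\<close> is the offset of the chosen occurrence of \<open>v\<close> in
    \<open>ws\<close>. Positions behind the first block are handled by \<open>f\<close>, after
    subtracting the length of that block.\<close>
  define k where "k = length (concat (map \<sigma> pre))"
  define g where "g i = (if i < length (\<sigma> v) then k + i else f (i - length (\<sigma> v)))" for i
  have len: "length (concat (map \<rho> us)) = length (concat (map \<sigma> us))"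
    if "\<forall>v. length (\<rho> v) = length (\<sigma> v)" for us and \<rho> :: "'v \<Rightarrow> 'm list"
    using that by (induction us) auto
  have "\<forall>i<length (concat (map \<sigma> (v # vs))). g i < length (concat (map \<sigma> ws)) \<and>
      concat (map \<sigma> ws) ! g i = concat (map \<sigma> (v # vs)) ! i"
  proof (intro allI impI)
    fix i assume i: "i < length (concat (map \<sigma> (v # vs)))"
    show "g i < length (concat (map \<sigma> ws)) \<and> concat (map \<sigma> ws) ! g i = concat (map \<sigma> (v # vs)) ! i"
    proof (cases "i < length (\<sigma> v)")
      case True
      then show ?thesis by (simp add: g_def k_def ws nth_append)
    next
      case False
      then show ?thesis using f1 i by (auto simp: g_def nth_append)
    qed
  qed
  moreover have "\<forall>\<rho> :: 'v \<Rightarrow> 'm list. (\<forall>v. length (\<rho> v) = length (\<sigma> v)) \<longrightarrow>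
      (\<forall>i<length (concat (map \<sigma> (v # vs))). concat (map \<rho> ws) ! g i = concat (map \<rho> (v # vs)) ! i)"
  proof (intro allI impI)
    fix \<rho> :: "'v \<Rightarrow> 'm list" and i
    assume \<rho>: "\<forall>v. length (\<rho> v) = length (\<sigma> v)" and i: "i < length (concat (map \<sigma> (v # vs)))"
    show "concat (map \<rho> ws) ! g i = concat (map \<rho> (v # vs)) ! i"
    proof (cases "i < length (\<sigma> v)")
      case True
      then show ?thesis using len[OF \<rho>, of pre] \<rho> by (simp add: g_def k_def ws nth_append)
    next
      case False
      then show ?thesis using f2 \<rho> i by (auto simp: g_def nth_append)
    qed
  qed
  ultimately show ?case by blast
qed

text \<open>Since variables are positions, each rearrangement of arguments needs a new formula;
  \<open>\<phi>'\<close> is one that is good for all environments simultaneously.\<close>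

lemma formula_blocks:
  fixes \<sigma> :: "'v \<Rightarrow> 's list" and M :: "('s, 'f, 'r, 'm) struct"
  assumes "formula L (concat (map \<sigma> vs)) \<phi>" and "set vs \<subseteq> set ws"
    and "set (concat (map \<sigma> ws)) \<subseteq> Sorts L"
  obtains \<phi>' where "formula L (concat (map \<sigma> ws)) \<phi>'"
    and "\<And>\<rho>. (\<And>v. \<rho> v \<in> tup M (\<sigma> v)) \<Longrightarrow>
      sat M \<phi>' (concat (map \<rho> ws)) \<longleftrightarrow> sat M \<phi> (concat (map \<rho> vs))"
proof -
  obtain f where f1: "\<forall>i<length (concat (map \<sigma> vs)). f i < length (concat (map \<sigma> ws)) \<and>
      concat (map \<sigma> ws) ! f i = concat (map \<sigma> vs) ! i"
    and f2: "\<forall>\<rho> :: 'v \<Rightarrow> 'm list. (\<forall>v. length (\<rho> v) = length (\<sigma> v)) \<longrightarrow>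
      (\<forall>i<length (concat (map \<sigma> vs)). concat (map \<rho> ws) ! f i = concat (map \<rho> vs) ! i)"
    using block_index[OF assms(2), where ?'m = 'm] by blast
  have w: "wf_fm L (concat (map \<sigma> vs)) \<phi>" using assms(1) by (simp add: formula_def)
  show ?thesis
  proof
    show "formula L (concat (map \<sigma> ws)) (ren f \<phi>)"
      using wf_ren[OF w f1] assms(3) by (simp add: formula_def)
    fix \<rho> :: "'v \<Rightarrow> 'm list" assume "\<And>v. \<rho> v \<in> tup M (\<sigma> v)"
    then have "\<forall>v. length (\<rho> v) = length (\<sigma> v)" by (auto simp: tup_def dest: list_all2_lengthD)
    with f2 have "\<forall>i<length (concat (map \<sigma> vs)). concat (map \<rho> ws) ! f i = concat (map \<rho> vs) ! i"
      by blast
    then show "sat M (ren f \<phi>) (concat (map \<rho> ws)) \<longleftrightarrow> sat M \<phi> (concat (map \<rho> vs))"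
      by (rule sat_ren[OF w])
  qed
qed

text \<open>The head of the list is bound innermost, because the innermost binder owns position 0
  and has to supply the head of the tuple.\<close>

primrec Exs :: "'s list \<Rightarrow> ('s, 'f, 'r) fm \<Rightarrow> ('s, 'f, 'r) fm" where
  "Exs [] \<phi> = \<phi>"
| "Exs (s # ss) \<phi> = Exs ss (Ex s \<phi>)"

lemma tup_Nil [simp]: "tup M [] = {[]}"
  by (auto simp: tup_def)

lemma tup_Cons: "e \<in> tup M (s # ss) \<longleftrightarrow> (\<exists>m w. e = m # w \<and> m \<in> dom M s \<and> w \<in> tup M ss)"
  by (auto simp: tup_def list_all2_Cons2)

lemma tup_append: "e \<in> tup M (ss @ ts) \<longleftrightarrow> (\<exists>u v. e = u @ v \<and> u \<in> tup M ss \<and> v \<in> tup M ts)"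
  by (auto simp: tup_def list_all2_append2 dest: list_all2_lengthD intro: list_all2_appendI)

lemma tup_appendI: "u \<in> tup M ss \<Longrightarrow> v \<in> tup M ts \<Longrightarrow> u @ v \<in> tup M (ss @ ts)"
  by (auto simp: tup_append)

lemma length_tup: "e \<in> tup M ss \<Longrightarrow> length e = length ss"
  by (auto simp: tup_def dest: list_all2_lengthD)

lemma tup_concat: "(\<And>v. v \<in> set vs \<Longrightarrow> \<rho> v \<in> tup M (\<sigma> v)) \<Longrightarrow>
    concat (map \<rho> vs) \<in> tup M (concat (map \<sigma> vs))"
  by (induction vs) (auto intro: tup_appendI)

lemma tup_nth: "e \<in> tup M ss \<longleftrightarrow> length e = length ss \<and> (\<forall>i<length ss. e ! i \<in> dom M (ss ! i))"
  by (auto simp: tup_def list_all2_conv_all_nth)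

lemma set_tup: "e \<in> tup M ss \<Longrightarrow> set ss \<subseteq> Sorts L \<Longrightarrow> set e \<subseteq> universe L M"
  by (auto simp: tup_nth universe_def set_conv_nth subset_iff)

lemma sat_Exs: "sat M (Exs ss \<phi>) e \<longleftrightarrow> (\<exists>w\<in>tup M ss. sat M \<phi> (w @ e))"
proof (induction ss arbitrary: \<phi>)
  case (Cons s ss)
  have "(\<exists>w\<in>tup M (s # ss). sat M \<phi> (w @ e)) \<longleftrightarrow>
      (\<exists>m\<in>dom M s. \<exists>w\<in>tup M ss. sat M \<phi> (m # w @ e))"
    unfolding Bex_def tup_Cons by fastforce
  then show ?case unfolding Exs.simps Cons.IH by auto
qed simp

lemma formula_Exs: "formula L (ss @ \<Gamma>) \<phi> \<Longrightarrow> formula L \<Gamma> (Exs ss \<phi>)"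
proof (induction ss arbitrary: \<phi>)
  case (Cons s ss)
  then have "formula L (ss @ \<Gamma>) (Ex s \<phi>)" by (auto simp: formula_def)
  with Cons.IH show ?case by simp
qed simp

section \<open>Predicates definable with parameters\<close>

text \<open>
  A predicate takes an environment, which assigns to each variable \<open>v\<close> a tuple of sorts
  \<open>\<sigma> v\<close>. In \<open>dp L M A \<sigma> W P\<close> the set \<open>W\<close> bounds
  the variables on which the predicate depends.
\<close>

definition envs :: "('s, 'f, 'r, 'm) struct \<Rightarrow> ('v \<Rightarrow> 's list) \<Rightarrow> ('v \<Rightarrow> 'm list) set" where
  "envs M \<sigma> = {\<rho>. \<forall>v. \<rho> v \<in> tup M (\<sigma> v)}"

definition dp :: "('s, 'f, 'r) lang \<Rightarrow> ('s, 'f, 'r, 'm) struct \<Rightarrow> 'm set \<Rightarrow> ('v \<Rightarrow> 's list) \<Rightarrow>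
    'v set \<Rightarrow> (('v \<Rightarrow> 'm list) \<Rightarrow> bool) \<Rightarrow> bool" where
  "dp L M A \<sigma> W P \<longleftrightarrow> (\<exists>vs \<phi> b ys. set vs \<subseteq> W \<and> set b \<subseteq> A \<and> b \<in> tup M ys \<and>
     formula L (concat (map \<sigma> vs) @ ys) \<phi> \<and>
     (\<forall>\<rho>\<in>envs M \<sigma>. P \<rho> \<longleftrightarrow> sat M \<phi> (concat (map \<rho> vs) @ b)))"

lemma envsI: "(\<And>v. \<rho> v \<in> tup M (\<sigma> v)) \<Longrightarrow> \<rho> \<in> envs M \<sigma>"
  by (simp add: envs_def)

lemma envsD: "\<rho> \<in> envs M \<sigma> \<Longrightarrow> \<rho> v \<in> tup M (\<sigma> v)"
  by (simp add: envs_def)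

lemma envs_upd: "\<rho> \<in> envs M \<sigma> \<Longrightarrow> x \<in> tup M (\<sigma> v) \<Longrightarrow> \<rho>(v := x) \<in> envs M \<sigma>"
  by (simp add: envs_def)

lemma dpI:
  assumes "set vs \<subseteq> W" "set b \<subseteq> A" "b \<in> tup M ys" "formula L (concat (map \<sigma> vs) @ ys) \<phi>"
    "\<And>\<rho>. \<rho> \<in> envs M \<sigma> \<Longrightarrow> P \<rho> \<longleftrightarrow> sat M \<phi> (concat (map \<rho> vs) @ b)"
  shows "dp L M A \<sigma> W P"
  unfolding dp_def using assms by blast

lemma dpE:
  assumes "dp L M A \<sigma> W P"
  obtains vs \<phi> b ys where "set vs \<subseteq> W" "set b \<subseteq> A" "b \<in> tup M ys"
    "formula L (concat (map \<sigma> vs) @ ys) \<phi>"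
    "\<And>\<rho>. \<rho> \<in> envs M \<sigma> \<Longrightarrow> P \<rho> \<longleftrightarrow> sat M \<phi> (concat (map \<rho> vs) @ b)"
  using assms unfolding dp_def by blast

section \<open>Normal forms and closure properties of definable predicates\<close>

lemma dp_formula:
  assumes "formula L (concat (map \<sigma> vs) @ ys) \<phi>" "b \<in> tup M ys" "set b \<subseteq> A" "set vs \<subseteq> W"
  shows "dp L M A \<sigma> W (\<lambda>\<rho>. sat M \<phi> (concat (map \<rho> vs) @ b))"
  unfolding dp_def using assms by blast

lemma dp_formula0:
  assumes "formula L (concat (map \<sigma> vs)) \<phi>" "set vs \<subseteq> W"
  shows "dp L M A \<sigma> W (\<lambda>\<rho>. sat M \<phi> (concat (map \<rho> vs)))"
  using dp_formula[of L \<sigma> vs "[]" \<phi> "[]" M A W] assms by simp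

lemma dp_mono:
  assumes "dp L M A \<sigma> W P" "A \<subseteq> B" "W \<subseteq> V"
  shows "dp L M B \<sigma> V P"
proof -
  obtain vs \<phi> b ys where *: "set vs \<subseteq> W" "set b \<subseteq> A" "b \<in> tup M ys"
    "formula L (concat (map \<sigma> vs) @ ys) \<phi>"
    "\<And>\<rho>. \<rho> \<in> envs M \<sigma> \<Longrightarrow> P \<rho> \<longleftrightarrow> sat M \<phi> (concat (map \<rho> vs) @ b)"
    by (rule dpE[OF assms(1)]) (rule that)
  show ?thesis by (rule dpI[OF _ _ *(3-5)]) (use * assms(2,3) in auto)
qed

lemma dp_cong:
  assumes "dp L M A \<sigma> W P" "\<And>\<rho>. \<rho> \<in> envs M \<sigma> \<Longrightarrow> P \<rho> \<longleftrightarrow> Q \<rho>"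
  shows "dp L M A \<sigma> W Q"
proof -
  obtain vs \<phi> b ys where *: "set vs \<subseteq> W" "set b \<subseteq> A" "b \<in> tup M ys"
    "formula L (concat (map \<sigma> vs) @ ys) \<phi>"
    "\<And>\<rho>. \<rho> \<in> envs M \<sigma> \<Longrightarrow> P \<rho> \<longleftrightarrow> sat M \<phi> (concat (map \<rho> vs) @ b)"
    by (rule dpE[OF assms(1)]) (rule that)
  show ?thesis by (rule dpI[OF *(1-4)]) (use * assms(2) in auto)
qed

lemma dp_supp:
  assumes "dp L M A \<sigma> W P" "\<rho> \<in> envs M \<sigma>" "\<rho>' \<in> envs M \<sigma>" "\<And>v. v \<in> W \<Longrightarrow> \<rho> v = \<rho>' v"
  shows "P \<rho> \<longleftrightarrow> P \<rho>'"
proof -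
  obtain vs \<phi> b ys where vs: "set vs \<subseteq> W" and "set b \<subseteq> A" "b \<in> tup M ys"
    "formula L (concat (map \<sigma> vs) @ ys) \<phi>" and P: "\<And>\<rho>. \<rho> \<in> envs M \<sigma> \<Longrightarrow> P \<rho> \<longleftrightarrow> sat M \<phi> (concat (map \<rho> vs) @ b)"
    by (rule dpE[OF assms(1)]) (rule that)
  have "map \<rho> vs = map \<rho>' vs" using assms(4) vs by auto
  with P assms(2,3) show ?thesis by (simp del: map_eq_conv)
qed

lemma dp_finite_supp:
  assumes "dp L M A \<sigma> W P"
  obtains V where "finite V" "V \<subseteq> W" "dp L M A \<sigma> V P"
proof -
  obtain vs \<phi> b ys where *: "set vs \<subseteq> W" "set b \<subseteq> A" "b \<in> tup M ys"
    "formula L (concat (map \<sigma> vs) @ ys) \<phi>"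
    "\<And>\<rho>. \<rho> \<in> envs M \<sigma> \<Longrightarrow> P \<rho> \<longleftrightarrow> sat M \<phi> (concat (map \<rho> vs) @ b)"
    by (rule dpE[OF assms]) (rule that)
  have "dp L M A \<sigma> (set vs) P" by (rule dpI[OF _ *(2-5)]) auto
  then show ?thesis using that[of "set vs"] *(1) by simp
qed

text \<open>The order of the variables in a witness of \<open>dp\<close> is arbitrary; binding or
  substituting one of them requires a prescribed order.\<close>

lemma dp_obtain:
  assumes "dp L M A \<sigma> W P" "finite W" "W \<subseteq> set ws" "set (concat (map \<sigma> ws)) \<subseteq> Sorts L"
  obtains \<phi> b ys where "set b \<subseteq> A" "b \<in> tup M ys" "formula L (concat (map \<sigma> ws) @ ys) \<phi>"
    "\<And>\<rho>. \<rho> \<in> envs M \<sigma> \<Longrightarrow> P \<rho> \<longleftrightarrow> sat M \<phi> (concat (map \<rho> ws) @ b)"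
proof -
  obtain vs \<phi> b ys where vs: "set vs \<subseteq> W" and b: "set b \<subseteq> A" "b \<in> tup M ys"
    and \<phi>: "formula L (concat (map \<sigma> vs) @ ys) \<phi>"
    and P: "\<And>\<rho>. \<rho> \<in> envs M \<sigma> \<Longrightarrow> P \<rho> \<longleftrightarrow> sat M \<phi> (concat (map \<rho> vs) @ b)"
    by (rule dpE[OF assms(1)]) (rule that)
  \<comment> \<open>The parameters become one more block, named \<open>None\<close>, so that the
    rearrangement of blocks can leave them at the end.\<close>
  define \<tau> where "\<tau> = case_option ys \<sigma>"
  have m: "map (case_option c h) (map Some us @ [None]) = map h us @ [c]" for c h and us :: "'b list"
    by simp
  have ysS: "set ys \<subseteq> Sorts L" using \<phi> by (simp add: formula_def)
  have 1: "formula L (concat (map \<tau> (map Some vs @ [None]))) \<phi>"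
    using \<phi> by (simp add: \<tau>_def comp_def)
  have 2: "set (map Some vs @ [None]) \<subseteq> set (map Some ws @ [None])" using vs assms(3) by auto
  have 3: "set (concat (map \<tau> (map Some ws @ [None]))) \<subseteq> Sorts L"
    using assms(4) ysS by (simp add: \<tau>_def comp_def)
  obtain \<phi>' where f: "formula L (concat (map \<tau> (map Some ws @ [None]))) \<phi>'"
    and s: "\<And>\<rho>. (\<And>v. \<rho> v \<in> tup M (\<tau> v)) \<Longrightarrow> sat M \<phi>' (concat (map \<rho> (map Some ws @ [None])))
      \<longleftrightarrow> sat M \<phi> (concat (map \<rho> (map Some vs @ [None])))"
    using formula_blocks[OF 1 2 3] by blast
  show ?thesis
  proof (rule that[OF b])
    show "formula L (concat (map \<sigma> ws) @ ys) \<phi>'" using f by (simp add: \<tau>_def comp_def)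
    fix \<rho> assume r: "\<rho> \<in> envs M \<sigma>"
    then have "case_option b \<rho> v \<in> tup M (\<tau> v)" for v
      using b by (auto simp: \<tau>_def envsD split: option.split)
    from s[OF this] show "P \<rho> \<longleftrightarrow> sat M \<phi>' (concat (map \<rho> ws) @ b)"
      using P r by (simp add: comp_def)
  qed
qed

lemma dp_obtain0:
  assumes "dp L M {} \<sigma> W P" "finite W" "W \<subseteq> set ws" "set (concat (map \<sigma> ws)) \<subseteq> Sorts L"
  obtains \<phi> where "formula L (concat (map \<sigma> ws)) \<phi>"
    "\<And>\<rho>. \<rho> \<in> envs M \<sigma> \<Longrightarrow> P \<rho> \<longleftrightarrow> sat M \<phi> (concat (map \<rho> ws))"
proof -
  obtain \<phi> b ys where *: "set b \<subseteq> {}" "b \<in> tup M ys" "formula L (concat (map \<sigma> ws) @ ys) \<phi>"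
    "\<And>\<rho>. \<rho> \<in> envs M \<sigma> \<Longrightarrow> P \<rho> \<longleftrightarrow> sat M \<phi> (concat (map \<rho> ws) @ b)"
    by (rule dp_obtain[OF assms]) (rule that)
  then have "b = []" "ys = []" by (auto simp: tup_nth)
  with * show ?thesis by (intro that[of \<phi>]) simp_all
qed

text \<open>The environment \<open>\<rho>'\<close> is demanded as a hypothesis because the variables
  outside \<open>W\<close> need values too, and for them a tuple of the right sorts may have to be
  invented.\<close>

lemma dp_rename:
  assumes P: "dp L M A \<sigma> W P" and \<tau>: "\<And>v. v \<in> W \<Longrightarrow> \<tau> (f v) = \<sigma> v"
    and Q: "\<And>\<rho>. \<rho> \<in> envs M \<tau> \<Longrightarrow> \<exists>\<rho>'\<in>envs M \<sigma>. (\<forall>v\<in>W. \<rho>' v = \<rho> (f v)) \<and> (P \<rho>' \<longleftrightarrow> Q \<rho>)"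
  shows "dp L M A \<tau> (f ` W) Q"
proof -
  obtain vs \<phi> b ys where vs: "set vs \<subseteq> W" and b: "set b \<subseteq> A" "b \<in> tup M ys"
    and \<phi>: "formula L (concat (map \<sigma> vs) @ ys) \<phi>"
    and P': "\<And>\<rho>. \<rho> \<in> envs M \<sigma> \<Longrightarrow> P \<rho> \<longleftrightarrow> sat M \<phi> (concat (map \<rho> vs) @ b)"
    by (rule dpE[OF P]) (rule that)
  have "map \<tau> (map f vs) = map \<sigma> vs" using \<tau> vs by auto
  then have "formula L (concat (map \<tau> (map f vs)) @ ys) \<phi>" using \<phi> by (simp only:)
  from dp_formula[OF this b(2,1), of "f ` W"] vs
  have "dp L M A \<tau> (f ` W) (\<lambda>\<rho>. sat M \<phi> (concat (map \<rho> (map f vs)) @ b))" by auto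
  then show ?thesis
  proof (rule dp_cong)
    fix \<rho> assume "\<rho> \<in> envs M \<tau>"
    from Q[OF this] obtain \<rho>' where r: "\<rho>' \<in> envs M \<sigma>" "\<forall>v\<in>W. \<rho>' v = \<rho> (f v)" "P \<rho>' \<longleftrightarrow> Q \<rho>"
      by blast
    then have "map \<rho> (map f vs) = map \<rho>' vs" using vs by auto
    with P' r show "sat M \<phi> (concat (map \<rho> (map f vs)) @ b) \<longleftrightarrow> Q \<rho>" by (simp only:)
  qed
qed

lemma dp_neg:
  assumes "dp L M A \<sigma> W P"
  shows "dp L M A \<sigma> W (\<lambda>\<rho>. \<not> P \<rho>)"
proof -
  obtain vs \<phi> b ys where *: "set vs \<subseteq> W" "set b \<subseteq> A" "b \<in> tup M ys"
    "formula L (concat (map \<sigma> vs) @ ys) \<phi>"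
    "\<And>\<rho>. \<rho> \<in> envs M \<sigma> \<Longrightarrow> P \<rho> \<longleftrightarrow> sat M \<phi> (concat (map \<rho> vs) @ b)"
    by (rule dpE[OF assms]) (rule that)
  have "formula L (concat (map \<sigma> vs) @ ys) (Neg \<phi>)" using *(4) by (simp add: formula_def)
  then show ?thesis by (rule dpI[OF *(1-3)]) (simp add: *(5))
qed

lemma dp_imp:
  fixes M :: "('s, 'f, 'r, 'm) struct" and \<sigma> :: "'v \<Rightarrow> 's list"
  assumes "dp L M A \<sigma> W P" "dp L M A \<sigma> W Q"
  shows "dp L M A \<sigma> W (\<lambda>\<rho>. P \<rho> \<longrightarrow> Q \<rho>)"
proof -
  obtain vs1 \<phi>1 b1 ys1 where 1: "set vs1 \<subseteq> W" "set b1 \<subseteq> A" "b1 \<in> tup M ys1"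
    "formula L (concat (map \<sigma> vs1) @ ys1) \<phi>1"
    "\<And>\<rho>. \<rho>\<in>envs M \<sigma> \<Longrightarrow> P \<rho> \<longleftrightarrow> sat M \<phi>1 (concat (map \<rho> vs1) @ b1)"
    by (rule dpE[OF assms(1)]) (rule that)
  obtain vs2 \<phi>2 b2 ys2 where 2: "set vs2 \<subseteq> W" "set b2 \<subseteq> A" "b2 \<in> tup M ys2"
    "formula L (concat (map \<sigma> vs2) @ ys2) \<phi>2"
    "\<And>\<rho>. \<rho>\<in>envs M \<sigma> \<Longrightarrow> Q \<rho> \<longleftrightarrow> sat M \<phi>2 (concat (map \<rho> vs2) @ b2)"
    by (rule dpE[OF assms(2)]) (rule that)
  \<comment> \<open>The variables keep their names under \<open>Inl\<close>; the two parameter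
    tuples are the blocks \<open>Inr True\<close> and \<open>Inr False\<close>, so that both
    formulas fit into one context.\<close>
  define \<tau> :: "'v + bool \<Rightarrow> 's list" where "\<tau> = case_sum \<sigma> (\<lambda>i. if i then ys1 else ys2)"
  let ?ws = "map Inl (vs1 @ vs2) @ [Inr True, Inr False]"
  have S: "set (concat (map \<tau> ?ws)) \<subseteq> Sorts L"
    using 1(4) 2(4) by (simp add: \<tau>_def comp_def formula_def)
  have f1: "formula L (concat (map \<tau> (map Inl vs1 @ [Inr True]))) \<phi>1"
    using 1(4) by (simp add: \<tau>_def comp_def)
  have f2: "formula L (concat (map \<tau> (map Inl vs2 @ [Inr False]))) \<phi>2"
    using 2(4) by (simp add: \<tau>_def comp_def)
  obtain \<psi>1 where p1: "formula L (concat (map \<tau> ?ws)) \<psi>1"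
    "\<And>\<rho>. (\<And>v. \<rho> v \<in> tup M (\<tau> v)) \<Longrightarrow> sat M \<psi>1 (concat (map \<rho> ?ws))
      \<longleftrightarrow> sat M \<phi>1 (concat (map \<rho> (map Inl vs1 @ [Inr True])))"
    using formula_blocks[OF f1 _ S, where M = M] by auto
  obtain \<psi>2 where p2: "formula L (concat (map \<tau> ?ws)) \<psi>2"
    "\<And>\<rho>. (\<And>v. \<rho> v \<in> tup M (\<tau> v)) \<Longrightarrow> sat M \<psi>2 (concat (map \<rho> ?ws))
      \<longleftrightarrow> sat M \<phi>2 (concat (map \<rho> (map Inl vs2 @ [Inr False])))"
    using formula_blocks[OF f2 _ S, where M = M] by auto
  have "formula L (concat (map \<sigma> (vs1 @ vs2)) @ (ys1 @ ys2)) (Imp \<psi>1 \<psi>2)"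
    using p1(1) p2(1) by (simp add: formula_def \<tau>_def comp_def)
  moreover have "b1 @ b2 \<in> tup M (ys1 @ ys2)" using 1(3) 2(3) by (rule tup_appendI)
  moreover have "set (b1 @ b2) \<subseteq> A" "set (vs1 @ vs2) \<subseteq> W" using 1(1,2) 2(1,2) by auto
  moreover have "(P \<rho> \<longrightarrow> Q \<rho>) \<longleftrightarrow> sat M (Imp \<psi>1 \<psi>2) (concat (map \<rho> (vs1 @ vs2)) @ (b1 @ b2))"
    if r: "\<rho> \<in> envs M \<sigma>" for \<rho>
  proof -
    let ?r = "case_sum \<rho> (\<lambda>i. if i then b1 else b2)"
    have "?r v \<in> tup M (\<tau> v)" for v
      using 1(3) 2(3) r by (auto simp: \<tau>_def envsD split: sum.split)
    from p1(2)[OF this] p2(2)[OF this] show ?thesis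
      using 1(5)[OF r] 2(5)[OF r] by (simp add: comp_def)
  qed
  ultimately show ?thesis unfolding dp_def by blast
qed

lemma dp_True: "dp L M A \<sigma> W (\<lambda>_. True)"
  using dp_formula0[of L \<sigma> "[]" "Imp Fls Fls" W M A] by (simp add: formula_def)

lemma dp_False: "dp L M A \<sigma> W (\<lambda>_. False)"
  using dp_neg[OF dp_True] by simp

lemma dp_const: "dp L M A \<sigma> W (\<lambda>_. c)"
  by (cases c) (simp_all add: dp_True dp_False)

lemma dp_disj:
  assumes "dp L M A \<sigma> W P" "dp L M A \<sigma> W Q"
  shows "dp L M A \<sigma> W (\<lambda>\<rho>. P \<rho> \<or> Q \<rho>)"
  using dp_imp[OF dp_neg[OF assms(1)] assms(2)] by (rule dp_cong) auto

lemma dp_conj: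
  assumes "dp L M A \<sigma> W P" "dp L M A \<sigma> W Q"
  shows "dp L M A \<sigma> W (\<lambda>\<rho>. P \<rho> \<and> Q \<rho>)"
  using dp_neg[OF dp_imp[OF assms(1) dp_neg[OF assms(2)]]] by (rule dp_cong) auto

lemma dp_iff:
  assumes "dp L M A \<sigma> W P" "dp L M A \<sigma> W Q"
  shows "dp L M A \<sigma> W (\<lambda>\<rho>. P \<rho> \<longleftrightarrow> Q \<rho>)"
  using dp_conj[OF dp_imp[OF assms] dp_imp[OF assms(2,1)]] by (rule dp_cong) auto

lemma dp_ball_finite:
  "finite I \<Longrightarrow> (\<And>i. i \<in> I \<Longrightarrow> dp L M A \<sigma> W (P i)) \<Longrightarrow> dp L M A \<sigma> W (\<lambda>\<rho>. \<forall>i\<in>I. P i \<rho>)"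
  by (induction I rule: finite_induct) (auto simp: dp_True intro: dp_conj)

lemma dp_bex_finite:
  "finite I \<Longrightarrow> (\<And>i. i \<in> I \<Longrightarrow> dp L M A \<sigma> W (P i)) \<Longrightarrow> dp L M A \<sigma> W (\<lambda>\<rho>. \<exists>i\<in>I. P i \<rho>)"
  by (induction I rule: finite_induct) (auto simp: dp_False intro: dp_disj)

lemma dp_ex:
  fixes M :: "('s, 'f, 'r, 'm) struct" and \<sigma> :: "'v \<Rightarrow> 's list"
  assumes "dp L M A \<sigma> W P"
  shows "dp L M A \<sigma> (W - {v}) (\<lambda>\<rho>. \<exists>x\<in>tup M (\<sigma> v). P (\<rho>(v := x)))"
proof -
  obtain vs \<phi> b ys where 1: "set vs \<subseteq> W" "set b \<subseteq> A" "b \<in> tup M ys"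
    "formula L (concat (map \<sigma> vs) @ ys) \<phi>"
    "\<And>\<rho>. \<rho>\<in>envs M \<sigma> \<Longrightarrow> P \<rho> \<longleftrightarrow> sat M \<phi> (concat (map \<rho> vs) @ b)"
    by (rule dpE[OF assms]) (rule that)
  show ?thesis
  proof (cases "v \<in> set vs")
    case False
    then have "map (\<rho>(v := x)) vs = map \<rho> vs" for \<rho> x by auto
    \<comment> \<open>The quantifier is vacuous here; its range contains \<open>\<rho> v\<close>,
      hence it is not empty.\<close>
    then have eq: "(\<exists>x\<in>tup M (\<sigma> v). P (\<rho>(v := x))) \<longleftrightarrow> P \<rho>" if "\<rho> \<in> envs M \<sigma>" for \<rho>
      using 1(5) that envs_upd[OF that] envsD[OF that] by metis
    have "set vs \<subseteq> W - {v}" using 1(1) False by auto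
    then have "dp L M A \<sigma> (W - {v}) P" unfolding dp_def using 1 by blast
    then show ?thesis by (rule dp_cong) (simp add: eq)
  next
    case True
    define us where "us = filter (\<lambda>w. w \<noteq> v) vs"
    have vn: "v \<notin> set us" by (auto simp: us_def)
    have S: "set (concat (map \<sigma> (v # us))) \<subseteq> Sorts L"
      using 1(4) True by (auto simp: formula_def us_def)
    have d: "dp L M A \<sigma> (set vs) P" unfolding dp_def using 1 by blast
    have sub: "set vs \<subseteq> set (v # us)" by (auto simp: us_def)
    obtain \<psi> c zs where 2: "set c \<subseteq> A" "c \<in> tup M zs" "formula L (concat (map \<sigma> (v # us)) @ zs) \<psi>"
      "\<And>\<rho>. \<rho>\<in>envs M \<sigma> \<Longrightarrow> P \<rho> \<longleftrightarrow> sat M \<psi> (concat (map \<rho> (v # us)) @ c)"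
      by (rule dp_obtain[OF d finite_set sub S]) (rule that)
    have "formula L (concat (map \<sigma> us) @ zs) (Exs (\<sigma> v) \<psi>)"
      using 2(3) by (intro formula_Exs) simp
    moreover have "(\<exists>x\<in>tup M (\<sigma> v). P (\<rho>(v := x))) \<longleftrightarrow> sat M (Exs (\<sigma> v) \<psi>) (concat (map \<rho> us) @ c)"
      if r: "\<rho> \<in> envs M \<sigma>" for \<rho>
    proof -
      have "map (\<rho>(v := x)) us = map \<rho> us" for x using vn by auto
      then have "P (\<rho>(v := x)) \<longleftrightarrow> sat M \<psi> (x @ concat (map \<rho> us) @ c)" if "x \<in> tup M (\<sigma> v)" for x
        using 2(4)[OF envs_upd[OF r that]] by (simp del: map_eq_conv)
      then show ?thesis by (simp add: sat_Exs)
    qed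
    moreover have "set us \<subseteq> W - {v}" using 1(1) by (auto simp: us_def)
    ultimately show ?thesis unfolding dp_def using 2(1,2) by blast
  qed
qed

lemma dp_all:
  assumes "dp L M A \<sigma> W P"
  shows "dp L M A \<sigma> (W - {v}) (\<lambda>\<rho>. \<forall>x\<in>tup M (\<sigma> v). P (\<rho>(v := x)))"
  using dp_neg[OF dp_ex[OF dp_neg[OF assms], of v]] by (rule dp_cong) auto

lemma dp_inst:
  fixes M :: "('s, 'f, 'r, 'm) struct" and \<sigma> :: "'v \<Rightarrow> 's list"
  assumes "dp L M A \<sigma> W P" "u \<in> tup M (\<sigma> v)" "set u \<subseteq> A"
  shows "dp L M A \<sigma> (W - {v}) (\<lambda>\<rho>. P (\<rho>(v := u)))"
proof -
  obtain vs \<phi> b ys where 1: "set vs \<subseteq> W" "set b \<subseteq> A" "b \<in> tup M ys"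
    "formula L (concat (map \<sigma> vs) @ ys) \<phi>"
    "\<And>\<rho>. \<rho>\<in>envs M \<sigma> \<Longrightarrow> P \<rho> \<longleftrightarrow> sat M \<phi> (concat (map \<rho> vs) @ b)"
    by (rule dpE[OF assms(1)]) (rule that)
  define us where "us = filter (\<lambda>w. w \<noteq> v) vs"
  have vn: "v \<notin> set us" by (auto simp: us_def)
  show ?thesis
  proof (cases "v \<in> set vs")
    case False
    then have "map (\<rho>(v := u)) vs = map \<rho> vs" for \<rho> by auto
    then have eq: "P (\<rho>(v := u)) \<longleftrightarrow> P \<rho>" if "\<rho> \<in> envs M \<sigma>" for \<rho>
      using 1(5) that envs_upd[OF that assms(2)] by metis
    have "set vs \<subseteq> W - {v}" using 1(1) False by auto
    then have "dp L M A \<sigma> (W - {v}) P" unfolding dp_def using 1 by blast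
    then show ?thesis by (rule dp_cong) (simp add: eq)
  next
    case True
    \<comment> \<open>With \<open>v\<close> listed last, its block touches the parameters, and
      regrouping the context makes it a part of them.\<close>
    have S: "set (concat (map \<sigma> (us @ [v]))) \<subseteq> Sorts L"
      using 1(4) True by (auto simp: formula_def us_def)
    have d: "dp L M A \<sigma> (set vs) P" unfolding dp_def using 1 by blast
    have sub: "set vs \<subseteq> set (us @ [v])" by (auto simp: us_def)
    obtain \<psi> c zs where 2: "set c \<subseteq> A" "c \<in> tup M zs" "formula L (concat (map \<sigma> (us @ [v])) @ zs) \<psi>"
      "\<And>\<rho>. \<rho>\<in>envs M \<sigma> \<Longrightarrow> P \<rho> \<longleftrightarrow> sat M \<psi> (concat (map \<rho> (us @ [v])) @ c)"
      by (rule dp_obtain[OF d finite_set sub S]) (rule that)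
    have "formula L (concat (map \<sigma> us) @ (\<sigma> v @ zs)) \<psi>" using 2(3) by simp
    moreover have "u @ c \<in> tup M (\<sigma> v @ zs)" using 2(2) assms(2) by (simp add: tup_appendI)
    moreover have "P (\<rho>(v := u)) \<longleftrightarrow> sat M \<psi> (concat (map \<rho> us) @ (u @ c))"
      if r: "\<rho> \<in> envs M \<sigma>" for \<rho>
    proof -
      have "map (\<rho>(v := u)) us = map \<rho> us" using vn by auto
      then show ?thesis using 2(4)[OF envs_upd[OF r assms(2)]] by (simp del: map_eq_conv)
    qed
    moreover have "set us \<subseteq> W - {v}" using 1(1) by (auto simp: us_def)
    moreover have "set (u @ c) \<subseteq> A" using 2(1) assms(3) by simp
    ultimately show ?thesis unfolding dp_def by blast
  qed
qed

section \<open>A nonprincipal ultrafilter\<close>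

text \<open>Zorn's lemma for the proper filters below \<open>sequentially\<close>, where finer
  filters count as larger. A nonempty chain is bounded by its infimum, which is proper because an
  event holds eventually in it only if it does in some member.\<close>

lemma ex_ultrafilter:
  "\<exists>U :: nat filter. U \<le> sequentially \<and> U \<noteq> bot \<and>
     (\<forall>P. eventually P U \<or> eventually (\<lambda>i. \<not> P i) U)"
proof -
  define F where "F = {U :: nat filter. U \<le> sequentially \<and> U \<noteq> bot}"
  have "\<exists>U\<in>F. \<forall>V\<in>F. V \<le> U \<longrightarrow> V = U"
  proof (rule predicate_Zorn[where P = "\<lambda>U V. V \<le> U"])
    show "partial_order_on F (relation_of (\<lambda>U V. V \<le> U) F)"
      by (auto simp: relation_of_def partial_order_on_def preorder_on_def refl_on_def trans_def antisym_def)
    fix C assume C: "C \<in> Chains (relation_of (\<lambda>U V. V \<le> U) F)"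
    then have CF: "C \<subseteq> F" and ch: "\<And>U V. U \<in> C \<Longrightarrow> V \<in> C \<Longrightarrow> U \<le> V \<or> V \<le> U"
      by (auto simp: Chains_def relation_of_def)
    show "\<exists>U\<in>F. \<forall>V\<in>C. U \<le> V"
    proof (cases "C = {}")
      case True
      have "sequentially \<in> F" by (simp add: F_def)
      then show ?thesis using True by auto
    next
      case False
      have "eventually P (Inf C) \<longleftrightarrow> (\<exists>b\<in>C. eventually P b)" for P
        using False by (rule eventually_Inf_base) (metis ch inf.absorb1 inf.absorb2 order_refl)
      then have "Inf C \<noteq> bot"
        using CF by (auto simp: F_def trivial_limit_def)
      moreover have "Inf C \<le> sequentially"
        using False CF by (auto simp: F_def intro: Inf_lower2)
      ultimately show ?thesis by (intro bexI[of _ "Inf C"]) (auto simp: F_def intro: Inf_lower)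
    qed
  qed
  then obtain U where U: "U \<in> F" and max: "\<And>V. V \<in> F \<Longrightarrow> V \<le> U \<Longrightarrow> V = U" by blast
  have "eventually P U \<or> eventually (\<lambda>i. \<not> P i) U" for P
  proof (rule ccontr)
    assume n: "\<not> ?thesis"
    \<comment> \<open>Restricting the filter to \<open>P\<close> keeps it proper, since
      \<open>\<not> P\<close> is not eventual. Minimality then forces \<open>P\<close> to be
      eventual, which it is not.\<close>
    define V where "V = inf U (principal {i. P i})"
    have ev: "eventually Q V \<longleftrightarrow> eventually (\<lambda>i. P i \<longrightarrow> Q i) U" for Q
      by (simp add: V_def eventually_inf_principal)
    have "V \<noteq> bot" using n ev[of "\<lambda>_. False"] by (auto simp: trivial_limit_def)
    then have "V \<in> F" using U by (auto simp: F_def V_def intro: le_infI1)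
    then have "V = U" by (rule max) (simp add: V_def)
    then show False using ev[of P] n by simp
  qed
  with U show ?thesis by (auto simp: F_def)
qed

definition ulim :: "nat filter" where
  "ulim = (SOME U. U \<le> sequentially \<and> U \<noteq> bot \<and>
     (\<forall>P. eventually P U \<or> eventually (\<lambda>i. \<not> P i) U))"

lemma ulim: "ulim \<le> sequentially" "ulim \<noteq> bot"
  "eventually P ulim \<or> eventually (\<lambda>i. \<not> P i) ulim"
  using someI_ex[OF ex_ultrafilter, folded ulim_def] by blast+

lemma ev_not: "(\<forall>\<^sub>F i in ulim. \<not> P i) \<longleftrightarrow> \<not> (\<forall>\<^sub>F i in ulim. P i)"
proof
  assume "\<forall>\<^sub>F i in ulim. \<not> P i"
  show "\<not> (\<forall>\<^sub>F i in ulim. P i)"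
  proof
    assume "\<forall>\<^sub>F i in ulim. P i"
    with \<open>\<forall>\<^sub>F i in ulim. \<not> P i\<close> have "\<forall>\<^sub>F i in ulim. False" by eventually_elim simp
    then show False using ulim(2) by (simp add: trivial_limit_def)
  qed
qed (use ulim(3) in blast)

lemma ev_const [simp]: "(\<forall>\<^sub>F i in ulim. c) \<longleftrightarrow> c"
  using ulim(2) by (cases c) (auto simp: trivial_limit_def)

lemma ev_gt: "\<forall>\<^sub>F i in ulim. n < i"
  using ulim(1) eventually_gt_at_top[of n] by (rule filter_leD)

lemma ev_ex: "(\<forall>\<^sub>F i in ulim. P i) \<Longrightarrow> \<exists>i. P i"
  using ulim(2) eventually_happens by blast

text \<open>A truth value converges along an ultrafilter. Taken for finitely many parameters at
  once, this gives a single index that already decides all of them as the limit does.\<close>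

lemma ev_iff_ev: "\<forall>\<^sub>F i in ulim. P i \<longleftrightarrow> (\<forall>\<^sub>F i in ulim. P i)"
proof (cases "\<forall>\<^sub>F i in ulim. P i")
  case True
  then show ?thesis by eventually_elim (simp add: True)
next
  case False
  then have "\<forall>\<^sub>F i in ulim. \<not> P i" by (simp add: ev_not)
  then show ?thesis by eventually_elim (simp add: False)
qed

text \<open>Course-of-values recursion with a choice at each stage. The first hypothesis says that
  stage \<open>k\<close> looks only at the earlier values, so \<open>f\<close> may be arbitrary from
  \<open>k\<close> on.\<close>

lemma seq_choice:
  fixes P :: "(nat \<Rightarrow> 'b) \<Rightarrow> nat \<Rightarrow> 'b \<Rightarrow> bool"
  assumes "\<And>f g k r. (\<And>j. j < k \<Longrightarrow> f j = g j) \<Longrightarrow> P f k r \<longleftrightarrow> P g k r"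
    and "\<And>k f. (\<And>j. j < k \<Longrightarrow> P f j (f j)) \<Longrightarrow> \<exists>r. P f k r"
  shows "\<exists>f. \<forall>k. P f k (f k)"
proof (rule dependent_wf_choice[where R = less_than])
  show "P f k r \<longleftrightarrow> P g k r" if "\<And>j. (j, k) \<in> less_than \<Longrightarrow> f j = g j" for f g k r
    by (rule assms(1)) (simp add: that)
  show "\<exists>r. P f k r" if "\<And>j. (j, k) \<in> less_than \<Longrightarrow> P f j (f j)" for f k
    by (rule assms(2)) (simp add: that)
qed simp

section \<open>Types as families of definable sets\<close>

text \<open>Definable sets are kept as predicates, which makes types extensional: formulas with the
  same solutions need not be told apart, and closure properties can be read off from
  \<open>dp\<close>.\<close>

definition dset :: "('s, 'f, 'r) lang \<Rightarrow> ('s, 'f, 'r, 'm) struct \<Rightarrow> 'm set \<Rightarrow> 's list \<Rightarrow>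
    ('m list \<Rightarrow> bool) \<Rightarrow> bool" where
  "dset L M A xs X \<longleftrightarrow> (\<exists>(\<phi>, b)\<in>pformulas L M xs A. \<forall>x\<in>tup M xs. X x \<longleftrightarrow> sat M \<phi> (x @ b))"

lemma dsetE:
  assumes "dset L M A xs X"
  obtains \<phi> b ys where "set b \<subseteq> A" "b \<in> tup M ys" "formula L (xs @ ys) \<phi>"
    "\<And>x. x \<in> tup M xs \<Longrightarrow> X x \<longleftrightarrow> sat M \<phi> (x @ b)"
  using assms unfolding dset_def pformulas_def by blast

lemma dsetI:
  assumes "set b \<subseteq> A" "b \<in> tup M ys" "formula L (xs @ ys) \<phi>"
    "\<And>x. x \<in> tup M xs \<Longrightarrow> X x \<longleftrightarrow> sat M \<phi> (x @ b)"
  shows "dset L M A xs X"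
  using assms unfolding dset_def pformulas_def by blast

lemma dset_mono:
  assumes "dset L M A xs X" "A \<subseteq> B"
  shows "dset L M B xs X"
proof -
  obtain \<phi> b ys where *: "set b \<subseteq> A" "b \<in> tup M ys" "formula L (xs @ ys) \<phi>"
    "\<And>x. x \<in> tup M xs \<Longrightarrow> X x \<longleftrightarrow> sat M \<phi> (x @ b)"
    by (rule dsetE[OF assms(1)]) (rule that)
  show ?thesis by (rule dsetI[OF _ *(2-4)]) (use *(1) assms(2) in auto)
qed

lemma dset_sorts: "dset L M A xs X \<Longrightarrow> set xs \<subseteq> Sorts L"
  by (auto simp: dset_def pformulas_def formula_def)

lemma dset_dp:
  assumes "dset L M A (\<sigma> v) X" "v \<in> W"
  shows "dp L M A \<sigma> W (\<lambda>\<rho>. X (\<rho> v))"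
proof -
  obtain \<phi> b ys where *: "set b \<subseteq> A" "b \<in> tup M ys" "formula L (\<sigma> v @ ys) \<phi>"
    "\<And>x. x \<in> tup M (\<sigma> v) \<Longrightarrow> X x \<longleftrightarrow> sat M \<phi> (x @ b)"
    by (rule dsetE[OF assms(1)]) (rule that)
  show ?thesis
    by (rule dpI[where vs = "[v]", OF _ *(1,2)]) (use * assms(2) in \<open>auto simp: envsD\<close>)
qed

text \<open>All variables but \<open>v\<close> are frozen, and their values join the parameters.
  This leads from predicates of many variables to conditions on one tuple, which are what a type
  decides.\<close>

lemma dp_dset:
  assumes P: "dp L M A \<sigma> W P" and \<rho>: "\<rho> \<in> envs M \<sigma>" and xs: "\<sigma> v = xs" "set xs \<subseteq> Sorts L"
    and B: "\<And>w. w \<in> W \<Longrightarrow> w \<noteq> v \<Longrightarrow> set (\<rho> w) \<subseteq> B" "A \<subseteq> B"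
  shows "dset L M B xs (\<lambda>x. P (\<rho>(v := x)))"
proof -
  obtain vs \<phi> b ys where *: "set vs \<subseteq> W" "set b \<subseteq> A" "b \<in> tup M ys"
    "formula L (concat (map \<sigma> vs) @ ys) \<phi>"
    "\<And>\<rho>. \<rho> \<in> envs M \<sigma> \<Longrightarrow> P \<rho> \<longleftrightarrow> sat M \<phi> (concat (map \<rho> vs) @ b)"
    by (rule dpE[OF P]) (rule that)
  define us where "us = filter (\<lambda>w. w \<noteq> v) vs"
  have d: "dp L M A \<sigma> (set vs) P" by (rule dpI[OF _ *(2-5)]) auto
  have sub: "set vs \<subseteq> set (v # us)" by (auto simp: us_def)
  have S: "set (concat (map \<sigma> (v # us))) \<subseteq> Sorts L"
    using *(4) xs by (auto simp: formula_def us_def)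
  obtain \<psi> c zs where 2: "set c \<subseteq> A" "c \<in> tup M zs" "formula L (concat (map \<sigma> (v # us)) @ zs) \<psi>"
    "\<And>\<rho>. \<rho>\<in>envs M \<sigma> \<Longrightarrow> P \<rho> \<longleftrightarrow> sat M \<psi> (concat (map \<rho> (v # us)) @ c)"
    by (rule dp_obtain[OF d finite_set sub S]) (rule that)
  show ?thesis
  proof (rule dsetI)
    show "set (concat (map \<rho> us) @ c) \<subseteq> B" using 2(1) B *(1) by (auto simp: us_def)
    show "concat (map \<rho> us) @ c \<in> tup M (concat (map \<sigma> us) @ zs)"
      using 2(2) \<rho> by (intro tup_appendI tup_concat) (auto simp: envsD)
    show "formula L (xs @ concat (map \<sigma> us) @ zs) \<psi>" using 2(3) xs(1) by simp
    fix x assume x: "x \<in> tup M xs"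
    have "map (\<rho>(v := x)) us = map \<rho> us" by (auto simp: us_def)
    then show "P (\<rho>(v := x)) \<longleftrightarrow> sat M \<psi> (x @ concat (map \<rho> us) @ c)"
      using 2(4)[OF envs_upd[OF \<rho>]] x xs(1) by (simp del: map_eq_conv)
  qed
qed

lemma dset_plug:
  assumes "dset L M A (xs @ zs) Y" "n \<in> tup M zs" "set n \<subseteq> B" "A \<subseteq> B"
  shows "dset L M B xs (\<lambda>x. Y (x @ n))"
proof -
  obtain \<phi> b ys where f: "set b \<subseteq> A" "b \<in> tup M ys" "formula L ((xs @ zs) @ ys) \<phi>"
    "\<And>x. x \<in> tup M (xs @ zs) \<Longrightarrow> Y x \<longleftrightarrow> sat M \<phi> (x @ b)"
    by (rule dsetE[OF assms(1)]) (rule that)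
  show ?thesis
  proof (rule dsetI)
    show "set (n @ b) \<subseteq> B" using f(1) assms(3,4) by auto
    show "n @ b \<in> tup M (zs @ ys)" using assms(2) f(2) by (rule tup_appendI)
    show "formula L (xs @ zs @ ys) \<phi>" using f(3) by simp
    fix x assume "x \<in> tup M xs"
    then show "Y (x @ n) \<longleftrightarrow> sat M \<phi> (x @ n @ b)" using f(4)[OF tup_appendI] assms(2) by simp
  qed
qed

lemma dset_plug_left:
  assumes "dset L M A (xs @ zs) Y" "x \<in> tup M xs" "set x \<subseteq> B" "A \<subseteq> B"
  shows "dset L M B zs (\<lambda>n. Y (x @ n))"
\<comment> \<open>The right block needs some value to start from; if its sorts admit no tuple, any
  formula in the right context will do.\<close>
proof (cases "tup M zs = {}")
  case True
  then show ?thesis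
    using dsetI[of "[]" B M "[]" L zs Fls] dset_sorts[OF assms(1)] by (simp add: formula_def)
next
  case False
  then obtain n0 where n0: "n0 \<in> tup M zs" by blast
  obtain \<phi> b ys where f: "set b \<subseteq> A" "b \<in> tup M ys" "formula L ((xs @ zs) @ ys) \<phi>"
    "\<And>x. x \<in> tup M (xs @ zs) \<Longrightarrow> Y x \<longleftrightarrow> sat M \<phi> (x @ b)"
    by (rule dsetE[OF assms(1)]) (rule that)
  let ?\<sigma> = "case_bool xs zs"
  have "dp L M A ?\<sigma> UNIV (\<lambda>\<rho>. sat M \<phi> (concat (map \<rho> [True, False]) @ b))"
    using f(1-3) by (intro dp_formula[where ys = ys]) auto
  then have "dset L M B zs (\<lambda>n. sat M \<phi> (concat (map ((case_bool x n0)(False := n)) [True, False]) @ b))"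
    by (rule dp_dset) (use assms(2-4) n0 dset_sorts[OF assms(1)] in \<open>auto simp: envs_def split: bool.splits\<close>)
  then have *: "dset L M B zs (\<lambda>n. sat M \<phi> (x @ n @ b))" by simp
  obtain \<psi> c ws where p: "set c \<subseteq> B" "c \<in> tup M ws" "formula L (zs @ ws) \<psi>"
    "\<And>n. n \<in> tup M zs \<Longrightarrow> sat M \<phi> (x @ n @ b) \<longleftrightarrow> sat M \<psi> (n @ c)"
    by (rule dsetE[OF *]) (rule that)
  show ?thesis
  proof (rule dsetI[OF p(1-3)])
    fix n assume n: "n \<in> tup M zs"
    show "Y (x @ n) \<longleftrightarrow> sat M \<psi> (n @ c)" using f(4)[OF tup_appendI[OF assms(2) n]] p(4)[OF n] by simp
  qed
qed

lemma tp_eq_iff: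
  assumes "a \<in> tup M xs" "a' \<in> tup M xs"
  shows "tp L M xs a A = tp L M xs a' A \<longleftrightarrow> (\<forall>X. dset L M A xs X \<longrightarrow> (X a \<longleftrightarrow> X a'))"
proof
  assume eq: "tp L M xs a A = tp L M xs a' A"
  show "\<forall>X. dset L M A xs X \<longrightarrow> (X a \<longleftrightarrow> X a')"
  proof (intro allI impI)
    fix X assume "dset L M A xs X"
    then obtain \<phi> b where f: "(\<phi>, b) \<in> pformulas L M xs A"
      and X: "\<forall>x\<in>tup M xs. X x \<longleftrightarrow> sat M \<phi> (x @ b)" unfolding dset_def by blast
    have "(\<phi>, b) \<in> tp L M xs a A \<longleftrightarrow> (\<phi>, b) \<in> tp L M xs a' A" using eq by simp
    then show "X a \<longleftrightarrow> X a'" using f X assms by (simp add: tp_def)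
  qed
next
  assume X: "\<forall>X. dset L M A xs X \<longrightarrow> (X a \<longleftrightarrow> X a')"
  have "sat M \<phi> (a @ b) \<longleftrightarrow> sat M \<phi> (a' @ b)" if "(\<phi>, b) \<in> pformulas L M xs A" for \<phi> b
    using X[rule_format, of "\<lambda>x. sat M \<phi> (x @ b)"] that unfolding dset_def by blast
  then show "tp L M xs a A = tp L M xs a' A" by (auto simp: tp_def)
qed

section \<open>Saturated structures\<close>

lemma infinite_Field: "Card_order \<kappa> \<Longrightarrow> |UNIV :: nat set| <o \<kappa> \<Longrightarrow> infinite (Field \<kappa>)"
proof -
  assume "Card_order \<kappa>" "|UNIV :: nat set| <o \<kappa>"
  then have "|UNIV :: nat set| \<le>o |Field \<kappa>|"
    using card_of_Field_ordIso[of \<kappa>] by (meson ordLess_imp_ordLeq ordIso_symmetric ordLeq_ordIso_trans)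
  then show ?thesis using card_of_ordLeq_infinite infinite_UNIV_nat by blast
qed

text \<open>What the argument asks of a structure, isolated because it will be applied to the
  structure of imaginaries. Saturation is stated for tuples and definable sets, and
  \<open>dom_disj\<close> lets an element determine its sort.\<close>

locale saturated_struct =
  fixes L :: "('s, 'f, 'r) lang" and M :: "('s, 'f, 'r, 'm) struct" and \<kappa> :: "'k rel"
  assumes dom_disj: "s \<in> Sorts L \<Longrightarrow> t \<in> Sorts L \<Longrightarrow> x \<in> dom M s \<Longrightarrow> x \<in> dom M t \<Longrightarrow> s = t"
    and card_order: "Card_order \<kappa>" and nat_less: "|UNIV :: nat set| <o \<kappa>"
    and realize: "\<And>B xs Xs. small L \<kappa> M B \<Longrightarrow> set xs \<subseteq> Sorts L \<Longrightarrow>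
      (\<And>X. X \<in> Xs \<Longrightarrow> dset L M B xs X) \<Longrightarrow>
      (\<And>F. F \<subseteq> Xs \<Longrightarrow> finite F \<Longrightarrow> \<exists>x\<in>tup M xs. \<forall>X\<in>F. X x) \<Longrightarrow> \<exists>x\<in>tup M xs. \<forall>X\<in>Xs. X x"
begin

abbreviation "D \<equiv> dp L M"
abbreviation "DS \<equiv> dset L M"
abbreviation "sml \<equiv> small L \<kappa> M"

lemma small_Un: "sml A \<Longrightarrow> sml B \<Longrightarrow> sml (A \<union> B)"
  using card_of_Un_ordLess_infinite_Field[OF infinite_Field[OF card_order nat_less] card_order]
  by (auto simp: small_def)

lemma small_countable: "countable A \<Longrightarrow> A \<subseteq> universe L M \<Longrightarrow> sml A"
proof -
  assume A: "countable A" "A \<subseteq> universe L M"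
  then have "|A| \<le>o |UNIV :: nat set|" by (auto elim!: countableE intro: card_of_ordLeqI)
  then show ?thesis using A nat_less ordLeq_ordLess_trans by (auto simp: small_def)
qed

lemma small_tup: "a \<in> tup M xs \<Longrightarrow> set xs \<subseteq> Sorts L \<Longrightarrow> sml (set a)"
  by (intro small_countable set_tup countable_finite) auto

lemma small_UN: "(\<And>i. a i \<in> tup M xs) \<Longrightarrow> set xs \<subseteq> Sorts L \<Longrightarrow> sml (\<Union>i\<in>I. set (a i))" for I :: "nat set"
  using set_tup by (intro small_countable countable_UN) (auto intro: countable_finite, blast)

section \<open>Average types\<close>

text \<open>\<open>h\<close> realizes over \<open>B\<close> the limit of the types of the
  \<open>al i\<close> along \<open>ulim\<close>. This limit type is finitely satisfiable in the
  sequence.\<close>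

definition avg :: "'s list \<Rightarrow> (nat \<Rightarrow> 'm list) \<Rightarrow> 'm set \<Rightarrow> 'm list \<Rightarrow> bool" where
  "avg xs al B h \<longleftrightarrow> h \<in> tup M xs \<and>
     (\<forall>X. DS B xs X \<longrightarrow> (X h \<longleftrightarrow> (\<forall>\<^sub>F i in ulim. X (al i))))"

lemma avg_tup: "avg xs al B h \<Longrightarrow> h \<in> tup M xs"
  by (simp add: avg_def)

lemma avg_mono: "avg xs al B h \<Longrightarrow> C \<subseteq> B \<Longrightarrow> avg xs al C h"
  unfolding avg_def using dset_mono by blast

lemma ev_not_DS: "DS B xs X \<Longrightarrow> DS B xs (\<lambda>x. \<not> X x)"
proof -
  assume "DS B xs X"
  then obtain \<phi> b ys where *: "set b \<subseteq> B" "b \<in> tup M ys" "formula L (xs @ ys) \<phi>"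
    "\<And>x. x \<in> tup M xs \<Longrightarrow> X x \<longleftrightarrow> sat M \<phi> (x @ b)"
    by (rule dsetE) (rule that)
  from *(3) have "formula L (xs @ ys) (Neg \<phi>)" by (simp add: formula_def)
  then show ?thesis by (rule dsetI[OF *(1,2)]) (simp add: *(4))
qed

text \<open>Each finite part of the average type is realized in the sequence itself, at an index
  where its finitely many conditions hold together.\<close>

lemma avg_exists:
  assumes "sml B" "set xs \<subseteq> Sorts L" "\<And>i. al i \<in> tup M xs"
  shows "\<exists>h. avg xs al B h"
proof -
  let ?Xs = "{X. DS B xs X \<and> (\<forall>\<^sub>F i in ulim. X (al i))}"
  have "\<exists>h\<in>tup M xs. \<forall>X\<in>?Xs. X h"
  proof (rule realize[OF assms(1,2)])
    fix F assume F: "F \<subseteq> ?Xs" "finite F"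
    then have "\<forall>\<^sub>F i in ulim. \<forall>X\<in>F. X (al i)" by (intro eventually_ball_finite) auto
    then obtain i where "\<forall>X\<in>F. X (al i)" using ev_ex by blast
    with assms(3) show "\<exists>x\<in>tup M xs. \<forall>X\<in>F. X x" by blast
  qed simp
  then obtain h where h: "h \<in> tup M xs" "\<And>X. DS B xs X \<Longrightarrow> \<forall>\<^sub>F i in ulim. X (al i) \<Longrightarrow> X h" by blast
  have "X h \<longleftrightarrow> (\<forall>\<^sub>F i in ulim. X (al i))" if "DS B xs X" for X
    using h(2)[OF that] h(2)[OF ev_not_DS[OF that]] by (auto simp: ev_not)
  with h(1) show ?thesis by (auto simp: avg_def)
qed

lemma avg_dp:
  assumes "avg xs al B h" "D A \<sigma> W P" "\<sigma> v = xs" "set xs \<subseteq> Sorts L" "\<rho> \<in> envs M \<sigma>"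
    "\<And>w. w \<in> W \<Longrightarrow> w \<noteq> v \<Longrightarrow> set (\<rho> w) \<subseteq> B" "A \<subseteq> B"
  shows "P (\<rho>(v := h)) \<longleftrightarrow> (\<forall>\<^sub>F i in ulim. P (\<rho>(v := al i)))"
  using dp_dset[OF assms(2,5,3,4,6,7)] assms(1) by (auto simp: avg_def)

text \<open>When \<open>B\<close> contains \<open>al\<close>, this is a coheir sequence: every entry
  realizes, over \<open>B\<close> and its predecessors, the same global type finitely satisfiable in
  \<open>al\<close>.\<close>

definition morley :: "'s list \<Rightarrow> (nat \<Rightarrow> 'm list) \<Rightarrow> 'm set \<Rightarrow> (nat \<Rightarrow> 'm list) \<Rightarrow> bool" where
  "morley xs al B g \<longleftrightarrow> (\<forall>k. avg xs al (B \<union> (\<Union>j<k. set (g j))) (g k))"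

lemma morley_tup: "morley xs al B g \<Longrightarrow> g k \<in> tup M xs"
  by (auto simp: morley_def avg_def)

lemma morley_exists:
  assumes "sml B" "set xs \<subseteq> Sorts L" "\<And>i. al i \<in> tup M xs"
  shows "\<exists>g. morley xs al B g"
  unfolding morley_def
proof (rule seq_choice)
  fix f g :: "nat \<Rightarrow> 'm list" and k r
  assume "\<And>j. j < k \<Longrightarrow> f j = g j"
  then have "(\<Union>j<k. set (f j)) = (\<Union>j<k. set (g j))" by (intro SUP_cong) auto
  then show "avg xs al (B \<union> (\<Union>j<k. set (f j))) r \<longleftrightarrow> avg xs al (B \<union> (\<Union>j<k. set (g j))) r"
    by (simp only:)
next
  fix k and f :: "nat \<Rightarrow> 'm list"
  assume f: "\<And>j. j < k \<Longrightarrow> avg xs al (B \<union> (\<Union>i<j. set (f i))) (f j)"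
  have "set (f j) \<subseteq> universe L M" if "j < k" for j
    by (rule set_tup[OF avg_tup[OF f[OF that]] assms(2)])
  then have "\<Union> (set ` f ` {..<k}) \<subseteq> universe L M" by auto
  then have "sml (B \<union> (\<Union>j<k. set (f j)))"
    by (intro small_Un assms(1) small_countable) (auto simp: image_image intro: countable_finite)
  then show "\<exists>r. avg xs al (B \<union> (\<Union>j<k. set (f j))) r"
    using assms(2,3) by (rule avg_exists)
qed

text \<open>The last variable can be replaced by the limit of the \<open>al t\<close>, because its
  entry is taken over all the earlier ones; this is where \<open>j\<close> must be increasing. As
  the \<open>al t\<close> lie in \<open>B\<close>, the remaining condition is again over
  \<open>B\<close> and has one variable less. Both sides turn into the same limit.\<close>

lemma morley_indisc:
  fixes j :: "nat \<Rightarrow> nat"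
  assumes g: "morley xs al B g" and xs: "set xs \<subseteq> Sorts L"
    and al: "\<And>i. al i \<in> tup M xs" "\<And>i. set (al i) \<subseteq> B"
    and P: "D B (\<lambda>_. xs) W P" and j: "strict_mono j"
  shows "P (g \<circ> j) \<longleftrightarrow> P g"
proof -
  have main: "D B (\<lambda>_. xs) {..<n} P \<Longrightarrow> strict_mono j \<Longrightarrow> P (g \<circ> j) \<longleftrightarrow> P g" for n P and j :: "nat \<Rightarrow> nat"
  proof (induction n arbitrary: P j)
    case 0
    show ?case by (rule dp_supp[OF 0(1)]) (auto simp: envs_def morley_tup[OF g])
  next
    case (Suc n)
    have *: "P (g \<circ> i) \<longleftrightarrow> (\<forall>\<^sub>F t in ulim. P ((g \<circ> i)(n := al t)))" if i: "strict_mono i" for i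
    proof -
      have "P ((g \<circ> i)(n := g (i n))) \<longleftrightarrow> (\<forall>\<^sub>F t in ulim. P ((g \<circ> i)(n := al t)))"
      proof (rule avg_dp[OF _ Suc.prems(1) refl xs])
        show "avg xs al (B \<union> (\<Union>j<i n. set (g j))) (g (i n))" using g by (simp add: morley_def)
        show "g \<circ> i \<in> envs M (\<lambda>_. xs)" by (auto simp: envs_def morley_tup[OF g])
        fix w assume "w \<in> {..<Suc n}" "w \<noteq> n"
        then have "i w < i n" using i by (simp add: strict_mono_less)
        then show "set ((g \<circ> i) w) \<subseteq> B \<union> (\<Union>j<i n. set (g j))" by auto
      qed simp
      moreover have "(g \<circ> i)(n := g (i n)) = g \<circ> i" by auto
      ultimately show ?thesis by (simp only:)
    qed
    have **: "P ((g \<circ> i)(n := al t)) \<longleftrightarrow> P (g(n := al t))" if i: "strict_mono i" for i t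
    proof (rule Suc.IH[of "\<lambda>\<rho>. P (\<rho>(n := al t))", OF _ i])
      have "{..<Suc n} - {n} = {..<n}" by auto
      moreover have "D B (\<lambda>_. xs) ({..<Suc n} - {n}) (\<lambda>\<rho>. P (\<rho>(n := al t)))"
        using al by (intro dp_inst[OF Suc.prems(1)]) auto
      ultimately show "D B (\<lambda>_. xs) {..<n} (\<lambda>\<rho>. P (\<rho>(n := al t)))" by (simp only:)
    qed
    have "P (g \<circ> id) \<longleftrightarrow> (\<forall>\<^sub>F t in ulim. P ((g \<circ> id)(n := al t)))"
      by (rule *) (simp add: strict_mono_def)
    moreover have "P (g \<circ> j) \<longleftrightarrow> (\<forall>\<^sub>F t in ulim. P ((g \<circ> j)(n := al t)))"
      using Suc.prems(2) by (rule *)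
    ultimately show ?case unfolding **[OF Suc.prems(2)] by (simp only: comp_id)
  qed
  obtain V where V: "finite V" "V \<subseteq> W" "D B (\<lambda>_. xs) V P"
    by (rule dp_finite_supp[OF P]) (rule that)
  from V(1) obtain n where n: "V \<subseteq> {..<n}" using finite_nat_iff_bounded by blast
  show ?thesis by (rule main[OF dp_mono[OF V(3) order_refl n] j])
qed

section \<open>Algebraic closure\<close>

text \<open>The sort of \<open>e\<close> is quantified universally, so that elements of no sort
  belong to the closure by default and \<open>B \<subseteq> acl B\<close> holds for every set
  \<open>B\<close>.\<close>

definition acl :: "'m set \<Rightarrow> 'm set" where
  "acl B = {e. \<forall>s\<in>Sorts L. e \<in> dom M s \<longrightarrow> (\<exists>Z. DS B [s] Z \<and> Z [e] \<and> finite {z\<in>tup M [s]. Z z})}"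

lemma acl_mono: "B \<subseteq> C \<Longrightarrow> acl B \<subseteq> acl C"
  using dset_mono[of L M B _ _ C] by (fastforce simp: acl_def)

lemma DS_eq:
  assumes "e \<in> tup M xs" "set e \<subseteq> B" "set xs \<subseteq> Sorts L"
  shows "DS B xs (\<lambda>x. x = e)"
proof -
  \<comment> \<open>The conjunction of the equations between coordinates, written with
    \<open>Imp\<close> and \<open>Fls\<close>; the starting value \<open>Neg Fls\<close> is
    truth.\<close>
  define \<psi> where "\<psi> = foldr (\<lambda>i \<phi>. Neg (Imp (Eq (Var i) (Var (length xs + i))) (Neg \<phi>)))
    [0..<length xs] (Neg Fls :: ('s, 'f, 'r) fm)"
  have tm: "tm_sort L (xs @ xs) (Var i) (xs ! i)" "tm_sort L (xs @ xs) (Var (length xs + i)) (xs ! i)"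
    if "i < length xs" for i
    using tm_sort.intros(1)[of i "xs @ xs" L] tm_sort.intros(1)[of "length xs + i" "xs @ xs" L] that
    by (simp_all add: nth_append)
  have "wf_fm L (xs @ xs) (foldr (\<lambda>i \<phi>. Neg (Imp (Eq (Var i) (Var (length xs + i))) (Neg \<phi>))) is (Neg Fls))"
    if "set is \<subseteq> {..<length xs}" for "is"
    using that by (induction "is") (auto intro: tm)
  from this[of "[0..<length xs]"] have "formula L (xs @ xs) \<psi>"
    using assms(3) by (simp add: formula_def \<psi>_def atLeast0LessThan)
  have "sat M (foldr (\<lambda>i \<phi>. Neg (Imp (Eq (Var i) (Var (length xs + i))) (Neg \<phi>))) is (Neg Fls)) (x @ e)
    \<longleftrightarrow> (\<forall>i\<in>set is. x ! i = e ! i)"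
    if "set is \<subseteq> {..<length xs}" "x \<in> tup M xs" for "is" x
    using that length_tup[OF that(2)] by (induction "is") (auto simp: nth_append)
  from this[of "[0..<length xs]"] have "x = e \<longleftrightarrow> sat M \<psi> (x @ e)" if "x \<in> tup M xs" for x
    using that length_tup[OF that] length_tup[OF assms(1)] unfolding \<psi>_def
    by (simp only: set_upt atLeast0LessThan list_eq_iff_nth_eq) auto
  then show ?thesis using assms(1,2) \<open>formula L (xs @ xs) \<psi>\<close>
    by (intro dsetI[of e B M xs L xs \<psi>]) auto
qed

lemma subset_acl: "B \<subseteq> acl B"
proof
  fix e assume e: "e \<in> B"
  have "DS B [s] (\<lambda>x. x = [e])" if "s \<in> Sorts L" "e \<in> dom M s" for s
    using e that by (intro DS_eq) (auto simp: tup_nth)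
  moreover have "finite {z\<in>tup M [s]. z = [e]}" for s
    by (rule finite_subset[of _ "{[e]}"]) auto
  ultimately show "e \<in> acl B" unfolding acl_def
    by (intro CollectI ballI impI exI[of _ "\<lambda>x. x = [e]"] conjI) auto
qed

lemma DS_append:
  assumes "DS B xs X" "DS B ys Y"
  shows "DS B (xs @ ys) (\<lambda>z. X (take (length xs) z) \<and> Y (drop (length xs) z))"
proof -
  let ?\<sigma> = "case_bool xs ys"
  have "D B ?\<sigma> UNIV (\<lambda>\<rho>. X (\<rho> True) \<and> Y (\<rho> False))"
    using dset_dp[of L M B ?\<sigma> True X] dset_dp[of L M B ?\<sigma> False Y] assms by (intro dp_conj) auto
  moreover have "UNIV \<subseteq> set [True, False]" by auto
  moreover have "set (concat (map ?\<sigma> [True, False])) \<subseteq> Sorts L"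
    using assms[THEN dset_sorts] by simp
  ultimately obtain \<phi> b zs where *: "set b \<subseteq> B" "b \<in> tup M zs"
    "formula L (concat (map ?\<sigma> [True, False]) @ zs) \<phi>"
    "\<And>\<rho>. \<rho> \<in> envs M ?\<sigma> \<Longrightarrow> X (\<rho> True) \<and> Y (\<rho> False) \<longleftrightarrow> sat M \<phi> (concat (map \<rho> [True, False]) @ b)"
    by (rule dp_obtain[OF _ finite]) (rule that)
  show ?thesis
  proof (rule dsetI[OF *(1,2)])
    show "formula L ((xs @ ys) @ zs) \<phi>" using *(3) by simp
    fix z assume "z \<in> tup M (xs @ ys)"
    then obtain u v where z: "z = u @ v" "u \<in> tup M xs" "v \<in> tup M ys" by (auto simp: tup_append)
    then have "case_bool u v \<in> envs M ?\<sigma>" by (auto intro!: envsI split: bool.split)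
    from *(4)[OF this] z show "X (take (length xs) z) \<and> Y (drop (length xs) z) \<longleftrightarrow> sat M \<phi> (z @ b)"
      by (simp add: length_tup)
  qed
qed

text \<open>A tuple of algebraic elements lies in a product of finitely many finite definable
  sets.\<close>

lemma acl_tup:
  assumes "f \<in> tup M ys" "set ys \<subseteq> Sorts L" "set f \<subseteq> acl B"
  shows "\<exists>Z. DS B ys Z \<and> Z f \<and> finite {z\<in>tup M ys. Z z}"
  using assms
proof (induction ys arbitrary: f)
  case Nil
  have "DS B [] (\<lambda>_. True)" by (rule dsetI[of "[]" _ _ "[]" _ _ "Neg Fls"]) (auto simp: formula_def)
  then show ?case by auto
next
  case (Cons s ys)
  then obtain e w where f: "f = e # w" "e \<in> dom M s" "w \<in> tup M ys" by (auto simp: tup_Cons)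
  have "\<exists>Z. DS B ys Z \<and> Z w \<and> finite {z\<in>tup M ys. Z z}"
    using Cons.prems f by (intro Cons.IH) auto
  then obtain Z where Z: "DS B ys Z" "Z w" "finite {z\<in>tup M ys. Z z}" by blast
  obtain Y where Y: "DS B [s] Y" "Y [e]" "finite {z\<in>tup M [s]. Y z}"
    using Cons.prems f(1,2) by (auto simp: acl_def)
  have "DS B (s # ys) (\<lambda>z. Y (take 1 z) \<and> Z (drop 1 z))" using DS_append[OF Y(1) Z(1)] by simp
  moreover have "{z\<in>tup M (s # ys). Y (take 1 z) \<and> Z (drop 1 z)} \<subseteq>
      (\<lambda>(u, v). u @ v) ` ({z\<in>tup M [s]. Y z} \<times> {z\<in>tup M ys. Z z})"
  proof
    fix z assume "z \<in> {z\<in>tup M (s # ys). Y (take 1 z) \<and> Z (drop 1 z)}"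
    then obtain m u where "z = m # u" "m \<in> dom M s" "u \<in> tup M ys" "Y [m]" "Z u"
      by (auto simp: tup_Cons)
    then show "z \<in> (\<lambda>(u, v). u @ v) ` ({z\<in>tup M [s]. Y z} \<times> {z\<in>tup M ys. Z z})"
      by (intro image_eqI[of _ _ "([m], u)"]) (auto simp: tup_nth)
  qed
  then have "finite {z\<in>tup M (s # ys). Y (take 1 z) \<and> Z (drop 1 z)}"
    using Y(3) Z(3) by (meson finite_SigmaI finite_imageI finite_subset)
  ultimately show ?case using Y(2) Z(2) f(1) by (intro exI conjI) auto
qed

text \<open>
  Whether \<open>\<phi>(h,z)\<close> holds is, for the finitely many conjugates
  \<open>z\<close> of an algebraic \<open>f\<close> at once, the same as for a single suitable
  member of the sequence \<open>al\<close>.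
\<close>

lemma avg_acl:
  assumes h: "avg xs al B h" and xs: "set xs \<subseteq> Sorts L"
    and al: "\<And>i. al i \<in> tup M xs" "\<And>i. set (al i) \<subseteq> B"
  shows "avg xs al (acl B) h"
proof -
  have "X h \<longleftrightarrow> (\<forall>\<^sub>F i in ulim. X (al i))" if X: "DS (acl B) xs X" for X
  proof -
    obtain \<phi> f ys where *: "set f \<subseteq> acl B" "f \<in> tup M ys" "formula L (xs @ ys) \<phi>"
      "\<And>x. x \<in> tup M xs \<Longrightarrow> X x \<longleftrightarrow> sat M \<phi> (x @ f)"
      by (rule dsetE[OF X]) (rule that)
    have ys: "set ys \<subseteq> Sorts L" using *(3) by (simp add: formula_def)
    obtain Z where Z: "DS B ys Z" "Z f" "finite {z\<in>tup M ys. Z z}" using acl_tup[OF *(2) ys *(1)] by blast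
    have "\<forall>\<^sub>F i in ulim. \<forall>z\<in>{z\<in>tup M ys. Z z}.
        sat M \<phi> (al i @ z) \<longleftrightarrow> (\<forall>\<^sub>F t in ulim. sat M \<phi> (al t @ z))"
      by (rule eventually_ball_finite[OF Z(3)]) (auto intro: ev_iff_ev)
    then obtain k where k: "\<And>z. z \<in> tup M ys \<Longrightarrow> Z z \<Longrightarrow>
        sat M \<phi> (al k @ z) \<longleftrightarrow> (\<forall>\<^sub>F t in ulim. sat M \<phi> (al t @ z))"
      using ev_ex[of "\<lambda>i. \<forall>z\<in>{z\<in>tup M ys. Z z}.
        sat M \<phi> (al i @ z) \<longleftrightarrow> (\<forall>\<^sub>F t in ulim. sat M \<phi> (al t @ z))"] by blast
    \<comment> \<open>Variable 0 is the point whose type is considered, 1 runs through the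
      conjugates of \<open>f\<close>, and 2 is held at \<open>al k\<close>, which lies in
      \<open>B\<close> and is therefore an admissible parameter.\<close>
    define \<sigma> :: "nat \<Rightarrow> 's list" where "\<sigma> = (\<lambda>_. xs)(1 := ys)"
    define \<rho> :: "nat \<Rightarrow> 'm list" where "\<rho> = (\<lambda>_. al k)(1 := f)"
    have "D {} \<sigma> {0, 1, 2} (\<lambda>\<rho>. sat M \<phi> (concat (map \<rho> [0, 1])))"
      "D {} \<sigma> {0, 1, 2} (\<lambda>\<rho>. sat M \<phi> (concat (map \<rho> [2, 1])))"
      using *(3) by (intro dp_formula0; simp add: \<sigma>_def)+
    then have "D B \<sigma> {0, 1, 2} (\<lambda>\<rho>. sat M \<phi> (concat (map \<rho> [0, 1])))"
      "D B \<sigma> {0, 1, 2} (\<lambda>\<rho>. sat M \<phi> (concat (map \<rho> [2, 1])))"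
      by - (rule dp_mono, assumption, simp, simp)+
    moreover have "D B \<sigma> {0, 1, 2} (\<lambda>\<rho>. Z (\<rho> 1))" using Z(1) by (intro dset_dp) (simp_all add: \<sigma>_def)
    ultimately have "D B \<sigma> {0, 1, 2} (\<lambda>\<rho>. Z (\<rho> 1) \<longrightarrow>
        (sat M \<phi> (concat (map \<rho> [0, 1])) \<longleftrightarrow> sat M \<phi> (concat (map \<rho> [2, 1]))))"
      by (intro dp_imp dp_iff)
    from dp_all[OF this, of 1] have "D B \<sigma> ({0, 1, 2} - {1}) (\<lambda>\<rho>. \<forall>z\<in>tup M (\<sigma> 1). Z ((\<rho>(1 := z)) 1) \<longrightarrow>
        (sat M \<phi> (concat (map (\<rho>(1 := z)) [0, 1])) \<longleftrightarrow> sat M \<phi> (concat (map (\<rho>(1 := z)) [2, 1]))))"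
      .
    then have "DS B xs (\<lambda>x. \<forall>z\<in>tup M (\<sigma> 1). Z (((\<rho>(0 := x))(1 := z)) 1) \<longrightarrow>
        (sat M \<phi> (concat (map ((\<rho>(0 := x))(1 := z)) [0, 1])) \<longleftrightarrow>
         sat M \<phi> (concat (map ((\<rho>(0 := x))(1 := z)) [2, 1]))))"
      by (rule dp_dset) (use al *(2) xs in \<open>auto simp: \<rho>_def \<sigma>_def envs_def\<close>)
    then have W: "DS B xs (\<lambda>x. \<forall>z\<in>tup M ys. Z z \<longrightarrow> (sat M \<phi> (x @ z) \<longleftrightarrow> sat M \<phi> (al k @ z)))"
      by (simp add: \<rho>_def \<sigma>_def)
    have "\<forall>\<^sub>F i in ulim. \<forall>z\<in>{z\<in>tup M ys. Z z}. sat M \<phi> (al i @ z) \<longleftrightarrow> sat M \<phi> (al k @ z)"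
    proof (rule eventually_ball_finite[OF Z(3)], safe)
      fix z assume "z \<in> tup M ys" "Z z"
      then show "\<forall>\<^sub>F i in ulim. sat M \<phi> (al i @ z) \<longleftrightarrow> sat M \<phi> (al k @ z)"
        using k[of z] ev_iff_ev[of "\<lambda>i. sat M \<phi> (al i @ z)"] by simp
    qed
    then have "\<forall>\<^sub>F i in ulim. \<forall>z\<in>tup M ys. Z z \<longrightarrow> (sat M \<phi> (al i @ z) \<longleftrightarrow> sat M \<phi> (al k @ z))"
      by eventually_elim auto
    with W h have "\<forall>z\<in>tup M ys. Z z \<longrightarrow> (sat M \<phi> (h @ z) \<longleftrightarrow> sat M \<phi> (al k @ z))"
      by (auto simp: avg_def)
    then have "sat M \<phi> (h @ f) \<longleftrightarrow> sat M \<phi> (al k @ f)" using *(2) Z(2) by blast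
    also have "\<dots> \<longleftrightarrow> (\<forall>\<^sub>F t in ulim. sat M \<phi> (al t @ f))" using k *(2) Z(2) by blast
    finally show ?thesis using *(4) al(1) avg_tup[OF h] by simp
  qed
  with h show ?thesis by (simp add: avg_def)
qed

text \<open>Adding the predecessors after closing \<open>B\<close> gives no more than closing after
  adding them, so \<open>avg_acl\<close> applies at each stage.\<close>

lemma morley_acl:
  assumes g: "morley xs al B g" and xs: "set xs \<subseteq> Sorts L"
    and al: "\<And>i. al i \<in> tup M xs" "\<And>i. set (al i) \<subseteq> B"
  shows "morley xs al (acl B) g"
  unfolding morley_def
proof
  fix k
  let ?B = "B \<union> (\<Union>j<k. set (g j))"
  have "avg xs al (acl ?B) (g k)"
    using g al by (intro avg_acl xs) (auto simp: morley_def)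
  then show "avg xs al (acl B \<union> (\<Union>j<k. set (g j))) (g k)"
  proof (rule avg_mono)
    have "acl B \<subseteq> acl ?B" by (rule acl_mono) simp
    moreover have "(\<Union>j<k. set (g j)) \<subseteq> acl ?B" using subset_acl[of ?B] by simp
    ultimately show "acl B \<union> (\<Union>j<k. set (g j)) \<subseteq> acl ?B" by simp
  qed
qed

section \<open>Lifting sequences along elementary equivalence\<close>

definition eeq :: "'m set \<Rightarrow> ('v \<Rightarrow> 's list) \<Rightarrow> 'v set \<Rightarrow> ('v \<Rightarrow> 'm list) \<Rightarrow> ('v \<Rightarrow> 'm list) \<Rightarrow> bool" where
  "eeq A \<sigma> W \<rho> \<rho>' \<longleftrightarrow> (\<forall>P. D A \<sigma> W P \<longrightarrow> (P \<rho> \<longleftrightarrow> P \<rho>'))"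

text \<open>The forth step of a back-and-forth construction: finitely many conditions on the new
  entry amount to one existential condition on the old entries, which both environments satisfy, and
  saturation does the rest.\<close>

lemma eeq_step:
  assumes e: "eeq A \<sigma> {..<n} \<rho> \<rho>'" and \<rho>: "\<rho> \<in> envs M \<sigma>" "\<rho>' \<in> envs M \<sigma>"
    and A: "sml A" and S: "\<And>v. set (\<sigma> v) \<subseteq> Sorts L"
  shows "\<exists>x\<in>tup M (\<sigma> n). eeq A \<sigma> {..<Suc n} \<rho> (\<rho>'(n := x))"
proof -
  let ?Ps = "{P. D A \<sigma> {..<Suc n} P \<and> P \<rho>}"
  let ?f = "\<lambda>P x. P (\<rho>'(n := x))"
  let ?B = "A \<union> (\<Union>i<n. set (\<rho>' i))"
  have "\<exists>x\<in>tup M (\<sigma> n). \<forall>X\<in>?f ` ?Ps. X x"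
  proof (rule realize)
    have "\<Union> (set ` \<rho>' ` {..<n}) \<subseteq> universe L M" using set_tup[OF envsD[OF \<rho>(2)] S] by blast
    then show "sml ?B" by (intro small_Un A small_countable) (auto simp: image_image intro: countable_finite)
    show "set (\<sigma> n) \<subseteq> Sorts L" by (rule S)
    fix X assume "X \<in> ?f ` ?Ps"
    then obtain P where P: "D A \<sigma> {..<Suc n} P" "X = ?f P" by blast
    show "DS ?B (\<sigma> n) X" unfolding P(2)
      by (rule dp_dset[OF P(1) \<rho>(2) refl S]) auto
  next
    fix F assume F: "F \<subseteq> ?f ` ?Ps" "finite F"
    then obtain G where G: "G \<subseteq> ?Ps" "finite G" "F = ?f ` G" by (meson finite_subset_image)
    have "{..<Suc n} - {n} = {..<n}" by auto
    moreover have "D A \<sigma> {..<Suc n} (\<lambda>\<rho>. \<forall>P\<in>G. P \<rho>)" using G by (intro dp_ball_finite) auto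
    ultimately have "D A \<sigma> {..<n} (\<lambda>\<rho>. \<exists>x\<in>tup M (\<sigma> n). \<forall>P\<in>G. P (\<rho>(n := x)))"
      using dp_ex[of L M A \<sigma> "{..<Suc n}" "\<lambda>\<rho>. \<forall>P\<in>G. P \<rho>" n] by simp
    moreover have "\<exists>x\<in>tup M (\<sigma> n). \<forall>P\<in>G. P (\<rho>(n := x))"
      using G(1) envsD[OF \<rho>(1)] by (intro bexI[of _ "\<rho> n"]) auto
    ultimately have "\<exists>x\<in>tup M (\<sigma> n). \<forall>P\<in>G. P (\<rho>'(n := x))"
      using e[unfolded eeq_def, rule_format, of "\<lambda>\<rho>. \<exists>x\<in>tup M (\<sigma> n). \<forall>P\<in>G. P (\<rho>(n := x))"] by blast
    then show "\<exists>x\<in>tup M (\<sigma> n). \<forall>X\<in>F. X x" using G(3) by simp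
  qed
  then obtain x where x: "x \<in> tup M (\<sigma> n)" "\<forall>X\<in>?f ` ?Ps. X x" by (rule bexE)
  have x2: "P (\<rho>'(n := x))" if "D A \<sigma> {..<Suc n} P" "P \<rho>" for P
    using bspec[OF x(2) imageI, of P] that by blast
  have "P \<rho> \<longleftrightarrow> P (\<rho>'(n := x))" if "D A \<sigma> {..<Suc n} P" for P
    using x2[OF that] x2[OF dp_neg[OF that]] by blast
  then show ?thesis using x(1) unfolding eeq_def by (intro bexI[of _ x]) simp_all
qed

lemma eeq_lift:
  fixes \<rho> \<rho>' :: "nat \<Rightarrow> 'm list"
  assumes e: "eeq A \<sigma> {0} \<rho> \<rho>'" and \<rho>: "\<rho> \<in> envs M \<sigma>" "\<rho>' \<in> envs M \<sigma>"
    and A: "sml A" and S: "\<And>v. set (\<sigma> v) \<subseteq> Sorts L"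
  shows "\<exists>\<rho>''\<in>envs M \<sigma>. \<rho>'' 0 = \<rho>' 0 \<and> (\<forall>n. eeq A \<sigma> {..<n} \<rho> \<rho>'')"
proof -
  \<comment> \<open>The environment at stage \<open>k\<close>: the values chosen so far, the
    candidate \<open>r\<close> at \<open>k\<close>, and the old values of \<open>\<rho>'\<close> as
    filler beyond. By \<open>dp_supp\<close> the filler does not matter.\<close>
  let ?c = "\<lambda>f k r i. if i < (k :: nat) then f i else if i = k then r else \<rho>' i"
  have "\<exists>f. \<forall>k. (k = 0 \<longrightarrow> f k = \<rho>' 0) \<and> f k \<in> tup M (\<sigma> k) \<and> eeq A \<sigma> {..<Suc k} \<rho> (?c f k (f k))"
  proof (rule seq_choice[where P = "\<lambda>f k r. (k = 0 \<longrightarrow> r = \<rho>' 0) \<and> r \<in> tup M (\<sigma> k) \<and> eeq A \<sigma> {..<Suc k} \<rho> (?c f k r)"])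
    fix f g :: "nat \<Rightarrow> 'm list" and k r
    assume "\<And>j. j < k \<Longrightarrow> f j = g j"
    then have "?c f k r = ?c g k r" by auto
    then show "((k = 0 \<longrightarrow> r = \<rho>' 0) \<and> r \<in> tup M (\<sigma> k) \<and> eeq A \<sigma> {..<Suc k} \<rho> (?c f k r)) \<longleftrightarrow>
      ((k = 0 \<longrightarrow> r = \<rho>' 0) \<and> r \<in> tup M (\<sigma> k) \<and> eeq A \<sigma> {..<Suc k} \<rho> (?c g k r))" by simp
  next
    fix k and f :: "nat \<Rightarrow> 'm list"
    assume IH: "\<And>j. j < k \<Longrightarrow> (j = 0 \<longrightarrow> f j = \<rho>' 0) \<and> f j \<in> tup M (\<sigma> j) \<and> eeq A \<sigma> {..<Suc j} \<rho> (?c f j (f j))"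
    show "\<exists>r. (k = 0 \<longrightarrow> r = \<rho>' 0) \<and> r \<in> tup M (\<sigma> k) \<and> eeq A \<sigma> {..<Suc k} \<rho> (?c f k r)"
    proof (cases k)
      case 0
      have "?c f 0 (\<rho>' 0) = \<rho>'" by auto
      moreover have "{..<Suc 0} = {0}" by auto
      ultimately show ?thesis using 0 e envsD[OF \<rho>(2)] by (intro exI[of _ "\<rho>' 0"]) (auto simp: lessThan_Suc)
    next
      case (Suc m)
      define \<rho>1 where "\<rho>1 = (\<lambda>i. if i < k then f i else \<rho>' i)"
      have "?c f m (f m) = \<rho>1" using Suc by (auto simp: \<rho>1_def fun_eq_iff less_Suc_eq)
      then have "eeq A \<sigma> {..<k} \<rho> \<rho>1" using IH[of m] Suc by simp
      moreover have "\<rho>1 \<in> envs M \<sigma>" using IH envsD[OF \<rho>(2)] by (auto simp: \<rho>1_def envs_def)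
      ultimately obtain x where "x \<in> tup M (\<sigma> k)" "eeq A \<sigma> {..<Suc k} \<rho> (\<rho>1(k := x))"
        using eeq_step[OF _ \<rho>(1) _ A S] by blast
      moreover have "\<rho>1(k := x) = ?c f k x" by (auto simp: \<rho>1_def)
      ultimately show ?thesis using Suc by auto
    qed
  qed
  then obtain f where f: "f 0 = \<rho>' 0" "\<And>k. f k \<in> tup M (\<sigma> k)" "\<And>k. eeq A \<sigma> {..<Suc k} \<rho> (?c f k (f k))"
    by blast
  have fe: "f \<in> envs M \<sigma>" using f(2) by (rule envsI)
  have "eeq A \<sigma> {..<n} \<rho> f" for n
    unfolding eeq_def
  proof (intro allI impI)
    fix P assume P: "D A \<sigma> {..<n} P"
    then have P': "D A \<sigma> {..<Suc n} P" by (rule dp_mono) auto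
    have "?c f n (f n) \<in> envs M \<sigma>" using f(2) envsD[OF \<rho>(2)] by (auto simp: envs_def)
    then have "P f \<longleftrightarrow> P (?c f n (f n))" by (rule dp_supp[OF P' fe]) (auto simp: less_Suc_eq)
    then show "P \<rho> \<longleftrightarrow> P f" using f(3)[of n] P' by (simp add: eeq_def)
  qed
  with f(1) fe show ?thesis by blast
qed

end

section \<open>Thorn-independence\<close>

lemma thorn_indep_mono:
  assumes "thorn_indep L M A C B" "A' \<subseteq> A" "B' \<subseteq> B"
  shows "thorn_indep L M A' C B'"
  unfolding thorn_indep_def
proof (intro allI impI)
  fix xs a assume *: "set xs \<subseteq> Sorts L \<and> a \<in> tup M xs \<and> set a \<subseteq> A'"
  have "tp L M xs a (B' \<union> C) \<subseteq> tp L M xs a (B \<union> C)"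
    using assms(3) by (fastforce simp: tp_def pformulas_def)
  moreover have "\<not> type_thorn_forks L M xs C (tp L M xs a (B \<union> C))"
    using assms(1,2) * unfolding thorn_indep_def by (meson order_trans)
  ultimately show "\<not> type_thorn_forks L M xs C (tp L M xs a (B' \<union> C))"
    unfolding type_thorn_forks_def by blast
qed

lemma thorn_indep_Un_base: "thorn_indep L M A C (B \<union> C) \<longleftrightarrow> thorn_indep L M A C B"
  by (simp add: thorn_indep_def Un_assoc)

section \<open>Criteria for thorn-independence and for algebraicity\<close>

context saturated_struct
begin

text \<open>Independence of a set speaks of all tuples from it, in any order and with repetitions.
  Such a tuple is a coordinate projection \<open>tr\<close> of \<open>h\<close>, and pulling
  formulas back along \<open>tr\<close> preserves strong dividing and implications. So a
  thorn-forking formula for the projected tuple gives one for \<open>h\<close>.\<close>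

lemma thorn_indepI:
  assumes h: "h \<in> tup M xs" "set xs \<subseteq> Sorts L"
    and n: "\<not> type_thorn_forks L M xs C (tp L M xs h (B \<union> C))"
  shows "thorn_indep L M (set h) C B"
  unfolding thorn_indep_def
proof (intro allI impI notI)
  fix us a assume "set us \<subseteq> Sorts L \<and> a \<in> tup M us \<and> set a \<subseteq> set h"
  then have us: "set us \<subseteq> Sorts L" and a: "a \<in> tup M us" and sub: "set a \<subseteq> set h" by auto
  assume "type_thorn_forks L M us C (tp L M us a (B \<union> C))"
  then obtain \<phi> b D where \<phi>: "(\<phi>, b) \<in> tp L M us a (B \<union> C)"
    and D: "finite D" "\<And>\<delta> e. (\<delta>, e) \<in> D \<Longrightarrow> thorn_divides L M us C (\<delta>, e)"
    and cov: "realizations M us {(\<phi>, b)} \<subseteq> (\<Union>\<delta>\<in>D. realizations M us {\<delta>})"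
    unfolding type_thorn_forks_def thorn_forks_def by fast
  have "\<forall>i<length us. \<exists>j<length xs. h ! j = a ! i"
    using sub length_tup[OF a] length_tup[OF h(1)] by (metis in_set_conv_nth subsetD)
  then obtain f where f: "\<And>i. i < length us \<Longrightarrow> f i < length xs \<and> h ! f i = a ! i" by metis
  have fs: "xs ! f i = us ! i" if "i < length us" for i
  proof (rule dom_disj)
    show "xs ! f i \<in> Sorts L" using f[OF that] h(2) by (meson nth_mem subsetD)
    show "us ! i \<in> Sorts L" using us that by (meson nth_mem subsetD)
    show "a ! i \<in> dom M (xs ! f i)" using f[OF that] h(1) by (metis tup_nth)
    show "a ! i \<in> dom M (us ! i)" using a that by (simp add: tup_nth)
  qed
  \<comment> \<open>Positions of \<open>a\<close> go to the chosen coordinates of \<open>h\<close>;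
    parameter positions are shifted so as to stand behind \<open>h\<close>.\<close>
  define F where "F i = (if i < length us then f i else length xs + (i - length us))" for i
  define tr :: "'m list \<Rightarrow> 'm list" where "tr x = map (\<lambda>i. x ! f i) [0..<length us]" for x
  have tr: "tr x \<in> tup M us" if "x \<in> tup M xs" for x
  proof -
    have "x ! f i \<in> dom M (us ! i)" if "i < length us" for i
      using f[OF that] fs[OF that] \<open>x \<in> tup M xs\<close> by (metis tup_nth)
    then show ?thesis by (simp add: tup_nth tr_def)
  qed
  have "tr h = a" using f length_tup[OF a] by (auto simp: tr_def intro: nth_equalityI)
  have fm: "formula L (xs @ ys) (ren F \<psi>)" if "formula L (us @ ys) \<psi>" for ys \<psi>
  proof -
    have "\<forall>i<length (us @ ys). F i < length (xs @ ys) \<and> (xs @ ys) ! F i = (us @ ys) ! i"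
      using f fs by (auto simp: F_def nth_append trans_less_add1)
    with that h(2) show ?thesis by (auto simp: formula_def intro: wf_ren)
  qed
  have st: "sat M (ren F \<psi>) (x @ e) \<longleftrightarrow> sat M \<psi> (tr x @ e)"
    if "formula L (us @ ys) \<psi>" "x \<in> tup M xs" for ys \<psi> e x
  proof (rule sat_ren)
    show "wf_fm L (us @ ys) \<psi>" using that(1) by (simp add: formula_def)
    show "\<forall>i<length (us @ ys). (x @ e) ! F i = (tr x @ e) ! i"
      using f length_tup[OF that(2)] by (auto simp: F_def tr_def nth_append)
  qed
  have div: "thorn_divides L M xs C (ren F \<delta>, e)" if d: "thorn_divides L M us C (\<delta>, e)" for \<delta> e
  proof -
    obtain c ys k where c: "set c \<subseteq> universe L M" "set ys \<subseteq> Sorts L" "e \<in> tup M ys"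
      "formula L (us @ ys) \<delta>" "infinite (realizations M ys (tp L M ys e (C \<union> set c)))"
      and k: "k \<ge> 1" "k_inconsistent M us k ((\<lambda>a'. (\<delta>, a')) ` realizations M ys (tp L M ys e (C \<union> set c)))"
      using d unfolding thorn_divides_def strongly_divides_def prod.case by blast
    let ?R = "realizations M ys (tp L M ys e (C \<union> set c))"
    have "k_inconsistent M xs k ((\<lambda>a'. (ren F \<delta>, a')) ` ?R)"
      unfolding k_inconsistent_def
    proof (intro allI impI, elim conjE)
      fix Q assume Q: "Q \<subseteq> (\<lambda>a'. (ren F \<delta>, a')) ` ?R" "finite Q" "card Q = k"
      obtain R where R: "R \<subseteq> ?R" "Q = (\<lambda>a'. (ren F \<delta>, a')) ` R" using Q(1) by (meson subset_imageE)
      have "inj_on (\<lambda>a'. (ren F \<delta>, a')) R" "inj_on (\<lambda>a'. (\<delta>, a')) R" by (auto simp: inj_on_def)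
      then have "finite R" "card ((\<lambda>a'. (\<delta>, a')) ` R) = k"
        using R(2) Q(2,3) finite_imageD by (auto simp: card_image)
      then have "realizations M us ((\<lambda>a'. (\<delta>, a')) ` R) = {}"
        using k(2)[unfolded k_inconsistent_def, rule_format, of "(\<lambda>a'. (\<delta>, a')) ` R"] R(1) by blast
      moreover have "tr x \<in> realizations M us ((\<lambda>a'. (\<delta>, a')) ` R)" if "x \<in> realizations M xs Q" for x
        using that tr st[OF c(4)] unfolding R(2) realizations_def by auto
      ultimately show "realizations M xs Q = {}" by blast
    qed
    then show ?thesis using c k(1) fm[OF c(4)] unfolding thorn_divides_def strongly_divides_def by auto
  qed
  obtain ys where ys: "set b \<subseteq> B \<union> C" "b \<in> tup M ys" "formula L (us @ ys) \<phi>" "sat M \<phi> (a @ b)"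
    using \<phi> by (auto simp: tp_def pformulas_def)
  have "(ren F \<phi>, b) \<in> tp L M xs h (B \<union> C)"
    using ys fm[OF ys(3)] st[OF ys(3) h(1)] \<open>tr h = a\<close> by (auto simp: tp_def pformulas_def)
  moreover have "thorn_forks L M xs C (ren F \<phi>, b)"
    unfolding thorn_forks_def
  proof (intro exI conjI)
    let ?D = "(\<lambda>(\<delta>, e). (ren F \<delta>, e)) ` D"
    show "finite ?D" using D(1) by simp
    show "\<forall>\<delta>\<in>?D. thorn_divides L M xs C \<delta>" using D(2) div by auto
    show "realizations M xs {(ren F \<phi>, b)} \<subseteq> (\<Union>\<delta>\<in>?D. realizations M xs {\<delta>})"
    proof
      fix x assume "x \<in> realizations M xs {(ren F \<phi>, b)}"
      then have x: "x \<in> tup M xs" "sat M \<phi> (tr x @ b)"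
        using st[OF ys(3)] by (auto simp: realizations_def)
      then have "tr x \<in> realizations M us {(\<phi>, b)}" using tr by (simp add: realizations_def)
      then obtain \<delta> e where \<delta>: "(\<delta>, e) \<in> D" "sat M \<delta> (tr x @ e)"
        using cov by (fastforce simp: realizations_def)
      obtain zs where "formula L (us @ zs) \<delta>"
        using D(2)[OF \<delta>(1)] by (auto simp: thorn_divides_def strongly_divides_def)
      then have "x \<in> realizations M xs {(ren F \<delta>, e)}"
        using x(1) \<delta>(2) st by (simp add: realizations_def)
      with \<delta>(1) show "x \<in> (\<Union>\<delta>\<in>?D. realizations M xs {\<delta>})" by force
    qed
  qed
  ultimately show False using n by (auto simp: type_thorn_forks_def)
qed

lemma realizations_tp:
  assumes "e' \<in> realizations M ys (tp L M ys e B)" "DS B ys X" "X e" "e \<in> tup M ys"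
  shows "X e'"
proof -
  obtain \<phi> b where f: "(\<phi>, b) \<in> pformulas L M ys B"
    and X: "\<forall>x\<in>tup M ys. X x \<longleftrightarrow> sat M \<phi> (x @ b)" using assms(2) unfolding dset_def by blast
  then have "(\<phi>, b) \<in> tp L M ys e B" using assms(3,4) by (simp add: tp_def)
  then show ?thesis using assms(1) X unfolding realizations_def by auto
qed

text \<open>A point \<open>x\<close> in the base cannot distinguish conjugates: if it satisfies
  \<open>\<delta>\<close> with the parameter \<open>e\<close>, it does so with every conjugate of
  \<open>e\<close> over \<open>C\<close> and \<open>c\<close>. Infinitely many instances then share
  the solution \<open>x\<close>, against k-inconsistency.\<close>

lemma not_thorn_forks_witness:
  assumes "thorn_forks L M xs C (\<phi>, b)" "x \<in> tup M xs" "sat M \<phi> (x @ b)" "set x \<subseteq> C"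
  shows False
proof -
  have "x \<in> realizations M xs {(\<phi>, b)}" using assms(2,3) by (simp add: realizations_def)
  then obtain \<delta> e where d: "thorn_divides L M xs C (\<delta>, e)" "sat M \<delta> (x @ e)"
    using assms(1) unfolding thorn_forks_def by (fastforce simp: realizations_def)
  then obtain c ys k where c: "set c \<subseteq> universe L M" "set ys \<subseteq> Sorts L" "e \<in> tup M ys"
    "formula L (xs @ ys) \<delta>" "infinite (realizations M ys (tp L M ys e (C \<union> set c)))"
    and k: "k \<ge> 1" "k_inconsistent M xs k ((\<lambda>a'. (\<delta>, a')) ` realizations M ys (tp L M ys e (C \<union> set c)))"
    unfolding thorn_divides_def strongly_divides_def prod.case by blast
  let ?R = "realizations M ys (tp L M ys e (C \<union> set c))"
  have "DS (C \<union> set c) ys (\<lambda>z. sat M \<delta> (x @ z))"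
  proof -
    let ?\<sigma> = "case_bool xs ys"
    have "D {} ?\<sigma> UNIV (\<lambda>\<rho>. sat M \<delta> (concat (map \<rho> [True, False])))"
      using c(4) by (intro dp_formula0) auto
    then have "DS (C \<union> set c) ys (\<lambda>z. sat M \<delta> (concat (map ((case_bool x e)(False := z)) [True, False])))"
      by (rule dp_dset) (use assms(2,4) c(2,3) in \<open>auto simp: envs_def split: bool.split\<close>)
    then show ?thesis by simp
  qed
  then have all: "sat M \<delta> (x @ e')" if "e' \<in> ?R" for e'
    using realizations_tp[OF that, of "\<lambda>z. sat M \<delta> (x @ z)"] d(2) c(3) by simp
  obtain R where R: "R \<subseteq> ?R" "finite R" "card R = k"
    using infinite_arbitrarily_large[OF c(5)] by blast
  have "inj_on (\<lambda>a'. (\<delta>, a')) R" by (auto simp: inj_on_def)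
  then have "realizations M xs ((\<lambda>a'. (\<delta>, a')) ` R) = {}"
    using k(2) R unfolding k_inconsistent_def by (metis card_image finite_imageI image_mono)
  moreover have "x \<in> realizations M xs ((\<lambda>a'. (\<delta>, a')) ` R)"
    using all R(1) assms(2) by (auto simp: realizations_def)
  ultimately show False by blast
qed

lemma avgD: "avg xs al B h \<Longrightarrow> DS B xs X \<Longrightarrow> X h \<longleftrightarrow> (\<forall>\<^sub>F i in ulim. X (al i))"
  by (simp add: avg_def)

text \<open>A formula of the average type already holds of some \<open>al i\<close>; this point lies
  in \<open>C\<close>, so the formula cannot thorn-fork over \<open>C\<close>.\<close>

lemma avg_indep:
  assumes h: "avg xs al B h" and xs: "set xs \<subseteq> Sorts L" and al: "\<And>i. al i \<in> tup M xs"
    and C: "\<And>i. set (al i) \<subseteq> C" "C \<subseteq> B"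
  shows "thorn_indep L M (set h) C B"
proof (rule thorn_indepI[OF avg_tup[OF h] xs], rule notI)
  assume "type_thorn_forks L M xs C (tp L M xs h (B \<union> C))"
  then obtain \<phi> b where f: "(\<phi>, b) \<in> pformulas L M xs B" "sat M \<phi> (h @ b)" "thorn_forks L M xs C (\<phi>, b)"
    using C(2) by (auto simp: type_thorn_forks_def tp_def Un_absorb2)
  have "DS B xs (\<lambda>x. sat M \<phi> (x @ b))" using f(1) unfolding dset_def by blast
  from avgD[OF h this] have "\<forall>\<^sub>F i in ulim. sat M \<phi> (al i @ b)" using f(2) by blast
  then obtain i where "sat M \<phi> (al i @ b)" using ev_ex by blast
  then show False using not_thorn_forks_witness[OF f(3) al] C(1) by blast
qed

text \<open>The parameters of a formula involve only finitely many entries of the sequence. As the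
  ultrafilter is nonprincipal, the formula holds of some \<open>al i\<close> beyond all of them, and
  the independence of this \<open>al i\<close> from its predecessors applies.\<close>

lemma avg_indep_seq:
  assumes h: "avg xs al (B \<union> (\<Union>i. set (al i))) h" and xs: "set xs \<subseteq> Sorts L"
    and al: "\<And>i. al i \<in> tup M xs" and "C \<subseteq> B"
    and ind: "\<And>i. thorn_indep L M (set (al i)) C (B \<union> (\<Union>j<i. set (al j)))"
  shows "thorn_indep L M (set h) C (B \<union> (\<Union>i. set (al i)))"
proof (rule thorn_indepI[OF avg_tup[OF h] xs], rule notI)
  let ?B = "B \<union> (\<Union>i. set (al i))"
  assume "type_thorn_forks L M xs C (tp L M xs h (?B \<union> C))"
  moreover have "?B \<union> C = ?B" using assms(4) by auto
  ultimately obtain \<phi> b ys where f: "set b \<subseteq> ?B" "b \<in> tup M ys" "formula L (xs @ ys) \<phi>"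
    "sat M \<phi> (h @ b)" "thorn_forks L M xs C (\<phi>, b)"
    by (auto simp: type_thorn_forks_def tp_def pformulas_def)
  have "\<exists>n. set b \<subseteq> B \<union> (\<Union>j<n. set (al j))"
    using f(1)
  proof (induction b)
    case (Cons e b)
    then obtain n where n: "set b \<subseteq> B \<union> (\<Union>j<n. set (al j))" by auto
    show ?case
    proof (cases "e \<in> B")
      case True
      then show ?thesis using n by auto
    next
      case False
      then obtain m where "e \<in> set (al m)" using Cons.prems by auto
      then have "set (e # b) \<subseteq> B \<union> (\<Union>j<max n (Suc m). set (al j))"
        using n by (fastforce simp: less_max_iff_disj)
      then show ?thesis by blast
    qed
  qed simp
  then obtain n where n: "set b \<subseteq> B \<union> (\<Union>j<n. set (al j))" by blast
  have "DS ?B xs (\<lambda>x. sat M \<phi> (x @ b))" by (rule dsetI[OF f(1-3)]) simp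
  from avgD[OF h this] have "\<forall>\<^sub>F i in ulim. sat M \<phi> (al i @ b)" using f(4) by blast
  then have "\<forall>\<^sub>F i in ulim. sat M \<phi> (al i @ b) \<and> n < i" using ev_gt by (rule eventually_conj)
  then obtain i where i: "sat M \<phi> (al i @ b)" "n < i" using ev_ex by blast
  have "set b \<subseteq> B \<union> (\<Union>j<i. set (al j))" using n i(2) by fastforce
  then have "(\<phi>, b) \<in> tp L M xs (al i) (B \<union> (\<Union>j<i. set (al j)) \<union> C)"
    using f(2,3) i(1) by (auto simp: tp_def pformulas_def)
  then show False using ind[of i] f(5) xs al[of i] by (auto simp: thorn_indep_def type_thorn_forks_def)
qed

lemma DS_ball_finite:
  assumes "finite F" "\<And>X. X \<in> F \<Longrightarrow> DS B xs X" "x0 \<in> tup M xs" "set xs \<subseteq> Sorts L"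
  shows "DS B xs (\<lambda>x. \<forall>X\<in>F. X x)"
proof -
  let ?\<sigma> = "\<lambda>_ :: unit. xs"
  have "D B ?\<sigma> UNIV (\<lambda>\<rho>. \<forall>X\<in>F. X (\<rho> ()))"
    using assms(1,2) by (intro dp_ball_finite dset_dp) auto
  then have "DS B xs (\<lambda>x. \<forall>X\<in>F. X (((\<lambda>_. x0)(() := x)) ()))"
    by (rule dp_dset) (use assms(3,4) in \<open>auto simp: envs_def\<close>)
  then show ?thesis by simp
qed

text \<open>If \<open>e\<close> were not algebraic, every formula true of it would have infinitely
  many solutions, hence solutions outside the finite set of conjugates. By saturation there would be
  a conjugate different from all conjugates.\<close>

lemma acl_if_finite:
  assumes S: "S \<in> Sorts L" and e: "e \<in> dom M S" and B: "sml B"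
    and fin: "finite (realizations M [S] (tp L M [S] [e] B))" (is "finite ?R")
  shows "e \<in> acl B"
proof (rule ccontr)
  assume n: "e \<notin> acl B"
  have e1: "[e] \<in> tup M [S]" using e by (simp add: tup_nth)
  have inf: "infinite {z\<in>tup M [S]. Z z}" if "DS B [S] Z" "Z [e]" for Z
    using n that dom_disj[OF _ S _ e] unfolding acl_def by blast
  \<comment> \<open>The type of \<open>e\<close> together with the demand to differ from each of its
    conjugates.\<close>
  let ?Xs = "{X. DS B [S] X \<and> X [e]} \<union> (\<lambda>r x. x \<noteq> r) ` ?R"
  let ?B = "B \<union> (\<Union>r\<in>?R. set r)"
  have R: "?R \<subseteq> tup M [S]" by (auto simp: realizations_def)
  have "\<exists>x\<in>tup M [S]. \<forall>X\<in>?Xs. X x"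
  proof (rule realize)
    have "(\<Union>r\<in>?R. set r) \<subseteq> universe L M" using R S set_tup[of _ M "[S]" L] by fastforce
    then show "sml ?B" using fin
      by (intro small_Un B small_countable) (auto intro!: countable_finite)
    show "set [S] \<subseteq> Sorts L" using S by simp
    fix X assume X: "X \<in> ?Xs"
    show "DS ?B [S] X"
    proof (cases "X \<in> {X. DS B [S] X \<and> X [e]}")
      case True
      then show ?thesis using dset_mono[of L M B "[S]" X ?B] by simp
    next
      case False
      with X have "X \<in> (\<lambda>r x. x \<noteq> r) ` ?R" by (elim UnE) simp_all
      then obtain r where r: "r \<in> ?R" "X = (\<lambda>x. x \<noteq> r)" by (rule imageE)
      have "DS ?B [S] (\<lambda>x. x = r)" by (rule DS_eq) (use r R S in auto)
      then show ?thesis unfolding r(2) by (rule ev_not_DS)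
    qed
  next
    fix F assume F: "F \<subseteq> ?Xs" "finite F"
    let ?F = "F \<inter> {X. DS B [S] X \<and> X [e]}"
    have "DS B [S] (\<lambda>x. \<forall>X\<in>?F. X x)"
      by (rule DS_ball_finite[OF _ _ e1]) (use F S in auto)
    then have "infinite {z\<in>tup M [S]. \<forall>X\<in>?F. X z}" by (rule inf) auto
    then have "\<not> {z\<in>tup M [S]. \<forall>X\<in>?F. X z} \<subseteq> ?R" using fin finite_subset by blast
    then obtain z where z: "z \<in> tup M [S]" "\<forall>X\<in>?F. X z" "z \<notin> ?R" by (auto simp only: subset_iff mem_Collect_eq)
    have "X z" if "X \<in> F" for X
    proof (cases "X \<in> ?F")
      case True
      then show ?thesis using z(2) by blast
    next
      case False
      then have "X \<in> (\<lambda>r x. x \<noteq> r) ` ?R" using F(1) that by blast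
      then obtain r where "r \<in> ?R" "X = (\<lambda>x. x \<noteq> r)" by (rule imageE)
      then show ?thesis using z(3) by blast
    qed
    with z(1) show "\<exists>x\<in>tup M [S]. \<forall>X\<in>F. X x" by blast
  qed
  then obtain x where x: "x \<in> tup M [S]" "\<forall>X\<in>?Xs. X x" by (rule bexE)
  have "sat M \<phi> (x @ b)" if "(\<phi>, b) \<in> tp L M [S] [e] B" for \<phi> b
  proof -
    have "(\<phi>, b) \<in> pformulas L M [S] B" "sat M \<phi> ([e] @ b)" using that by (auto simp: tp_def)
    then have "(\<lambda>x. sat M \<phi> (x @ b)) \<in> ?Xs" by (auto simp: dset_def)
    from bspec[OF x(2) this] show ?thesis .
  qed
  then have "x \<in> ?R" using x(1) by (auto simp: realizations_def)
  then have "(\<lambda>y. y \<noteq> x) \<in> ?Xs" by (intro UnI2) (rule imageI)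
  from bspec[OF x(2) this] show False by simp
qed

end

text \<open>\<open>quotient\<close> is uniform elimination of imaginaries: \<open>\<pi>\<close>
  sends a tuple to a code of its class, and \<open>\<delta>\<close> defines the graph of
  \<open>\<pi>\<close>. It is what makes a class available as a parameter.\<close>

locale rosy_struct = saturated_struct L M \<kappa>
  for L :: "('s, 'f, 'r) lang" and M :: "('s, 'f, 'r, 'm) struct" and \<kappa> :: "'k rel" +
  assumes quotient: "\<And>ws E. defines_equiv L M ws E \<Longrightarrow> \<exists>S\<in>Sorts L. \<exists>\<pi> \<delta>.
      formula L (ws @ [S]) \<delta> \<and> (\<forall>x\<in>tup M ws. \<pi> x \<in> dom M S) \<and>
      (\<forall>x\<in>tup M ws. \<forall>z\<in>dom M S. sat M \<delta> (x @ [z]) \<longleftrightarrow> \<pi> x = z) \<and>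
      (\<forall>x\<in>tup M ws. \<forall>y\<in>tup M ws. \<pi> x = \<pi> y \<longleftrightarrow> sat M E (x @ y))"
    and indep: "independence_relation L \<kappa> M (thorn_indep L M)"
    and sym: "symmetric_relation L \<kappa> M (thorn_indep L M)"
    and trans: "transitive_relation L \<kappa> M (thorn_indep L M)"
begin

abbreviation "ind \<equiv> thorn_indep L M"

lemma ind_sym: "ind A C B \<Longrightarrow> sml A \<Longrightarrow> sml B \<Longrightarrow> sml C \<Longrightarrow> ind B C A"
  using sym unfolding symmetric_relation_def by blast

lemma ind_trans:
  "sml A \<Longrightarrow> sml B \<Longrightarrow> C \<subseteq> E \<Longrightarrow> E \<subseteq> B \<Longrightarrow> ind A C B \<longleftrightarrow> ind A C E \<and> ind A E B"
  using trans unfolding transitive_relation_def by blast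

lemma ind_extend:
  assumes "set xs \<subseteq> Sorts L" "a \<in> tup M xs" "sml B'" "sml C" "B \<subseteq> B'" "ind (set a) C B"
  shows "\<exists>a'\<in>tup M xs. tp L M xs a' (B \<union> C) = tp L M xs a (B \<union> C) \<and> ind (set a') C B'"
  using indep assms unfolding independence_relation_def by blast

text \<open>Entries are added to the block one at a time. The new entry is independent from block
  and past together; transitivity moves the block into the base, symmetry turns the relation around,
  and transitivity recombines it with the induction hypothesis.\<close>

lemma ind_seq:
  assumes C: "sml C" and g: "\<And>k. g k \<in> tup M xs" "set xs \<subseteq> Sorts L"
    and ind: "\<And>k. ind (set (g k)) C (\<Union>j<k. set (g j))"
  shows "ind (\<Union>j\<in>{m..<m + Suc n}. set (g j)) C (\<Union>j<m. set (g j))"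
proof (induction n)
  case 0
  then show ?case using ind[of m] by simp
next
  case (Suc n)
  define X where "X = (\<Union>j\<in>{m..<m + Suc n}. set (g j))"
  define Y where "Y = (\<Union>j<m. set (g j))"
  define k where "k = m + Suc n"
  have s: "sml X" "sml Y" "sml (set (g k))"
    unfolding X_def Y_def
    by (rule small_UN[OF g], rule small_UN[OF g], rule small_tup[OF g])
  have XC: "sml (X \<union> C)" by (intro small_Un s C)
  have "{..<k} = {m..<m + Suc n} \<union> {..<m}" by (auto simp: k_def)
  then have kXY: "(\<Union>j<k. set (g j)) = X \<union> Y" unfolding X_def Y_def by (simp only: UN_Un)
  have "ind (set (g k)) C (X \<union> Y \<union> C)" using ind[of k] by (simp add: kXY thorn_indep_Un_base)
  moreover have "sml (X \<union> Y \<union> C)" by (intro small_Un s C)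
  ultimately have "ind (set (g k)) (X \<union> C) (X \<union> Y \<union> C)"
    using ind_trans[OF s(3), of "X \<union> Y \<union> C" C "X \<union> C"] by blast
  then have "ind (set (g k)) (X \<union> C) Y" by (rule thorn_indep_mono) auto
  then have "ind Y (X \<union> C) (set (g k))" by (rule ind_sym) (intro small_Un s C)+
  then have 1: "ind Y (X \<union> C) (set (g k) \<union> (X \<union> C))" by (simp only: thorn_indep_Un_base)
  have "ind X C Y" using Suc by (simp add: X_def Y_def)
  then have "ind Y C X" by (rule ind_sym) (intro small_Un s C)+
  then have 2: "ind Y C (X \<union> C)" by (simp add: thorn_indep_Un_base)
  have sB: "sml (set (g k) \<union> (X \<union> C))" by (intro small_Un s C)
  have "ind Y C (set (g k) \<union> (X \<union> C))"
    using ind_trans[OF s(2) sB, of C "X \<union> C"] 1 2 by blast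
  then have "ind Y C (set (g k) \<union> X)" by (rule thorn_indep_mono) auto
  then have "ind (set (g k) \<union> X) C Y" by (rule ind_sym) (intro small_Un s C)+
  moreover have "set (g k) \<union> X = (\<Union>j\<in>{m..<m + Suc (Suc n)}. set (g j))"
  proof -
    have "{m..<m + Suc (Suc n)} = insert k {m..<m + Suc n}" by (auto simp: k_def)
    then show ?thesis unfolding X_def by (simp only: UN_insert)
  qed
  ultimately show ?case unfolding Y_def by (simp only:)
qed

text \<open>If the code \<open>e\<close> of the common class were not algebraic over
  \<open>C\<close>, it would have infinitely many conjugates, and these code pairwise disjoint
  classes. So membership in the class coded by \<open>e\<close> strongly divides over
  \<open>C\<close>. It is implied by equivalence with \<open>u\<close>, which \<open>u'\<close>
  satisfies, contrary to independence.\<close>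

lemma quotient_acl:
  assumes E: "defines_equiv L M ws E" and ws: "set ws \<subseteq> Sorts L"
    and u: "u \<in> tup M ws" "u' \<in> tup M ws" "sat M E (u @ u')"
    and ind: "ind (set u') C (set u)" and C: "sml C"
  obtains S \<delta> e where "S \<in> Sorts L" "e \<in> dom M S" "e \<in> acl C" "formula L (ws @ [S]) \<delta>"
    "\<And>x. x \<in> tup M ws \<Longrightarrow> sat M \<delta> (x @ [e]) \<longleftrightarrow> sat M E (x @ u)"
proof -
  obtain S \<pi> \<delta> where S: "S \<in> Sorts L" and q: "formula L (ws @ [S]) \<delta> \<and> (\<forall>x\<in>tup M ws. \<pi> x \<in> dom M S) \<and>
      (\<forall>x\<in>tup M ws. \<forall>z\<in>dom M S. sat M \<delta> (x @ [z]) \<longleftrightarrow> \<pi> x = z) \<and>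
      (\<forall>x\<in>tup M ws. \<forall>y\<in>tup M ws. \<pi> x = \<pi> y \<longleftrightarrow> sat M E (x @ y))"
    using quotient[OF E] by (elim bexE exE)
  have \<delta>: "formula L (ws @ [S]) \<delta>" using q by (rule conjunct1)
  have \<pi>: "\<pi> x \<in> dom M S" if "x \<in> tup M ws" for x
    using q that by simp
  have s\<delta>: "sat M \<delta> (x @ [z]) \<longleftrightarrow> \<pi> x = z" if "x \<in> tup M ws" "z \<in> dom M S" for x z
    using q that by simp
  have s\<pi>: "\<pi> x = \<pi> y \<longleftrightarrow> sat M E (x @ y)" if "x \<in> tup M ws" "y \<in> tup M ws" for x y
    using q that by simp
  define e where "e = \<pi> u"
  have e: "e \<in> dom M S" using \<pi> u(1) by (simp add: e_def)
  let ?R = "realizations M [S] (tp L M [S] [e] C)"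
  have "e \<in> acl C"
  proof (rule acl_if_finite[OF S e C], rule ccontr)
    assume inf: "infinite ?R"
    have "k_inconsistent M ws 2 ((\<lambda>a'. (\<delta>, a')) ` ?R)"
      unfolding k_inconsistent_def
    proof (intro allI impI, elim conjE)
      fix F assume F: "F \<subseteq> (\<lambda>a'. (\<delta>, a')) ` ?R" "finite F" "card F = 2"
      obtain p q where pq: "F = {p, q}" "p \<noteq> q" using F(3) by (auto simp: card_2_iff)
      with F(1) obtain r1 r2 where r: "F = {(\<delta>, r1), (\<delta>, r2)}" "r1 \<noteq> r2" "r1 \<in> ?R" "r2 \<in> ?R"
        by auto
      then obtain e1 e2 where ee: "r1 = [e1]" "r2 = [e2]" "e1 \<in> dom M S" "e2 \<in> dom M S"
        by (auto simp: realizations_def tup_Cons)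
      have False if "x \<in> realizations M ws F" for x
      proof -
        have x: "x \<in> tup M ws" "sat M \<delta> (x @ [e1])" "sat M \<delta> (x @ [e2])"
          using that r(1) ee by (auto simp: realizations_def)
        then have "\<pi> x = e1" "\<pi> x = e2" using s\<delta>[OF x(1)] ee(3,4) by simp_all
        then show False using ee r(2) by simp
      qed
      then show "realizations M ws F = {}" by blast
    qed
    moreover have "[e] \<in> tup M [S]" using e by (simp add: tup_nth)
    moreover have "(1 :: nat) \<le> 2" by simp
    ultimately have "strongly_divides L M ws C (\<delta>, [e])"
      using inf \<delta> S unfolding strongly_divides_def prod.case
      by (intro exI[of _ "[S]"] conjI exI[of _ "2 :: nat"]; simp)
    then have "thorn_divides L M ws C (\<delta>, [e])"
      unfolding thorn_divides_def by (intro exI[of _ "[]"]) simp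
    moreover have "realizations M ws {(E, u)} \<subseteq> realizations M ws {(\<delta>, [e])}"
    proof
      fix x assume "x \<in> realizations M ws {(E, u)}"
      then have x: "x \<in> tup M ws" "sat M E (x @ u)" by (auto simp: realizations_def)
      then have "sat M \<delta> (x @ [e])" using s\<pi>[OF x(1) u(1)] s\<delta>[OF x(1) e] by (simp add: e_def)
      with x(1) show "x \<in> realizations M ws {(\<delta>, [e])}" by (simp add: realizations_def)
    qed
    ultimately have "thorn_forks L M ws C (E, u)"
      unfolding thorn_forks_def by (intro exI[of _ "{(\<delta>, [e])}"]) simp
    moreover have "sat M E (u' @ u)" using s\<pi>[OF u(1,2)] s\<pi>[OF u(2,1)] u(3) by simp
    then have "(E, u) \<in> tp L M ws u' (set u \<union> C)"
      using E u by (auto simp: tp_def pformulas_def defines_equiv_def)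
    ultimately show False
      using ind ws u(2) by (auto simp: thorn_indep_def type_thorn_forks_def)
  qed
  moreover have "sat M \<delta> (x @ [e]) \<longleftrightarrow> sat M E (x @ u)" if "x \<in> tup M ws" for x
    using s\<delta>[OF that e] s\<pi>[OF that u(1)] by (simp add: e_def)
  ultimately show ?thesis by (intro that[OF S e _ \<delta>])
qed

end

section \<open>Order patterns\<close>

text \<open>Indiscernibility is available for strictly increasing reindexings of a whole sequence,
  so a finite list of indices has to be completed to one.\<close>

lemma extend_sorted:
  fixes js :: "nat list"
  assumes "sorted_wrt (<) js"
  shows "\<exists>j. strict_mono j \<and> (\<forall>t<length js. j t = js ! t)"
proof -
  define m where "m = Max (insert 0 (set js))"
  \<comment> \<open>\<open>m\<close> bounds the list, so the values \<open>m + Suc t\<close>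
    continue it increasingly.\<close>
  define j where "j t = (if t < length js then js ! t else m + Suc t)" for t
  have m: "js ! t \<le> m" if "t < length js" for t
    using that by (auto simp: m_def intro: Max_ge)
  have "j t < j (Suc t)" for t
  proof -
    consider "Suc t < length js" | "t < length js" "\<not> Suc t < length js" | "\<not> t < length js" by linarith
    then show ?thesis
    proof cases
      case 1
      then show ?thesis using assms by (simp add: j_def sorted_wrt_iff_nth_less)
    next
      case 2
      then show ?thesis using m[of t] by (simp add: j_def)
    next
      case 3
      then show ?thesis by (simp add: j_def)
    qed
  qed
  then have "strict_mono j" by (simp add: strict_mono_Suc_iff)
  then show ?thesis by (intro exI[of _ j]) (simp add: j_def)
qed

text \<open>The parameter that makes the cut is hidden under an existential quantifier, so that the
  pattern becomes a definable property of finitely many entries of \<open>g\<close> alone.\<close>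

definition pat :: "('s, 'f, 'r, 'm) struct \<Rightarrow> 's list \<Rightarrow> ('s, 'f, 'r) fm \<Rightarrow> (nat \<Rightarrow> 'm list) \<Rightarrow>
    nat \<Rightarrow> nat \<Rightarrow> bool" where
  "pat M ys \<phi> g k s \<longleftrightarrow> (\<exists>y\<in>tup M ys. \<forall>t<k. sat M \<phi> (g t @ y) \<longleftrightarrow> t < s)"

lemma pat_mono: "pat M ys \<phi> g k s \<Longrightarrow> k' \<le> k \<Longrightarrow> pat M ys \<phi> g k' s"
  unfolding pat_def by (elim bexE, rule bexI) simp_all

lemma dp_pat:
  assumes "formula L (xs @ ys) \<phi>"
  shows "dp L M {} (\<lambda>_. xs) {..<k} (\<lambda>g. pat M ys \<phi> g k s)"
proof -
  let ?\<sigma> = "case_option ys (\<lambda>_ :: nat. xs)"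
  let ?W = "insert None (Some ` {..<k})"
  have "dp L M {} ?\<sigma> ?W (\<lambda>\<rho>. \<forall>t\<in>{..<k}. sat M \<phi> (concat (map \<rho> [Some t, None])) \<longleftrightarrow> t < s)"
    using assms by (intro dp_ball_finite dp_iff dp_const dp_formula0) auto
  from dp_ex[OF this, of None]
  have "dp L M {} ?\<sigma> (?W - {None}) (\<lambda>\<rho>. \<exists>y\<in>tup M ys. \<forall>t<k. sat M \<phi> (\<rho> (Some t) @ y) \<longleftrightarrow> t < s)"
    by (rule dp_cong) (simp add: Ball_def)
  moreover have "?W - {None} = Some ` {..<k}" by auto
  ultimately have 1: "dp L M {} ?\<sigma> (Some ` {..<k}) (\<lambda>\<rho>. \<exists>y\<in>tup M ys. \<forall>t<k. sat M \<phi> (\<rho> (Some t) @ y) \<longleftrightarrow> t < s)"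
    by (simp only:)
  have "dp L M {} (\<lambda>_. xs) (the ` Some ` {..<k}) (\<lambda>g. pat M ys \<phi> g k s)"
  \<comment> \<open>An environment with the extra block needs some tuple of sorts \<open>ys\<close>
    as filler; without one the pattern cannot occur.\<close>
  proof (cases "tup M ys = {}")
    case True
    then show ?thesis by (simp add: pat_def dp_False)
  next
    case False
    then obtain y0 where y0: "y0 \<in> tup M ys" by blast
    show ?thesis
    proof (rule dp_rename[OF 1])
      show "xs = ?\<sigma> v" if "v \<in> Some ` {..<k}" for v using that by auto
      fix \<rho> assume \<rho>: "\<rho> \<in> envs M (\<lambda>_ :: nat. xs)"
      show "\<exists>\<rho>'\<in>envs M ?\<sigma>. (\<forall>v\<in>Some ` {..<k}. \<rho>' v = \<rho> (the v)) \<and>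
        ((\<exists>y\<in>tup M ys. \<forall>t<k. sat M \<phi> (\<rho>' (Some t) @ y) \<longleftrightarrow> t < s) \<longleftrightarrow> pat M ys \<phi> \<rho> k s)"
      proof (intro bexI conjI ballI)
        show "case_option y0 \<rho> \<in> envs M ?\<sigma>"
          using \<rho> y0 by (auto simp: envs_def split: option.split)
        show "(\<exists>y\<in>tup M ys. \<forall>t<k. sat M \<phi> (case_option y0 \<rho> (Some t) @ y) \<longleftrightarrow> t < s) \<longleftrightarrow> pat M ys \<phi> \<rho> k s"
          by (simp add: pat_def)
        show "case_option y0 \<rho> v = \<rho> (the v)" if "v \<in> Some ` {..<k}" for v using that by auto
      qed
    qed
  qed
  then show ?thesis by (simp add: image_image)
qed

text \<open>Averages are taken of single tuples, so a pair is stored as one tuple of sorts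
  \<open>xs @ ys\<close>. Conditions on the halves, addressed as \<open>(v, True)\<close> and
  \<open>(v, False)\<close>, have to become conditions on the pairs.\<close>

lemma dp_split:
  fixes \<sigma>' :: "'v \<times> bool \<Rightarrow> 's list" and M :: "('s, 'f, 'r, 'm) struct"
  assumes P: "dp L M A \<sigma>' W P" and \<sigma>': "\<And>v. \<sigma>' (v, True) = xs" "\<And>v. \<sigma>' (v, False) = ys"
    and S: "set xs \<subseteq> Sorts L" "set ys \<subseteq> Sorts L"
  shows "dp L M A (\<lambda>_. xs @ ys) (fst ` W)
    (\<lambda>\<rho>. P (\<lambda>(v, c). if c then take (length xs) (\<rho> v) else drop (length xs) (\<rho> v)))"
proof -
  obtain V where V: "finite V" "V \<subseteq> W" "dp L M A \<sigma>' V P" by (rule dp_finite_supp[OF P]) (rule that)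
  obtain ts where ts: "set ts = fst ` V" using finite_list[OF finite_imageI[OF V(1), of fst]] by blast
  \<comment> \<open>Listing both halves of each pair side by side makes the context of the halves
    literally that of the pairs, even if only one half occurs in \<open>P\<close>.\<close>
  let ?ws = "concat (map (\<lambda>t. [(t, True), (t, False)]) ts)"
  have "(v, c) \<in> set ?ws" if "(v, c) \<in> V" for v c
  proof -
    have "v \<in> set ts" unfolding ts by (rule image_eqI[OF _ that]) simp
    then show ?thesis by (cases c) auto
  qed
  then have sub: "V \<subseteq> set ?ws" by (intro subrelI)
  have c1: "concat (map \<sigma>' ?ws) = concat (map (\<lambda>_. xs @ ys) ts)"
    using \<sigma>' by (induction ts) simp_all
  have Sw: "set (concat (map \<sigma>' ?ws)) \<subseteq> Sorts L" unfolding c1 using S by auto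
  obtain \<phi> b zs where f: "set b \<subseteq> A" "b \<in> tup M zs" "formula L (concat (map \<sigma>' ?ws) @ zs) \<phi>"
    "\<And>\<rho>. \<rho> \<in> envs M \<sigma>' \<Longrightarrow> P \<rho> \<longleftrightarrow> sat M \<phi> (concat (map \<rho> ?ws) @ b)"
    by (rule dp_obtain[OF V(3,1) sub Sw]) (rule that)
  let ?sp = "\<lambda>\<rho> :: 'v \<Rightarrow> 'm list. \<lambda>(v, c). if c then take (length xs) (\<rho> v) else drop (length xs) (\<rho> v)"
  have c2: "concat (map (?sp \<rho>) ?ws) = concat (map \<rho> ts)" for \<rho>
    by (induction ts) auto
  show ?thesis
  proof (rule dpI[OF _ f(1,2)])
    show "set ts \<subseteq> fst ` W" using ts V(2) by auto
    show "formula L (concat (map (\<lambda>_. xs @ ys) ts) @ zs) \<phi>" using f(3) by (simp only: c1)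
    fix \<rho> :: "'v \<Rightarrow> 'm list" assume r: "\<rho> \<in> envs M (\<lambda>_. xs @ ys)"
    have "?sp \<rho> \<in> envs M \<sigma>'"
    proof (rule envsI)
      fix v :: "'v \<times> bool"
      obtain t c where v: "v = (t, c)" by (cases v)
      obtain a' b' where ab: "\<rho> t = a' @ b'" "a' \<in> tup M xs" "b' \<in> tup M ys"
        using envsD[OF r, of t] by (auto simp: tup_append)
      then show "?sp \<rho> v \<in> tup M (\<sigma>' v)"
        using length_tup[OF ab(2)] \<sigma>' by (cases c) (simp_all add: v)
    qed
    from f(4)[OF this] show "P (?sp \<rho>) \<longleftrightarrow> sat M \<phi> (concat (map \<rho> ts) @ b)" by (simp only: c2)
  qed
qed

section \<open>From finite order patterns to instability\<close>

context saturated_struct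
begin

text \<open>The reversed order of the indices is the one in which \<open>pat_unstable\<close> will
  find its Morley sequence of pairs ordered by \<open>\<phi>\<close>. Indiscernibility carries over
  because a decreasing list of indices is an increasing one read backwards, and the variables can be
  listed backwards too.\<close>

lemma indiscernible_part:
  fixes \<sigma>' :: "nat \<times> bool \<Rightarrow> 's list" and h :: "nat \<Rightarrow> 'm list"
  assumes h: "\<And>W P j. D {} (\<lambda>_ :: nat. xs @ ys) W P \<Longrightarrow> strict_mono j \<Longrightarrow> P (h \<circ> j) \<longleftrightarrow> P h"
    and S: "set xs \<subseteq> Sorts L" "set ys \<subseteq> Sorts L" and ht: "\<And>i. h i \<in> tup M (xs @ ys)"
  shows "indiscernible L M (if c then xs else ys) {(i, j). j \<le> i}
    (\<lambda>i. if c then take (length xs) (h i) else drop (length xs) (h i))"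
    (is "indiscernible L M ?zs ?r ?u")
proof -
  have "?u i \<in> tup M ?zs" for i using ht[of i] by (auto simp: tup_append length_tup)
  moreover have "sat M \<phi> (concat (map ?u is)) \<longleftrightarrow> sat M \<phi> (concat (map ?u js))"
    if \<phi>: "formula L (concat (replicate n ?zs)) \<phi>" and l: "length is = n" "length js = n"
      and s: "sorted_wrt (\<lambda>i j. (i, j) \<in> ?r - Id) is" "sorted_wrt (\<lambda>i j. (i, j) \<in> ?r - Id) js"
    for n \<phi> "is" js
  proof -
    let ?\<sigma>' = "\<lambda>(v :: nat, c). if c then xs else ys"
    let ?vs = "map (\<lambda>t. (t, c)) (rev [0..<n])"
    have "map ?\<sigma>' ?vs = replicate n ?zs" by (rule nth_equalityI) auto
    then have "D {} ?\<sigma>' UNIV (\<lambda>\<rho>. sat M \<phi> (concat (map \<rho> ?vs)))"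
      using \<phi> by (intro dp_formula0) (simp_all del: map_map)
    from dp_split[OF this _ _ S]
    have d: "D {} (\<lambda>_. xs @ ys) (range fst) (\<lambda>\<rho>. sat M \<phi> (concat (map
        (\<lambda>(v, c). if c then take (length xs) (\<rho> v) else drop (length xs) (\<rho> v)) ?vs)))"
      (is "D {} _ _ ?P") by simp
    have "sat M \<phi> (concat (map ?u ks)) \<longleftrightarrow> ?P h"
      if k: "length ks = n" "sorted_wrt (\<lambda>i j. (i, j) \<in> ?r - Id) ks" for ks
    proof -
      have "sorted_wrt (<) (rev ks)" unfolding sorted_wrt_rev
        using k(2) by (rule sorted_wrt_mono_rel[rotated]) auto
      then obtain j where j: "strict_mono j" "\<forall>t<length (rev ks). j t = rev ks ! t"
        using extend_sorted by blast
      have "map j [0..<n] = rev ks" using j(2) k(1) by (intro nth_equalityI) auto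
      then have "map j (rev [0..<n]) = ks" by (simp flip: rev_map)
      then have "map ?u ks = map ?u (map j (rev [0..<n]))" by (simp only:)
      then have "map ?u ks = map (\<lambda>t. ?u (j t)) (rev [0..<n])" by (simp only: map_map comp_def)
      also have "\<dots> = map (\<lambda>(v, c). if c then take (length xs) ((h \<circ> j) v) else drop (length xs) ((h \<circ> j) v)) ?vs"
        by simp
      finally have "sat M \<phi> (concat (map ?u ks)) \<longleftrightarrow> ?P (h \<circ> j)" by (simp only:)
      also have "\<dots> \<longleftrightarrow> ?P h" by (rule h[OF d j(1)])
      finally show ?thesis .
    qed
    with l s show ?thesis by simp
  qed
  ultimately show ?thesis unfolding indiscernible_def by blast
qed

text \<open>Compactness turns the finite patterns into parameters \<open>y s\<close> that cut the
  whole sequence. The pairs \<open>w t\<close> of an entry and the parameter of its own cut are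
  averaged into a Morley sequence of pairs, which is indiscernible and still ordered by
  \<open>\<phi>\<close>, but in the reverse direction.\<close>

lemma pat_unstable:
  assumes B: "sml B" and p: "p \<subseteq> pformulas L M xs B" and \<phi>: "formula L (xs @ ys) \<phi>"
    and g: "\<And>t. g t \<in> realizations M xs p" and pt: "\<And>k s. pat M ys \<phi> g k s"
  shows "\<not> stable_type L M xs p"
proof -
  have S: "set xs \<subseteq> Sorts L" "set ys \<subseteq> Sorts L" using \<phi> by (auto simp: formula_def)
  have gt: "g t \<in> tup M xs" for t using g by (simp add: realizations_def)
  have "\<exists>y\<in>tup M ys. \<forall>t. sat M \<phi> (g t @ y) \<longleftrightarrow> t < s" for s
  proof -
    let ?f = "\<lambda>t y. sat M \<phi> (g t @ y) \<longleftrightarrow> t < s"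
    have "\<exists>y\<in>tup M ys. \<forall>X\<in>range ?f. X y"
    proof (rule realize[OF _ S(2)])
      show "sml (\<Union>t. set (g t))" by (rule small_UN[OF gt S(1)])
      fix X assume "X \<in> range ?f"
      then obtain t where X: "X = ?f t" by blast
      have "D {} (case_bool xs ys) UNIV (\<lambda>\<rho>. sat M \<phi> (concat (map \<rho> [True, False])) \<longleftrightarrow> t < s)"
        using \<phi> by (intro dp_iff dp_const dp_formula0) auto
      moreover obtain y0 where "y0 \<in> tup M ys" using pt[of 0 0] by (auto simp: pat_def)
      then have "case_bool (g t) y0 \<in> envs M (case_bool xs ys)"
        using gt by (auto simp: envs_def split: bool.split)
      ultimately have "DS (\<Union>t. set (g t)) ys (\<lambda>y. sat M \<phi> (concat (map
          ((case_bool (g t) y0)(False := y)) [True, False])) \<longleftrightarrow> t < s)"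
        by (rule dp_dset) (use S in \<open>auto split: bool.splits\<close>)
      then show "DS (\<Union>t. set (g t)) ys X" unfolding X by simp
    next
      fix F assume F: "F \<subseteq> range ?f" "finite F"
      then obtain T where T: "finite T" "F = ?f ` T" using finite_subset_image[of F ?f UNIV] by auto
      then obtain k where k: "T \<subseteq> {..<k}" using finite_nat_iff_bounded by blast
      obtain y where "y \<in> tup M ys" "\<forall>t<k. ?f t y" using pt[of k s] by (auto simp: pat_def)
      then show "\<exists>y\<in>tup M ys. \<forall>X\<in>F. X y" unfolding T(2) using k by (intro bexI[of _ y]) auto
    qed
    then show ?thesis by simp
  qed
  then obtain y where y: "\<And>s. y s \<in> tup M ys" "\<And>s t. sat M \<phi> (g t @ y s) \<longleftrightarrow> t < s" by metis
  \<comment> \<open>The cut of \<open>y t\<close> comes just before the entry \<open>t\<close>, so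
    \<open>\<phi>\<close> fails on the diagonal, as the strict order in \<open>stable_type\<close>
    demands.\<close>
  define w where "w t = g t @ y t" for t
  define C where "C = B \<union> (\<Union>t. set (w t))"
  have wt: "w t \<in> tup M (xs @ ys)" for t using gt y(1) by (simp add: w_def tup_appendI)
  have SS: "set (xs @ ys) \<subseteq> Sorts L" using S by simp
  have "sml C" unfolding C_def by (intro small_Un B small_UN[OF wt SS])
  then obtain h where h: "morley (xs @ ys) w C h" using morley_exists SS wt by blast
  have ht: "h k \<in> tup M (xs @ ys)" for k using h by (rule morley_tup)
  have av: "avg (xs @ ys) w (C \<union> (\<Union>j<k. set (h j))) (h k)" for k using h by (simp add: morley_def)
  have wC: "set (w t) \<subseteq> C" for t by (auto simp: C_def)
  let ?n = "length xs"
  have wn: "take ?n (w t) = g t" "drop ?n (w t) = y t" for t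
    using length_tup[OF gt] by (auto simp: w_def)
  define u where "u i = take ?n (h i)" for i
  define v where "v i = drop ?n (h i)" for i
  have ind: "P (h \<circ> j) \<longleftrightarrow> P h" if P: "D {} (\<lambda>_ :: nat. xs @ ys) W P" and "strict_mono j" for W P j
    by (rule morley_indisc[OF h SS wt wC dp_mono[OF P] that(2)]) auto
  have iu: "indiscernible L M xs {(i, j). j \<le> i} u"
    using indiscernible_part[OF ind S ht, where c = True] by (simp add: u_def[abs_def])
  have iv: "indiscernible L M ys {(i, j). j \<le> i} v"
    using indiscernible_part[OF ind S ht, where c = False] by (simp add: v_def[abs_def])
  have "u i \<in> realizations M xs p" for i
  proof -
    have "sat M \<theta> (u i @ b)" if "(\<theta>, b) \<in> p" for \<theta> b
    proof -
      have "DS B xs (\<lambda>x. sat M \<theta> (x @ b))" using that p unfolding dset_def by blast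
      moreover have "DS B ys (\<lambda>_. True)"
        by (rule dsetI[of "[]" _ _ "[]" _ _ "Neg Fls"]) (use S in \<open>auto simp: formula_def\<close>)
      ultimately have "DS B (xs @ ys) (\<lambda>z. sat M \<theta> (take ?n z @ b) \<and> True)" by (rule DS_append)
      then have "DS (C \<union> (\<Union>j<i. set (h j))) (xs @ ys) (\<lambda>z. sat M \<theta> (take ?n z @ b) \<and> True)"
        by (rule dset_mono) (auto simp: C_def)
      from avgD[OF av this] have "sat M \<theta> (u i @ b) \<longleftrightarrow> (\<forall>\<^sub>F t in ulim. sat M \<theta> (g t @ b))"
        by (simp add: u_def wn)
      moreover have "sat M \<theta> (g t @ b)" for t using g[of t] that unfolding realizations_def by blast
      ultimately show ?thesis by simp
    qed
    moreover have "u i \<in> tup M xs" using iu by (simp add: indiscernible_def)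
    ultimately show ?thesis unfolding realizations_def by blast
  qed
  moreover have "sat M \<phi> (u i @ v j) \<longleftrightarrow> (i, j) \<in> {(i, j). j \<le> i} - Id" for i j
  proof -
    let ?Phi = "\<lambda>z z'. sat M \<phi> (take ?n z @ drop ?n z')"
    let ?\<sigma>' = "\<lambda>(v :: nat, c). if c then xs else ys"
    have "D {} ?\<sigma>' {(0, True), (1, False)} (\<lambda>\<rho>. sat M \<phi> (concat (map \<rho> [(0, True), (1, False)])))"
      using \<phi> by (intro dp_formula0) auto
    from dp_split[OF this _ _ S]
    have d: "D {} (\<lambda>_ :: nat. xs @ ys) {0, Suc 0} (\<lambda>\<rho>. ?Phi (\<rho> 0) (\<rho> (Suc 0)))" by simp
    have d': "D {} (\<lambda>_ :: nat. xs @ ys) {0} (\<lambda>\<rho>. ?Phi (\<rho> 0) (\<rho> 0))"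
    proof -
      have "D {} ?\<sigma>' {(0, True), (0, False)} (\<lambda>\<rho>. sat M \<phi> (concat (map \<rho> [(0, True), (0, False)])))"
        using \<phi> by (intro dp_formula0) auto
      from dp_split[OF this _ _ S] show ?thesis by simp
    qed
    have left: "?Phi (h j) z \<longleftrightarrow> (\<forall>\<^sub>F t in ulim. ?Phi (w t) z)"
      if "z \<in> tup M (xs @ ys)" "set z \<subseteq> C \<union> (\<Union>i<j. set (h i))" for j z
      using avg_dp[OF av d refl SS, of "\<lambda>_. z" 0 j] that by (simp add: envs_def)
    have right: "?Phi z (h j) \<longleftrightarrow> (\<forall>\<^sub>F t in ulim. ?Phi z (w t))"
      if "z \<in> tup M (xs @ ys)" "set z \<subseteq> C \<union> (\<Union>i<j. set (h i))" for j z
      using avg_dp[OF av d refl SS, of "\<lambda>_. z" "Suc 0" j] that by (simp add: envs_def)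
    have diag: "?Phi (h j) (h j) \<longleftrightarrow> (\<forall>\<^sub>F t in ulim. ?Phi (w t) (w t))" for j
      using avg_dp[OF av d' refl SS, of "\<lambda>_. w 0" 0 j] wt by (simp add: envs_def)
    have wC': "set (w t) \<subseteq> C \<union> (\<Union>i<j. set (h i))" for t j using wC by blast
    have hC: "set (h i) \<subseteq> C \<union> (\<Union>i<j. set (h i))" if "i < j" for i j using that by blast
    \<comment> \<open>The later entry of \<open>h\<close> is resolved first and becomes the outer
      limit. For \<open>j < i\<close> this asks for \<open>t < t'\<close> with \<open>t'\<close>
      growing after \<open>t\<close> is fixed, which holds; for \<open>i < j\<close> the roles are
      exchanged and the condition fails.\<close>
    have lt: "\<forall>\<^sub>F t' in ulim. ?Phi (w t) (w t')" for t
      using ev_gt[of t] by eventually_elim (simp add: wn y(2))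
    have gt': "\<not> (\<forall>\<^sub>F t' in ulim. ?Phi (w t') (w t))" for t
      unfolding ev_not[symmetric] using ev_gt[of t] by eventually_elim (simp add: wn y(2))
    have 1: "?Phi (h i) (h j)" if "j < i" for i j
      unfolding left[OF ht hC[OF that]] right[OF wt wC'] using lt by simp
    have 2: "\<not> ?Phi (h i) (h j)" if "i < j" for i j
      unfolding right[OF ht hC[OF that]] left[OF wt wC'] using gt' by simp
    have 3: "\<not> ?Phi (h i) (h i)" for i
      unfolding diag by (simp add: wn y(2))
    show ?thesis using 1[of j i] 2[of i j] 3[of i] by (cases i j rule: linorder_cases) (auto simp: u_def v_def)
  qed
  moreover have "linear_order {(i :: nat, j). j \<le> i}"
    by (auto simp: linear_order_on_def partial_order_on_def preorder_on_def refl_on_def trans_def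
        antisym_def total_on_def)
  ultimately show ?thesis unfolding stable_type_def using \<phi> iu iv by blast
qed

end

section \<open>Generic sequences in a stable type\<close>

lemma pat_if_le:
  assumes "\<And>k s. s \<le> k \<Longrightarrow> pat M ys \<phi> g k s"
  shows "pat M ys \<phi> g k s"
proof (cases "s \<le> k")
  case False
  obtain y where "y \<in> tup M ys" "\<forall>t<k. sat M \<phi> (g t @ y) \<longleftrightarrow> t < k"
    using assms[of k k] by (auto simp: pat_def)
  with False show ?thesis unfolding pat_def by (intro bexI[of _ y]) simp_all
qed (rule assms)

text \<open>The situation after all choices have been made. \<open>g\<close> is tied to
  \<open>al\<close> through \<open>g0\<close>, and stability enters through \<open>no_pat\<close>;
  the rest makes \<open>g\<close> indiscernible over \<open>E\<close> and independent over
  \<open>C\<close>.\<close>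

locale generic_sequence = rosy_struct L M \<kappa>
  for L :: "('s, 'f, 'r) lang" and M :: "('s, 'f, 'r, 'm) struct" and \<kappa> :: "'k rel" +
  fixes xs :: "'s list" and C E :: "'m set" and al bs g :: "nat \<Rightarrow> 'm list"
  assumes xs: "set xs \<subseteq> Sorts L" and C: "sml C" "C \<subseteq> E"
    and al: "\<And>i. al i \<in> tup M xs" "\<And>i. set (al i) \<subseteq> C"
    and bs: "\<And>i. bs i \<in> tup M xs" "\<And>i. set (bs i) \<subseteq> E"
    and g0: "avg xs al C (g 0)" and g: "morley xs bs E g"
    and g_ind: "\<And>k. ind (set (g k)) C (\<Union>j<k. set (g j))"
    and no_pat: "\<And>ys \<phi>. formula L (xs @ ys) \<phi> \<Longrightarrow> \<exists>k s. \<not> pat M ys \<phi> g k s"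
begin

lemma g_tup: "g k \<in> tup M xs"
  using g by (rule morley_tup)

lemma g_env: "g \<in> envs M (\<lambda>_. xs)"
  using g_tup by (rule envsI)

lemma g_acl: "morley xs bs (acl E) g"
  using g xs bs by (rule morley_acl)

lemma bs_acl: "set (bs i) \<subseteq> acl E"
  using bs(2) subset_acl by blast

lemma C_acl: "acl C \<subseteq> acl E"
  using C(2) by (rule acl_mono)

lemma g_indisc:
  "D (acl E) (\<lambda>_. xs) W P \<Longrightarrow> strict_mono j \<Longrightarrow> P (g \<circ> j) \<longleftrightarrow> P g"
  by (rule morley_indisc[OF g_acl xs bs(1) bs_acl])

text \<open>Among \<open>2 * N\<close> indices where the truth value changes once, in the middle,
  every window of \<open>N\<close> consecutive ones shows at most one cut, and the windows realize
  all its positions. Indiscernibility moves the window to the first \<open>N\<close>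
  entries.\<close>

lemma pat_block:
  assumes \<phi>: "formula L (xs @ ys) \<phi>" and y: "y \<in> tup M ys" and js: "sorted_wrt (<) js" "length js = 2 * N"
    and cut: "\<And>t. t < 2 * N \<Longrightarrow> sat M \<phi> (g (js ! t) @ y) \<longleftrightarrow> t < N" and s: "s \<le> N"
  shows "pat M ys \<phi> g N s"
proof -
  obtain j where j: "strict_mono j" "\<forall>t<length js. j t = js ! t" using extend_sorted[OF js(1)] by blast
  \<comment> \<open>Starting \<open>N - s\<close> places later leaves \<open>s\<close> indices
    before the change of truth value.\<close>
  define i where "i t = j (t + (N - s))" for t
  have i: "strict_mono i" using j(1) by (auto simp: strict_mono_def i_def)
  have "sat M \<phi> (g (i t) @ y) \<longleftrightarrow> t < s" if "t < N" for t
  proof -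
    have lt: "t + (N - s) < 2 * N" using that s by linarith
    then have "i t = js ! (t + (N - s))" using j(2) js(2) by (simp add: i_def)
    then have "sat M \<phi> (g (i t) @ y) \<longleftrightarrow> t + (N - s) < N" using cut[OF lt] by simp
    also have "\<dots> \<longleftrightarrow> t < s" using s by linarith
    finally show ?thesis .
  qed
  then have "pat M ys \<phi> (g \<circ> i) N s" using y unfolding pat_def by (intro bexI[of _ y]) simp_all
  moreover have "D (acl E) (\<lambda>_. xs) {..<N} (\<lambda>g. pat M ys \<phi> g N s)"
    by (rule dp_mono[OF dp_pat[OF \<phi>]]) simp_all
  ultimately show ?thesis using g_indisc[OF _ i] by blast
qed

text \<open>Choose \<open>2 * N\<close> elements of each set and walk along the numbers until one of
  the two selections has shown \<open>N\<close> elements. By then neither has shown more than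
  \<open>N\<close>, so both have at least \<open>N\<close> still to come.\<close>

lemma first_block:
  fixes P Q :: "nat set"
  assumes "P \<inter> Q = {}" "infinite P \<or> 2 * N < card P" "infinite Q \<or> 2 * N < card Q"
  shows "\<exists>js. sorted_wrt (<) js \<and> length js = 2 * N \<and>
    ((\<forall>t<2 * N. (t < N \<longrightarrow> js ! t \<in> P) \<and> (\<not> t < N \<longrightarrow> js ! t \<in> Q)) \<or>
     (\<forall>t<2 * N. (t < N \<longrightarrow> js ! t \<in> Q) \<and> (\<not> t < N \<longrightarrow> js ! t \<in> P)))"
proof -
  have big: "\<exists>P'\<subseteq>P. finite P' \<and> card P' = 2 * N" if "infinite P \<or> 2 * N < card P" for P :: "nat set"
    using that infinite_arbitrarily_large[of P] obtain_subset_with_card_n[of "2 * N" P]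
    by (metis finite_subset infinite_arbitrarily_large less_imp_le_nat rev_finite_subset)
  obtain P' where P': "P' \<subseteq> P" "finite P'" "card P' = 2 * N" using big assms(2) by blast
  obtain Q' where Q': "Q' \<subseteq> Q" "finite Q'" "card Q' = 2 * N" using big assms(3) by blast
  have key: "\<exists>js. sorted_wrt (<) js \<and> length js = 2 * N \<and>
      (\<forall>t<2 * N. (t < N \<longrightarrow> js ! t \<in> P') \<and> (\<not> t < N \<longrightarrow> js ! t \<in> Q'))"
    if c: "N \<le> card (P' \<inter> {..<m})" "N \<le> card (Q' \<inter> {m..})" for P' Q' :: "nat set" and m
  proof -
    obtain P1 where P1: "P1 \<subseteq> P' \<inter> {..<m}" "card P1 = N" "finite P1"
      by (rule obtain_subset_with_card_n[OF c(1)])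
    obtain Q1 where Q1: "Q1 \<subseteq> Q' \<inter> {m..}" "card Q1 = N" "finite Q1"
      by (rule obtain_subset_with_card_n[OF c(2)])
    let ?p = "sorted_list_of_set P1" and ?q = "sorted_list_of_set Q1"
    have "sorted_wrt (<) (?p @ ?q)" using P1 Q1 by (fastforce simp: sorted_wrt_append)
    moreover have "length (?p @ ?q) = 2 * N" using P1 Q1 by simp
    moreover have "(t < N \<longrightarrow> (?p @ ?q) ! t \<in> P') \<and> (\<not> t < N \<longrightarrow> (?p @ ?q) ! t \<in> Q')" if t: "t < 2 * N" for t
    proof (cases "t < N")
      case True
      then have "?p ! t \<in> P1" using P1 nth_mem[of t ?p] by simp
      then show ?thesis using True P1 by (auto simp: nth_append)
    next
      case False
      then have "?q ! (t - N) \<in> Q1" using Q1 t nth_mem[of "t - N" ?q] by simp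
      then show ?thesis using False P1 Q1 by (auto simp: nth_append)
    qed
    ultimately show ?thesis by blast
  qed
  obtain m0 where m0: "P' \<subseteq> {..<m0}" using P'(2) finite_nat_iff_bounded by blast
  define m where "m = (LEAST m. N \<le> card (P' \<inter> {..<m}) \<or> N \<le> card (Q' \<inter> {..<m}))"
  have "P' \<inter> {..<m0} = P'" using m0 by blast
  then have "N \<le> card (P' \<inter> {..<m0}) \<or> N \<le> card (Q' \<inter> {..<m0})" using P'(3) by simp
  then have m: "N \<le> card (P' \<inter> {..<m}) \<or> N \<le> card (Q' \<inter> {..<m})"
    unfolding m_def by (rule LeastI)
  have le: "card (R \<inter> {..<m}) \<le> N" if R: "R = P' \<or> R = Q'" for R
  proof (cases m)
    case (Suc m1)
    have "\<not> (N \<le> card (P' \<inter> {..<m1}) \<or> N \<le> card (Q' \<inter> {..<m1}))"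
      by (rule not_less_Least) (use Suc in \<open>simp add: m_def[symmetric]\<close>)
    then have lt: "card (R \<inter> {..<m1}) < N" using R by auto
    have "R \<inter> {..<m} \<subseteq> insert m1 (R \<inter> {..<m1})" using Suc by (auto simp: less_Suc_eq)
    then have "card (R \<inter> {..<m}) \<le> card (insert m1 (R \<inter> {..<m1}))" by (intro card_mono) auto
    also have "\<dots> \<le> Suc (card (R \<inter> {..<m1}))" by (rule card_insert_le_m1[THEN order_trans]) auto
    finally show ?thesis using lt by simp
  qed simp
  have split: "card R = card (R \<inter> {..<m}) + card (R \<inter> {m..})" if "finite R" for R
  proof -
    have "R = (R \<inter> {..<m}) \<union> (R \<inter> {m..})" by auto
    moreover have "(R \<inter> {..<m}) \<inter> (R \<inter> {m..}) = {}" by auto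
    ultimately show ?thesis using that card_Un_disjoint[of "R \<inter> {..<m}" "R \<inter> {m..}"] by simp
  qed
  have hi: "N \<le> card (P' \<inter> {m..})" "N \<le> card (Q' \<inter> {m..})"
    using split[OF P'(2)] split[OF Q'(2)] le[of P'] le[of Q'] P'(3) Q'(3) by simp_all
  from m show ?thesis
  proof
    assume "N \<le> card (P' \<inter> {..<m})"
    from key[OF this hi(2)] show ?thesis using P'(1) Q'(1) by blast
  next
    assume "N \<le> card (Q' \<inter> {..<m})"
    from key[OF this hi(1)] show ?thesis using P'(1) Q'(1) by blast
  qed
qed

text \<open>If arbitrarily large parts occurred on both sides, some parameter would yield
  \<open>2 * N\<close> indices with one change of truth value, in one direction or the other, and
  hence all cuts of length \<open>N\<close> for \<open>\<phi>\<close> or for its negation. Neither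
  formula admits all of them.\<close>

lemma dichotomy:
  assumes \<phi>: "formula L (xs @ ys) \<phi>"
  shows "\<exists>N. \<forall>y\<in>tup M ys.
    finite {i. sat M \<phi> (g i @ y)} \<and> card {i. sat M \<phi> (g i @ y)} \<le> N \<or>
    finite {i. \<not> sat M \<phi> (g i @ y)} \<and> card {i. \<not> sat M \<phi> (g i @ y)} \<le> N"
proof (rule ccontr)
  assume n: "\<not> ?thesis"
  have n\<phi>: "formula L (xs @ ys) (Neg \<phi>)" using \<phi> by (simp add: formula_def)
  have "(\<forall>s\<le>N. pat M ys \<phi> g N s) \<or> (\<forall>s\<le>N. pat M ys (Neg \<phi>) g N s)" for N
  proof -
    obtain y where y: "y \<in> tup M ys"
      and 1: "\<not> (finite {i. sat M \<phi> (g i @ y)} \<and> card {i. sat M \<phi> (g i @ y)} \<le> 2 * N)"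
      and 2: "\<not> (finite {i. \<not> sat M \<phi> (g i @ y)} \<and> card {i. \<not> sat M \<phi> (g i @ y)} \<le> 2 * N)"
      using n by blast
    let ?T = "{i. sat M \<phi> (g i @ y)}" and ?F = "{i. \<not> sat M \<phi> (g i @ y)}"
    have "\<exists>js. sorted_wrt (<) js \<and> length js = 2 * N \<and>
      ((\<forall>t<2 * N. (t < N \<longrightarrow> js ! t \<in> ?T) \<and> (\<not> t < N \<longrightarrow> js ! t \<in> ?F)) \<or>
       (\<forall>t<2 * N. (t < N \<longrightarrow> js ! t \<in> ?F) \<and> (\<not> t < N \<longrightarrow> js ! t \<in> ?T)))"
      by (rule first_block) (use 1 2 in auto)
    then obtain js where js: "sorted_wrt (<) js" "length js = 2 * N"
      "(\<forall>t<2 * N. (t < N \<longrightarrow> js ! t \<in> ?T) \<and> (\<not> t < N \<longrightarrow> js ! t \<in> ?F)) \<or>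
       (\<forall>t<2 * N. (t < N \<longrightarrow> js ! t \<in> ?F) \<and> (\<not> t < N \<longrightarrow> js ! t \<in> ?T))"
      by (elim exE conjE)
    from js(3) show ?thesis
    proof
      assume *: "\<forall>t<2 * N. (t < N \<longrightarrow> js ! t \<in> ?T) \<and> (\<not> t < N \<longrightarrow> js ! t \<in> ?F)"
      have "pat M ys \<phi> g N s" if "s \<le> N" for s
        by (rule pat_block[OF \<phi> y js(1,2) _ that]) (use * in auto)
      then show ?thesis by blast
    next
      assume *: "\<forall>t<2 * N. (t < N \<longrightarrow> js ! t \<in> ?F) \<and> (\<not> t < N \<longrightarrow> js ! t \<in> ?T)"
      have "pat M ys (Neg \<phi>) g N s" if "s \<le> N" for s
        by (rule pat_block[OF n\<phi> y js(1,2) _ that]) (use * in auto)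
      then show ?thesis by blast
    qed
  qed
  \<comment> \<open>The claim is applied to a length at which both formulas lack a pattern; longer
    patterns restrict to shorter ones.\<close>
  moreover obtain k s where 1: "\<not> pat M ys \<phi> g k s" "s \<le> k"
    using no_pat[OF \<phi>] pat_if_le[of M ys \<phi> g] by blast
  moreover obtain k' s' where 2: "\<not> pat M ys (Neg \<phi>) g k' s'" "s' \<le> k'"
    using no_pat[OF n\<phi>] pat_if_le[of M ys "Neg \<phi>" g] by blast
  ultimately have "pat M ys \<phi> g (max k k') s \<or> pat M ys (Neg \<phi>) g (max k k') s'"
    by (meson le_max_iff_disj)
  then show False using 1 2 pat_mono by (metis max.cobounded1 max.cobounded2)
qed

section \<open>Definability over the algebraic closure\<close>

definition blk :: "nat \<Rightarrow> 'm list \<Rightarrow> 'm list" where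
  "blk i a = take (length xs) (drop (i * length xs) a)"

lemma blk_concat:
  assumes "\<And>i. \<rho> i \<in> tup M xs" "i < m"
  shows "blk i (concat (map \<rho> [k..<k + m])) = \<rho> (k + i)"
  using assms(2)
proof (induction m arbitrary: i k)
  case (Suc m)
  have c: "concat (map \<rho> [k..<k + Suc m]) = \<rho> k @ concat (map \<rho> [Suc k..<Suc k + m])"
  proof -
    have "k < k + Suc m" by simp
    from upt_conv_Cons[OF this] have "[k..<k + Suc m] = k # [Suc k..<Suc k + m]"
      by (simp only: add_Suc_right add_Suc)
    then show ?thesis by (simp only: list.map concat.simps)
  qed
  have len: "length (\<rho> k) = length xs" by (rule length_tup) (rule assms(1))
  show ?case
  proof (cases i)
    case 0
    then show ?thesis unfolding c blk_def using len by simp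
  next
    case (Suc i')
    have "drop (i * length xs) (\<rho> k @ z) = drop (i' * length xs) z" for z
      using len Suc by simp
    moreover have "blk i' (concat (map \<rho> [Suc k..<Suc k + m])) = \<rho> (Suc k + i')"
      using Suc.prems Suc by (intro Suc.IH) simp
    ultimately show ?thesis unfolding c blk_def Suc by (simp only: add_Suc_right add_Suc)
  qed
qed simp

lemma concat_blk:
  assumes "a \<in> tup M (concat (replicate m xs))"
  obtains \<rho> where "\<And>i. \<rho> i \<in> tup M xs" "a = concat (map \<rho> [0..<m])"
proof -
  have "\<exists>\<rho>. (\<forall>i. \<rho> i \<in> tup M xs) \<and> a = concat (map \<rho> [0..<m])"
    using assms
  proof (induction m arbitrary: a)
    case 0
    then show ?case using g_tup by auto
  next
    case (Suc m)
    then obtain u v where a: "a = u @ v" "u \<in> tup M xs" "v \<in> tup M (concat (replicate m xs))"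
      by (auto simp: tup_append)
    then obtain \<rho> where \<rho>: "\<forall>i. \<rho> i \<in> tup M xs" "v = concat (map \<rho> [0..<m])" using Suc.IH by blast
    have up: "[0..<Suc m] = 0 # map Suc [0..<m]" unfolding map_Suc_upt by (rule upt_conv_Cons) simp
    have "a = concat (map (case_nat u \<rho>) [0..<Suc m])"
      unfolding up using a(1) \<rho>(2) by (simp add: comp_def)
    then show ?case using \<rho>(1) a(2) by (intro exI[of _ "case_nat u \<rho>"]) (simp split: nat.split)
  qed
  then show ?thesis using that by blast
qed

text \<open>By the dichotomy, a majority vote among any \<open>m\<close> consecutive entries decides
  what holds of almost all entries. Having the same majority predicate is a definable equivalence
  relation on tuples of \<open>m\<close> entries, and two disjoint stretches of \<open>g\<close>
  give equivalent, independent tuples. So the code \<open>e\<close> of their class is in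
  \<open>acl C\<close>, and it serves as the parameter of the definition.\<close>

lemma definable_MOST:
  assumes \<phi>: "formula L (xs @ ys) \<phi>" and y0: "y0 \<in> tup M ys"
  obtains \<chi> S e where "S \<in> Sorts L" "e \<in> dom M S" "e \<in> acl C" "formula L (ys @ [S]) \<chi>"
    "\<And>y. y \<in> tup M ys \<Longrightarrow> sat M \<chi> (y @ [e]) \<longleftrightarrow> (MOST j. sat M \<phi> (g j @ y))"
proof -
  have ys: "set ys \<subseteq> Sorts L" using \<phi> by (simp add: formula_def)
  obtain N where N: "\<And>y. y \<in> tup M ys \<Longrightarrow>
    finite {i. sat M \<phi> (g i @ y)} \<and> card {i. sat M \<phi> (g i @ y)} \<le> N \<or>
    finite {i. \<not> sat M \<phi> (g i @ y)} \<and> card {i. \<not> sat M \<phi> (g i @ y)} \<le> N"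
    using dichotomy[OF \<phi>] by blast
  \<comment> \<open>With at most \<open>N\<close> entries on the minority side,
    \<open>2 * N + 1\<close> votes always leave at least \<open>N + 1\<close> for the
    majority.\<close>
  define m where "m = 2 * N + 1"
  define ws where "ws = concat (replicate m xs)"
  have ws: "set ws \<subseteq> Sorts L" using xs by (auto simp: ws_def)
  define \<Psi> where "\<Psi> a y \<longleftrightarrow> N < card {i. i < m \<and> sat M \<phi> (blk i a @ y)}" for a y
  have \<Psi>_MOST: "\<Psi> (concat (map g [k..<k + m])) y \<longleftrightarrow> (MOST j. sat M \<phi> (g j @ y))"
    if y: "y \<in> tup M ys" for k y
  proof -
    let ?T = "{i. i < m \<and> sat M \<phi> (g (k + i) @ y)}" and ?F = "{i. i < m \<and> \<not> sat M \<phi> (g (k + i) @ y)}"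
    have "\<Psi> (concat (map g [k..<k + m])) y \<longleftrightarrow> N < card ?T"
      unfolding \<Psi>_def using blk_concat[where \<rho> = g and k = k, OF g_tup] by (intro arg_cong[where f = "\<lambda>c. N < card c"]) auto
    moreover have inj: "inj_on (\<lambda>i. k + i) B" for B by (simp add: inj_on_def)
    have sum: "card ?T + card ?F = m"
    proof -
      have "card (?T \<union> ?F) = card ?T + card ?F" by (rule card_Un_disjoint) auto
      moreover have "?T \<union> ?F = {..<m}" by auto
      ultimately show ?thesis by simp
    qed
    from N[OF y] have "N < card ?T \<longleftrightarrow> (MOST j. sat M \<phi> (g j @ y))"
    proof
      assume *: "finite {i. sat M \<phi> (g i @ y)} \<and> card {i. sat M \<phi> (g i @ y)} \<le> N"
      have "(\<lambda>i. k + i) ` ?T \<subseteq> {i. sat M \<phi> (g i @ y)}" by auto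
      with * have "card ((\<lambda>i. k + i) ` ?T) \<le> card {i. sat M \<phi> (g i @ y)}" by (intro card_mono) auto
      then have "card ?T \<le> N" using * card_image[OF inj, of ?T] by linarith
      moreover have "{i. sat M \<phi> (g i @ y)} \<union> {i. \<not> sat M \<phi> (g i @ y)} = UNIV" by blast
      then have "infinite {i. \<not> sat M \<phi> (g i @ y)}"
        using * infinite_UNIV_nat finite_Un[of "{i. sat M \<phi> (g i @ y)}"] by metis
      ultimately show ?thesis by (simp add: MOST_iff_cofinite)
    next
      assume *: "finite {i. \<not> sat M \<phi> (g i @ y)} \<and> card {i. \<not> sat M \<phi> (g i @ y)} \<le> N"
      have "(\<lambda>i. k + i) ` ?F \<subseteq> {i. \<not> sat M \<phi> (g i @ y)}" by auto
      with * have "card ((\<lambda>i. k + i) ` ?F) \<le> card {i. \<not> sat M \<phi> (g i @ y)}" by (intro card_mono) auto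
      then have "card ?F \<le> N" using * card_image[OF inj, of ?F] by linarith
      then have "N < card ?T" using sum by (simp add: m_def)
      then show ?thesis using * by (simp add: MOST_iff_cofinite)
    qed
    ultimately show ?thesis by simp
  qed
  \<comment> \<open>Variables \<open>0\<close> to \<open>2 * m - 1\<close> hold two tuples of
    \<open>m\<close> entries each, and variable \<open>2 * m\<close> holds \<open>y\<close>.\<close>
  let ?\<sigma> = "\<lambda>v. if v < 2 * m then xs else ys"
  have maj: "D {} ?\<sigma> (insert (2 * m) {k..<k + m}) (\<lambda>\<rho>. N < card {i. i < m \<and> sat M \<phi> (\<rho> (k + i) @ \<rho> (2 * m))})"
    if k: "k \<le> m" for k
  proof -
    \<comment> \<open>The majority condition is a finite disjunction over the sets of more than
      \<open>N\<close> voters.\<close>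
    let ?I = "{I. I \<subseteq> {..<m} \<and> N < card I}"
    have "D {} ?\<sigma> (insert (2 * m) {k..<k + m}) (\<lambda>\<rho>. \<exists>I\<in>?I. \<forall>i\<in>I. sat M \<phi> (concat (map \<rho> [k + i, 2 * m])))"
    proof (intro dp_bex_finite dp_ball_finite dp_formula0)
      show "finite ?I" by (rule finite_subset[of _ "Pow {..<m}"]) auto
      fix I i assume I: "I \<in> ?I"
      then show "finite I" using finite_subset by blast
      assume "i \<in> I"
      with I k have "k + i < 2 * m" "i < m" by auto
      then show "formula L (concat (map ?\<sigma> [k + i, 2 * m])) \<phi>"
        "set [k + i, 2 * m] \<subseteq> insert (2 * m) {k..<k + m}"
        using \<phi> by simp_all
    qed
    then show ?thesis
    proof (rule dp_cong)
      fix \<rho> :: "nat \<Rightarrow> 'm list"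
      let ?T = "{i. i < m \<and> sat M \<phi> (\<rho> (k + i) @ \<rho> (2 * m))}"
      show "(\<exists>I\<in>?I. \<forall>i\<in>I. sat M \<phi> (concat (map \<rho> [k + i, 2 * m]))) \<longleftrightarrow> N < card ?T"
      proof
        assume "\<exists>I\<in>?I. \<forall>i\<in>I. sat M \<phi> (concat (map \<rho> [k + i, 2 * m]))"
        then obtain I where "I \<subseteq> ?T" "N < card I" by auto
        then show "N < card ?T" using card_mono[of ?T I] by simp
      next
        assume "N < card ?T"
        then show "\<exists>I\<in>?I. \<forall>i\<in>I. sat M \<phi> (concat (map \<rho> [k + i, 2 * m]))"
          by (intro bexI[of _ ?T]) auto
      qed
    qed
  qed
  have ws_m: "concat (map ?\<sigma> [k..<k + m]) = ws" if "k \<le> m" for k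
  proof -
    have "map ?\<sigma> [k..<k + m] = replicate m xs" using that by (intro nth_equalityI) auto
    then show ?thesis by (simp only: ws_def)
  qed
  have two: "[0..<2 * m] = [0..<0 + m] @ [m..<m + m]"
    using upt_add_eq_append[of 0 m m] by (simp add: mult_2)
  have "D {} ?\<sigma> ({..2 * m} - {2 * m}) (\<lambda>\<rho>. \<forall>y\<in>tup M (?\<sigma> (2 * m)).
      (N < card {i. i < m \<and> sat M \<phi> ((\<rho>(2 * m := y)) (0 + i) @ (\<rho>(2 * m := y)) (2 * m))}) \<longleftrightarrow>
      (N < card {i. i < m \<and> sat M \<phi> ((\<rho>(2 * m := y)) (m + i) @ (\<rho>(2 * m := y)) (2 * m))}))"
    by (rule dp_all[OF dp_iff[OF dp_mono[OF maj[OF le0]] dp_mono[OF maj[OF order_refl]]]]) auto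
  then have "D {} ?\<sigma> ({..2 * m} - {2 * m}) (\<lambda>\<rho>. \<forall>y\<in>tup M ys.
      (N < card {i. i < m \<and> sat M \<phi> (\<rho> (0 + i) @ y)}) \<longleftrightarrow>
      (N < card {i. i < m \<and> sat M \<phi> (\<rho> (m + i) @ y)}))" (is "D _ _ _ ?Q")
  proof (rule dp_cong)
    fix \<rho> :: "nat \<Rightarrow> 'm list"
    have upd: "{i. i < m \<and> sat M \<phi> ((\<rho>(2 * m := y)) (k + i) @ (\<rho>(2 * m := y)) (2 * m))} =
      {i. i < m \<and> sat M \<phi> (\<rho> (k + i) @ y)}" if "k \<le> m" for y k using that by auto
    have ss: "?\<sigma> (2 * m) = ys" by simp
    show "(\<forall>y\<in>tup M (?\<sigma> (2 * m)).
      (N < card {i. i < m \<and> sat M \<phi> ((\<rho>(2 * m := y)) (0 + i) @ (\<rho>(2 * m := y)) (2 * m))}) \<longleftrightarrow>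
      (N < card {i. i < m \<and> sat M \<phi> ((\<rho>(2 * m := y)) (m + i) @ (\<rho>(2 * m := y)) (2 * m))})) \<longleftrightarrow> ?Q \<rho>"
      unfolding upd[OF le0] upd[OF order_refl] ss ..
  qed
  moreover have "{..2 * m} - {2 * m} = {..<2 * m}" by auto
  ultimately have dQ: "D {} ?\<sigma> {..<2 * m} ?Q" by (simp only:)
  have sub: "{..<2 * m} \<subseteq> set [0..<2 * m]" by auto
  have Sub: "set (concat (map ?\<sigma> [0..<2 * m])) \<subseteq> Sorts L" using xs ys by auto
  obtain EE where EE: "formula L (concat (map ?\<sigma> [0..<2 * m])) EE"
    "\<And>\<rho>. \<rho> \<in> envs M ?\<sigma> \<Longrightarrow> ?Q \<rho> \<longleftrightarrow> sat M EE (concat (map \<rho> [0..<2 * m]))"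
    by (rule dp_obtain0[OF dQ finite_lessThan sub Sub]) (rule that)
  have EEf: "formula L (ws @ ws) EE"
    using EE(1) ws_m[of 0] ws_m[of m] unfolding two by simp
  have EEs: "sat M EE (a @ b) \<longleftrightarrow> (\<forall>y\<in>tup M ys. \<Psi> a y \<longleftrightarrow> \<Psi> b y)"
    if ab: "a \<in> tup M ws" "b \<in> tup M ws" for a b
  proof -
    obtain \<rho>1 where 1: "\<And>i. \<rho>1 i \<in> tup M xs" "a = concat (map \<rho>1 [0..<m])"
      using concat_blk ab(1) unfolding ws_def by blast
    obtain \<rho>2 where 2: "\<And>i. \<rho>2 i \<in> tup M xs" "b = concat (map \<rho>2 [0..<m])"
      using concat_blk ab(2) unfolding ws_def by blast
    define \<rho> where "\<rho> v = (if v < m then \<rho>1 v else if v < 2 * m then \<rho>2 (v - m) else y0)" for v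
    have \<rho>: "\<rho> \<in> envs M ?\<sigma>" using 1 2 y0 by (auto simp: envs_def \<rho>_def)
    have "map \<rho> [0..<m] = map \<rho>1 [0..<m]" by (auto simp: \<rho>_def)
    moreover have "map \<rho> [m..<m + m] = map \<rho>2 [0..<m]" by (intro nth_equalityI) (auto simp: \<rho>_def)
    ultimately have "concat (map \<rho> [0..<2 * m]) = a @ b"
      unfolding two 1(2) 2(2) map_append concat_append by (simp only: add_0)
    moreover have "\<rho> i = blk i a" "\<rho> (m + i) = blk i b" if "i < m" for i
      using blk_concat[where \<rho> = \<rho>1 and k = 0, OF 1(1) that]
        blk_concat[where \<rho> = \<rho>2 and k = 0, OF 2(1) that] 1(2) 2(2) that
      by (simp_all add: \<rho>_def)
    then have "{i. i < m \<and> sat M \<phi> (\<rho> (0 + i) @ y)} = {i. i < m \<and> sat M \<phi> (blk i a @ y)}"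
      "{i. i < m \<and> sat M \<phi> (\<rho> (m + i) @ y)} = {i. i < m \<and> sat M \<phi> (blk i b @ y)}" for y
      by auto
    ultimately show ?thesis using EE(2)[OF \<rho>] by (simp only: \<Psi>_def)
  qed
  have defE: "defines_equiv L M ws EE"
    unfolding defines_equiv_def using EEf
    by (auto simp: equiv_def refl_on_def sym_def trans_def EEs)
  \<comment> \<open>Two adjacent stretches of \<open>g\<close> of length \<open>m\<close>: both
    compute the same majority, and the second is independent from the first over
    \<open>C\<close>.\<close>
  define u where "u = concat (map g [0..<0 + m])"
  define u' where "u' = concat (map g [m..<m + m])"
  have ct: "concat (map g [k..<k + m]) \<in> tup M ws" for k
  proof -
    have "map (\<lambda>_. xs) [k..<k + m] = replicate m xs" by (intro nth_equalityI) auto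
    moreover have "concat (map g [k..<k + m]) \<in> tup M (concat (map (\<lambda>_. xs) [k..<k + m]))"
      by (rule tup_concat) (rule g_tup)
    ultimately show ?thesis by (simp only: ws_def)
  qed
  then have u: "u \<in> tup M ws" "u' \<in> tup M ws" by (simp_all only: u_def u'_def)
  have uu: "sat M EE (u @ u')"
  proof -
    have "\<Psi> u y \<longleftrightarrow> \<Psi> u' y" if "y \<in> tup M ys" for y
      using \<Psi>_MOST[OF that, of 0] \<Psi>_MOST[OF that, of m] by (simp only: u_def u'_def)
    then show ?thesis using EEs[OF u] by blast
  qed
  have su: "set u = (\<Union>j<m. set (g j))" "set u' = (\<Union>j\<in>{m..<m + m}. set (g j))"
    by (auto simp: u_def u'_def)
  have "ind (set u') C (set u)"
    unfolding su using ind_seq[OF C(1) g_tup xs g_ind, of m "2 * N"] by (simp add: m_def)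
  then obtain S \<delta> e where S: "S \<in> Sorts L" "e \<in> dom M S" "e \<in> acl C" "formula L (ws @ [S]) \<delta>"
    "\<And>x. x \<in> tup M ws \<Longrightarrow> sat M \<delta> (x @ [e]) \<longleftrightarrow> sat M EE (x @ u)"
    by (rule quotient_acl[OF defE ws u uu _ C(1)]) (rule that)
  have sub\<psi>: "insert (2 * m) {0..<0 + m} \<subseteq> set ([0..<0 + m] @ [2 * m])" by auto
  have ws\<psi>: "concat (map ?\<sigma> ([0..<0 + m] @ [2 * m])) = ws @ ys"
    using ws_m[OF le0] by (simp del: map_map)
  obtain \<psi> where \<psi>: "formula L (concat (map ?\<sigma> ([0..<0 + m] @ [2 * m]))) \<psi>"
    "\<And>\<rho>. \<rho> \<in> envs M ?\<sigma> \<Longrightarrow> (N < card {i. i < m \<and> sat M \<phi> (\<rho> (0 + i) @ \<rho> (2 * m))}) \<longleftrightarrow>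
      sat M \<psi> (concat (map \<rho> ([0..<0 + m] @ [2 * m])))"
  proof (rule dp_obtain0[OF maj[OF le0] _ sub\<psi>])
    show "set (concat (map ?\<sigma> ([0..<0 + m] @ [2 * m]))) \<subseteq> Sorts L" unfolding ws\<psi> using ws ys by simp
  qed (simp, rule that)
  have \<psi>s: "sat M \<psi> (a @ y) \<longleftrightarrow> \<Psi> a y" if a: "a \<in> tup M ws" and y: "y \<in> tup M ys" for a y
  proof -
    obtain \<rho>1 where 1: "\<And>i. \<rho>1 i \<in> tup M xs" "a = concat (map \<rho>1 [0..<m])"
      using concat_blk a unfolding ws_def by blast
    define \<rho> where "\<rho> v = (if v < 2 * m then \<rho>1 v else y)" for v
    have \<rho>: "\<rho> \<in> envs M ?\<sigma>" using 1 y by (auto simp: envs_def \<rho>_def)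
    have "map \<rho> [0..<0 + m] = map \<rho>1 [0..<m]" by (auto simp: \<rho>_def)
    then have "concat (map \<rho> ([0..<0 + m] @ [2 * m])) = a @ y"
      unfolding 1(2) map_append concat_append by (simp add: \<rho>_def del: map_eq_conv)
    moreover have "{i. i < m \<and> sat M \<phi> (\<rho> (0 + i) @ \<rho> (2 * m))} = {i. i < m \<and> sat M \<phi> (blk i a @ y)}"
      using blk_concat[where \<rho> = \<rho>1 and k = 0 and m = m, OF 1(1)] 1(2) by (auto simp: \<rho>_def)
    ultimately show ?thesis using \<psi>(2)[OF \<rho>] by (simp only: \<Psi>_def)
  qed
  \<comment> \<open>The definition says that some tuple in the class coded by \<open>e\<close> has a
    majority for \<open>y\<close>. Equivalent tuples agree on this, so it does not matter which of
    them is taken.\<close>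
  define \<tau> :: "nat \<Rightarrow> 's list" where "\<tau> v = (if v = 0 then ws else if v = 1 then ys else [S])" for v
  have "D {} \<tau> {0, 1, 2} (\<lambda>\<rho>. sat M \<delta> (concat (map \<rho> [0, 2])) \<and> sat M \<psi> (concat (map \<rho> [0, 1])))"
    using S(4) \<psi>(1) unfolding ws\<psi> by (intro dp_conj dp_formula0) (simp_all add: \<tau>_def)
  from dp_ex[OF this, of 0]
  have "D {} \<tau> ({0, 1, 2} - {0}) (\<lambda>\<rho>. \<exists>x\<in>tup M (\<tau> 0). sat M \<delta> (concat (map (\<rho>(0 := x)) [0, 2])) \<and>
      sat M \<psi> (concat (map (\<rho>(0 := x)) [0, 1])))" .
  then obtain \<chi> where \<chi>: "formula L (concat (map \<tau> [1, 2])) \<chi>"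
    "\<And>\<rho>. \<rho> \<in> envs M \<tau> \<Longrightarrow> (\<exists>x\<in>tup M (\<tau> 0). sat M \<delta> (concat (map (\<rho>(0 := x)) [0, 2])) \<and>
      sat M \<psi> (concat (map (\<rho>(0 := x)) [0, 1]))) \<longleftrightarrow> sat M \<chi> (concat (map \<rho> [1, 2]))"
  proof (rule dp_obtain0[where ws = "[1, 2]"])
    show "set (concat (map \<tau> [1, 2])) \<subseteq> Sorts L" using ys S(1) by (simp add: \<tau>_def)
  qed (auto intro: that)
  show ?thesis
  proof (rule that[OF S(1-3)])
    show "formula L (ys @ [S]) \<chi>" using \<chi>(1) by (simp add: \<tau>_def)
    fix y assume y: "y \<in> tup M ys"
    have "(\<lambda>v. if v = 0 then u else if v = 1 then y else [e]) \<in> envs M \<tau>"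
      using u(1) y S(2) by (auto simp: envs_def \<tau>_def tup_nth)
    from \<chi>(2)[OF this] have "sat M \<chi> (y @ [e]) \<longleftrightarrow>
        (\<exists>x\<in>tup M ws. sat M \<delta> (x @ [e]) \<and> sat M \<psi> (x @ y))"
      by (simp add: \<tau>_def)
    also have "\<dots> \<longleftrightarrow> (\<exists>x\<in>tup M ws. sat M EE (x @ u) \<and> \<Psi> x y)"
      using S(5) \<psi>s[OF _ y] by (intro bex_cong) simp_all
    also have "\<dots> \<longleftrightarrow> \<Psi> u y" using EEs[OF _ u(1)] u(1) y by blast
    also have "\<dots> \<longleftrightarrow> (MOST j. sat M \<phi> (g j @ y))" unfolding u_def by (rule \<Psi>_MOST[OF y])
    finally show "sat M \<chi> (y @ [e]) \<longleftrightarrow> (MOST j. sat M \<phi> (g j @ y))" .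
  qed
qed

text \<open>All other variables and the parameters from \<open>acl C\<close> together play the part
  of \<open>y\<close> in \<open>definable_MOST\<close>. The price of the quantifier is one more
  algebraic parameter.\<close>

lemma dp_MOST:
  assumes P: "D (acl C) (\<lambda>_ :: nat. xs) W P"
  shows "D (acl C) (\<lambda>_. xs) (W - {k}) (\<lambda>\<rho>. MOST j. P (\<rho>(k := g j)))"
proof -
  obtain V where V: "finite V" "V \<subseteq> W" "D (acl C) (\<lambda>_. xs) V P"
    by (rule dp_finite_supp[OF P]) (rule that)
  obtain us where us: "set us = V - {k}" using finite_list[of "V - {k}"] V(1) by blast
  have sub: "V \<subseteq> set (k # us)" using us by auto
  have S: "set (concat (map (\<lambda>_. xs) (k # us))) \<subseteq> Sorts L" using xs by auto
  obtain \<phi> b zs where f: "set b \<subseteq> acl C" "b \<in> tup M zs"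
    "formula L (concat (map (\<lambda>_. xs) (k # us)) @ zs) \<phi>"
    "\<And>\<rho>. \<rho> \<in> envs M (\<lambda>_. xs) \<Longrightarrow> P \<rho> \<longleftrightarrow> sat M \<phi> (concat (map \<rho> (k # us)) @ b)"
    by (rule dp_obtain[OF V(3,1) sub S]) (rule that)
  let ?ys = "concat (map (\<lambda>_. xs) us) @ zs"
  have f': "formula L (xs @ ?ys) \<phi>" using f(3) by simp
  have ct: "concat (map \<rho> us) @ b \<in> tup M ?ys" if "\<rho> \<in> envs M (\<lambda>_. xs)" for \<rho>
    by (intro tup_appendI f(2) tup_concat envsD[OF that])
  obtain \<chi> S e where \<chi>: "S \<in> Sorts L" "e \<in> dom M S" "e \<in> acl C" "formula L (?ys @ [S]) \<chi>"
    "\<And>y. y \<in> tup M ?ys \<Longrightarrow> sat M \<chi> (y @ [e]) \<longleftrightarrow> (MOST j. sat M \<phi> (g j @ y))"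
    by (rule definable_MOST[OF f' ct[OF g_env]]) (rule that)
  show ?thesis
  proof (rule dpI)
    show "set us \<subseteq> W - {k}" using us V(2) by auto
    show "set (b @ [e]) \<subseteq> acl C" using f(1) \<chi>(3) by simp
    show "b @ [e] \<in> tup M (zs @ [S])" using f(2) \<chi>(2) by (intro tup_appendI) (simp_all add: tup_nth)
    show "formula L (concat (map (\<lambda>_. xs) us) @ zs @ [S]) \<chi>" using \<chi>(4) by simp
    fix \<rho> :: "nat \<Rightarrow> 'm list" assume \<rho>: "\<rho> \<in> envs M (\<lambda>_. xs)"
    have "P (\<rho>(k := g j)) \<longleftrightarrow> sat M \<phi> (g j @ concat (map \<rho> us) @ b)" for j
    proof -
      have "map (\<rho>(k := g j)) us = map \<rho> us" using us by auto
      then show ?thesis using f(4)[OF envs_upd[OF \<rho> g_tup]] by (simp del: map_eq_conv)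
    qed
    then show "(MOST j. P (\<rho>(k := g j))) \<longleftrightarrow> sat M \<chi> (concat (map \<rho> us) @ b @ [e])"
      using \<chi>(5)[OF ct[OF \<rho>]] by simp
  qed
qed

section \<open>Exchange of the averages of \<open>al\<close> and \<open>g\<close>\<close>

lemma MOST_const:
  fixes k :: nat
  assumes "\<And>j. k \<le> j \<Longrightarrow> P j \<longleftrightarrow> c"
  shows "(MOST j. P j) \<longleftrightarrow> c"
proof
  assume "MOST j. P j"
  then obtain m where "\<forall>j\<ge>m. P j" unfolding MOST_nat_le by blast
  then show c using assms[of "max m k"] by simp
next
  assume c
  then show "MOST j. P j" using assms unfolding MOST_nat_le by (intro exI[of _ k]) simp
qed

text \<open>Fixing the first variable shifts the numbering of the others down, so that an induction
  on the number of variables can continue.\<close>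

lemma dp_case_nat:
  assumes P: "D B (\<lambda>_ :: nat. xs) {..n} P" and a: "a \<in> tup M xs" "set a \<subseteq> B"
  shows "D B (\<lambda>_. xs) {..<n} (\<lambda>\<rho>. P (case_nat a \<rho>))"
proof -
  have "D B (\<lambda>_. xs) ({..n} - {0}) (\<lambda>\<rho>. P (\<rho>(0 := a)))" using dp_inst[OF P, of a 0] a by simp
  then have "D B (\<lambda>_. xs) ((\<lambda>v. v - 1) ` ({..n} - {0})) (\<lambda>\<rho>. P (case_nat a \<rho>))"
  proof (rule dp_rename)
    fix \<rho> :: "nat \<Rightarrow> 'm list" assume \<rho>: "\<rho> \<in> envs M (\<lambda>_. xs)"
    show "\<exists>\<rho>'\<in>envs M (\<lambda>_. xs). (\<forall>v\<in>{..n} - {0}. \<rho>' v = \<rho> (v - 1)) \<and>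
      (P (\<rho>'(0 := a)) \<longleftrightarrow> P (case_nat a \<rho>))"
    proof (intro bexI conjI ballI)
      show "case_nat a \<rho> \<in> envs M (\<lambda>_. xs)" using \<rho> a(1) by (auto simp: envs_def split: nat.split)
      have "(case_nat a \<rho>)(0 := a) = case_nat a \<rho>" by (rule ext) (simp split: nat.split)
      then show "P ((case_nat a \<rho>)(0 := a)) \<longleftrightarrow> P (case_nat a \<rho>)" by (simp only:)
      show "case_nat a \<rho> v = \<rho> (v - 1)" if "v \<in> {..n} - {0}" for v using that by (simp split: nat.split)
    qed
  qed simp
  moreover have "(\<lambda>v. v - 1) ` ({..n} - {0}) \<subseteq> {..<n}" by auto
  ultimately show ?thesis by (rule dp_mono[OF _ order_refl])
qed

lemma case_nat_env: "a \<in> tup M xs \<Longrightarrow> \<rho> \<in> envs M (\<lambda>_. xs) \<Longrightarrow> case_nat a \<rho> \<in> envs M (\<lambda>_. xs)"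
  by (auto simp: envs_def split: nat.split)

text \<open>
  The last variable \<open>g n\<close> is traded for the definition of the average type of
  \<open>g\<close>, which is over \<open>acl C\<close>.
\<close>

lemma averages_commute:
  "D (acl C) (\<lambda>_. xs) {..n} P \<Longrightarrow> (\<forall>\<^sub>F i in ulim. P (case_nat (al i) g)) \<longleftrightarrow> P g"
proof (induction n arbitrary: P)
  case 0
  have "P (g(0 := g 0)) \<longleftrightarrow> (\<forall>\<^sub>F i in ulim. P (g(0 := al i)))"
    by (rule avg_dp[OF avg_acl[OF g0 xs al] 0 refl xs g_env]) simp_all
  moreover have "P (g(0 := al i)) \<longleftrightarrow> P (case_nat (al i) g)" for i
    by (rule dp_supp[OF 0]) (intro envs_upd case_nat_env al(1) g_env | simp)+
  ultimately show ?case by (simp del: fun_upd_apply)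
next
  case (Suc n)
  let ?P1 = "\<lambda>\<rho>. MOST j. P (\<rho>(Suc n := g j))"
  have "{..Suc n} - {Suc n} = {..n}" by auto
  then have P1: "D (acl C) (\<lambda>_. xs) {..n} ?P1" using dp_MOST[OF Suc.prems, of "Suc n"] by (simp only:)
  have PE: "D (acl E) (\<lambda>_. xs) {..Suc n} P" by (rule dp_mono[OF Suc.prems C_acl order_refl])
  have left: "?P1 (case_nat (al i) g) \<longleftrightarrow> P (case_nat (al i) g)" for i
  proof (rule MOST_const[where k = n])
    fix j assume j: "n \<le> j"
    \<comment> \<open>Behind the head \<open>al i\<close> the variable \<open>Suc n\<close> is the
      entry \<open>n\<close> of \<open>g\<close>, so it may move to any \<open>j \<ge> n\<close>.
      Indiscernibility over \<open>acl E\<close> applies because this set contains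
      \<open>al i\<close>.\<close>
    define f where "f t = (if t < n then t else t + (j - n))" for t
    have f: "strict_mono f" by (auto simp: strict_mono_def f_def)
    have "set (al i) \<subseteq> acl E" using al(2) C(2) subset_acl by blast
    with al(1) have d: "D (acl E) (\<lambda>_. xs) {..<Suc n} (\<lambda>\<rho>. P (case_nat (al i) \<rho>))"
      by (rule dp_case_nat[OF PE])
    have "P ((case_nat (al i) g)(Suc n := g j)) \<longleftrightarrow> P (case_nat (al i) (g \<circ> f))"
    proof (rule dp_supp[OF Suc.prems])
      show "(case_nat (al i) g)(Suc n := g j) \<in> envs M (\<lambda>_. xs)"
        by (intro envs_upd case_nat_env al(1) g_env g_tup)
      show "case_nat (al i) (g \<circ> f) \<in> envs M (\<lambda>_. xs)"
        using g_tup by (intro case_nat_env al(1) envsI) simp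
      fix v assume "v \<in> {..Suc n}"
      then show "((case_nat (al i) g)(Suc n := g j)) v = case_nat (al i) (g \<circ> f) v"
        using j by (cases v) (auto simp: f_def)
    qed
    also have "\<dots> \<longleftrightarrow> P (case_nat (al i) g)" using g_indisc[OF d f] .
    finally show "P ((case_nat (al i) g)(Suc n := g j)) \<longleftrightarrow> P (case_nat (al i) g)" .
  qed
  have right: "?P1 g \<longleftrightarrow> P g"
  proof (rule MOST_const[where k = "Suc n"])
    fix j assume j: "Suc n \<le> j"
    \<comment> \<open>Without the extra head the variable is the entry \<open>Suc n\<close> of
      \<open>g\<close>, hence the bound is larger by one.\<close>
    define f where "f t = (if t < Suc n then t else t + (j - Suc n))" for t
    have f: "strict_mono f" by (auto simp: strict_mono_def f_def)
    have "P (g(Suc n := g j)) \<longleftrightarrow> P (g \<circ> f)"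
    proof (rule dp_supp[OF Suc.prems])
      show "g(Suc n := g j) \<in> envs M (\<lambda>_. xs)" by (intro envs_upd g_env g_tup)
      show "g \<circ> f \<in> envs M (\<lambda>_. xs)" using g_tup by (intro envsI) simp
      fix v assume "v \<in> {..Suc n}"
      then show "(g(Suc n := g j)) v = (g \<circ> f) v" using j by (auto simp: f_def)
    qed
    also have "\<dots> \<longleftrightarrow> P g" using g_indisc[OF PE f] .
    finally show "P (g(Suc n := g j)) \<longleftrightarrow> P g" .
  qed
  show ?case using Suc.IH[OF P1] unfolding left right .
qed

text \<open>With \<open>al i\<close> fixed as first entry, the induction hypothesis replaces all the
  others by entries of \<open>g\<close>, provided that their indices start above \<open>i\<close>;
  the bound \<open>k\<close> is there to permit this. Since it works for all large \<open>i\<close>,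
  \<open>averages_commute\<close> then replaces the first entry.\<close>

lemma transfer_increasing:
  assumes "D C (\<lambda>_. xs) {..<n} P"
    and "\<And>l. strict_mono l \<Longrightarrow> k \<le> l 0 \<Longrightarrow> P (al \<circ> l)"
  shows "P g"
  using assms
proof (induction n arbitrary: P k)
  case 0
  have "P (al \<circ> (\<lambda>t. t + k))" by (rule 0(2)) (auto simp: strict_mono_def)
  moreover have "P (al \<circ> (\<lambda>t. t + k)) \<longleftrightarrow> P g"
    by (rule dp_supp[OF 0(1)]) (use al(1) g_env in \<open>auto intro: envsI\<close>)
  ultimately show ?case by blast
next
  case (Suc n)
  have P: "D C (\<lambda>_. xs) {..n} P" using Suc.prems(1) by (simp only: lessThan_Suc_atMost)
  have "P (case_nat (al i) g)" if i: "k < i" for i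
  proof (rule Suc.IH[of "\<lambda>\<rho>. P (case_nat (al i) \<rho>)" "Suc i"])
    show "D C (\<lambda>_. xs) {..<n} (\<lambda>\<rho>. P (case_nat (al i) \<rho>))" by (rule dp_case_nat[OF P al])
    fix l :: "nat \<Rightarrow> nat" assume l: "strict_mono l" "Suc i \<le> l 0"
    have "strict_mono (case_nat i l)"
      using l by (auto simp: strict_mono_Suc_iff split: nat.split)
    then have "P (al \<circ> case_nat i l)" using i by (intro Suc.prems(2)) auto
    moreover have "al \<circ> case_nat i l = case_nat (al i) (al \<circ> l)"
      by (rule ext) (simp split: nat.split)
    ultimately show "P (case_nat (al i) (al \<circ> l))" by (simp only:)
  qed
  then have "\<forall>\<^sub>F i in ulim. P (case_nat (al i) g)" by (rule eventually_mono[OF ev_gt])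
  moreover have "D (acl C) (\<lambda>_. xs) {..n} P" by (rule dp_mono[OF P subset_acl order_refl])
  ultimately show ?case using averages_commute by blast
qed

theorem no_increasing_pattern:
  assumes "formula L (xs @ ys) \<phi>"
  shows "\<not> (\<forall>l. strict_mono l \<longrightarrow> (\<forall>k s. pat M ys \<phi> (al \<circ> l) k s))"
proof
  assume inc: "\<forall>l. strict_mono l \<longrightarrow> (\<forall>k s. pat M ys \<phi> (al \<circ> l) k s)"
  have "pat M ys \<phi> g k s" for k s
  proof (rule transfer_increasing)
    show "D C (\<lambda>_. xs) {..<k} (\<lambda>g. pat M ys \<phi> g k s)"
      by (rule dp_mono[OF dp_pat[OF assms]]) simp_all
    show "pat M ys \<phi> (al \<circ> l) k s" if "strict_mono l" for l using inc that by blast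
  qed
  then show False using no_pat[OF assms] by blast
qed

end

section \<open>Non-thorn-forking extensions of unstable types\<close>

text \<open>Reversing the order of a sequence amounts to negating the formula, up to a shift by one.\<close>

lemma order_pattern:
  fixes r :: "nat rel"
  assumes r: "linear_order r" and b: "\<And>j. b j \<in> tup M ys"
    and ord: "\<And>i j. sat M \<phi> (a i @ b j) \<longleftrightarrow> (i, j) \<in> r - Id"
  shows "\<exists>\<psi>\<in>{\<phi>, Neg \<phi>}. \<exists>h :: nat \<Rightarrow> nat. \<forall>l. strict_mono l \<longrightarrow> (\<forall>k s. pat M ys \<psi> ((a \<circ> h) \<circ> l) k s)"
proof -
  \<comment> \<open>The colour of a pair records whether \<open>r\<close> agrees on it with the
    usual order. On a homogeneous set \<open>r\<close> is therefore the usual order or its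
    reverse.\<close>
  define f where "f S = (if (Min S, Max S) \<in> r then 0 else (1 :: nat))" for S :: "nat set"
  have f2: "f S < 2" for S by (simp add: f_def)
  have "\<exists>Y t. Y \<subseteq> UNIV \<and> infinite Y \<and> t < 2 \<and> (\<forall>x\<in>Y. \<forall>y\<in>Y. x \<noteq> y \<longrightarrow> f {x, y} = t)"
    by (rule Ramsey2[OF infinite_UNIV_nat]) (simp add: f2)
  then obtain Y t where Y: "infinite Y" "t < 2" "\<forall>x\<in>Y. \<forall>y\<in>Y. x \<noteq> y \<longrightarrow> f {x, y} = t"
    by (elim exE conjE)
  obtain h :: "nat \<Rightarrow> nat" where hh: "strict_mono h \<and> (\<forall>n. h n \<in> Y)"
    using infinite_enumerate[OF Y(1)] by (rule exE)
  have hY: "h n \<in> Y" for n using hh by (rule conjunct2[THEN spec])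
  have less: "h i < h j" if "i < j" for i j using hh[THEN conjunct1] that by (rule strict_monoD)
  have inj: "h i \<noteq> h j" if "i < j" for i j using less[OF that] by (rule less_imp_neq)
  have fh: "f {h i, h j} = t" if "i < j" for i j
    using Y(3)[rule_format, OF hY hY inj[OF that]] .
  have mm: "f {h i, h j} = (if (h i, h j) \<in> r then 0 else 1)" if "i < j" for i j
    using less[OF that] by (simp add: f_def)
  have anti: "x = y" if "(x, y) \<in> r" "(y, x) \<in> r" for x y
    using r that unfolding linear_order_on_def partial_order_on_def antisym_def by blast
  have tot: "(x, y) \<in> r \<or> (y, x) \<in> r" if "x \<noteq> y" for x y
    using r that unfolding linear_order_on_def total_on_def by blast
  have eq: "\<not> sat M \<phi> (a (h i) @ b (h i))" for i by (simp add: ord)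
  show ?thesis
  proof (cases "t = 0")
    case True
    have up: "(h i, h j) \<in> r" if "i < j" for i j
    proof (rule ccontr)
      assume "(h i, h j) \<notin> r"
      then show False using fh[OF that] mm[OF that] True by simp
    qed
    have lt: "sat M \<phi> (a (h i) @ b (h j))" if "i < j" for i j
      using up[OF that] inj[OF that] by (simp add: ord)
    have gt: "\<not> sat M \<phi> (a (h j) @ b (h i))" if "i < j" for i j
      using anti[OF up[OF that]] inj[OF that] by (auto simp: ord)
    have iff: "sat M \<phi> (a (h i) @ b (h j)) \<longleftrightarrow> i < j" for i j
      using lt[of i j] gt[of j i] eq[of i] by (cases i j rule: linorder_cases) simp_all
    have "pat M ys \<phi> ((a \<circ> h) \<circ> l) k s" if l: "strict_mono l" for l k s
      unfolding pat_def
    proof (intro bexI allI impI)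
      show "b (h (l s)) \<in> tup M ys" by (rule b)
      show "sat M \<phi> (((a \<circ> h) \<circ> l) t @ b (h (l s))) \<longleftrightarrow> t < s" for t
        using iff[of "l t" "l s"] strict_mono_less[OF l, of t s] by (simp only: comp_apply)
    qed
    then show ?thesis by (intro bexI[of _ \<phi>] exI[of _ h] allI impI) simp_all
  next
    case False
    have down: "(h j, h i) \<in> r" if "i < j" for i j
    proof -
      have "(h i, h j) \<notin> r" using fh[OF that] mm[OF that] False by auto
      then show ?thesis using tot[OF inj[OF that]] by blast
    qed
    have gt: "sat M \<phi> (a (h j) @ b (h i))" if "i < j" for i j
      using down[OF that] inj[OF that] by (auto simp: ord)
    have lt: "\<not> sat M \<phi> (a (h i) @ b (h j))" if "i < j" for i j
      using anti[OF _ down[OF that]] inj[OF that] by (auto simp: ord)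
    have iff: "sat M \<phi> (a (h i) @ b (h j)) \<longleftrightarrow> j < i" for i j
      using lt[of i j] gt[of j i] eq[of i] by (cases i j rule: linorder_cases) simp_all
    have "pat M ys (Neg \<phi>) ((a \<circ> (h \<circ> Suc)) \<circ> l) k s" if l: "strict_mono l" for l k s
      unfolding pat_def
    proof (intro bexI allI impI)
      \<comment> \<open>The cut before all entries needs an index below every
        \<open>Suc (l t)\<close>: this is 0, which the shift by \<open>Suc\<close> has left free.
        For any other cut the index is that of the last entry before it.\<close>
      let ?j = "case_nat 0 (\<lambda>s'. Suc (l s')) s"
      show "b (h ?j) \<in> tup M ys" by (rule b)
      have cut: "\<not> ?j < Suc (l t) \<longleftrightarrow> t < s" for t
        using strict_mono_less[OF l, of "s - 1" t] by (cases s) auto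
      show "sat M (Neg \<phi>) (((a \<circ> (h \<circ> Suc)) \<circ> l) t @ b (h ?j)) \<longleftrightarrow> t < s" for t
        using iff[of "Suc (l t)" ?j] cut[of t] unfolding comp_apply sat.simps by blast
    qed
    then show ?thesis
      by (intro bexI[of _ "Neg \<phi>"] exI[of _ "h \<circ> Suc"] allI impI) simp_all
  qed
qed

section \<open>Conjugation by realizing types\<close>

context saturated_struct
begin

text \<open>A parameter tuple may mix entries of \<open>A\<close> and of \<open>n\<close> in any
  order and with repetitions. Entries in \<open>A\<close> remain parameters, and each other entry is
  read off from a position of \<open>n\<close>; the sorts match because different sorts are
  disjoint. Once \<open>n\<close> is separated in this way, it can be replaced by a
  conjugate.\<close>

lemma DS_param:
  assumes X: "DS (A \<union> set n) xs X" and n: "n \<in> tup M zs" "set zs \<subseteq> Sorts L"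
  shows "\<exists>Y. DS A (xs @ zs) Y \<and> (\<forall>x\<in>tup M xs. X x \<longleftrightarrow> Y (x @ n))"
proof -
  obtain \<phi> f ys where f: "set f \<subseteq> A \<union> set n" "f \<in> tup M ys" "formula L (xs @ ys) \<phi>"
    "\<And>x. x \<in> tup M xs \<Longrightarrow> X x \<longleftrightarrow> sat M \<phi> (x @ f)"
    by (rule dsetE[OF X]) (rule that)
  have ys: "set ys \<subseteq> Sorts L" "set xs \<subseteq> Sorts L" using f(3) by (simp_all add: formula_def)
  have lf: "length f = length ys" using f(2) by (rule length_tup)
  have ln: "length n = length zs" using n(1) by (rule length_tup)
  define I where "I = filter (\<lambda>i. f ! i \<in> A) [0..<length ys]"
  define f' where "f' = map (\<lambda>i. f ! i) I"
  define ys' where "ys' = map (\<lambda>i. ys ! i) I"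
  have Ilt: "i < length ys" "f ! i \<in> A" if "i \<in> set I" for i using that by (auto simp: I_def)
  have "\<exists>k<length I. I ! k = i" if "i < length ys" "f ! i \<in> A" for i
  proof -
    have "i \<in> set I" using that by (simp add: I_def)
    then show ?thesis by (simp add: in_set_conv_nth)
  qed
  then obtain pos where pos: "\<And>i. i < length ys \<Longrightarrow> f ! i \<in> A \<Longrightarrow> pos i < length I \<and> I ! pos i = i"
    by metis
  have "\<exists>j<length zs. n ! j = f ! i" if "i < length ys" "f ! i \<notin> A" for i
  proof -
    have "f ! i \<in> set f" using that(1) lf by simp
    then have "f ! i \<in> set n" using that(2) f(1) by blast
    then show ?thesis using ln by (simp add: in_set_conv_nth)
  qed
  then obtain jj where jj: "\<And>i. i < length ys \<Longrightarrow> f ! i \<notin> A \<Longrightarrow> jj i < length zs \<and> n ! jj i = f ! i"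
    by metis
  have sj: "zs ! jj i = ys ! i" if i: "i < length ys" "f ! i \<notin> A" for i
  proof (rule dom_disj)
    show "zs ! jj i \<in> Sorts L" using jj[OF i] n(2) by (meson nth_mem subsetD)
    show "ys ! i \<in> Sorts L" using ys i(1) by (meson nth_mem subsetD)
    show "f ! i \<in> dom M (zs ! jj i)" using jj[OF i] n(1) by (metis tup_nth)
    show "f ! i \<in> dom M (ys ! i)" using f(2) i(1) by (simp add: tup_nth)
  qed
  \<comment> \<open>The new context consists of the variables, then \<open>n\<close>, then the
    parameters kept from \<open>A\<close>, numbered by \<open>pos\<close>.\<close>
  define F where "F i = (if i < length xs then i else
    if f ! (i - length xs) \<in> A then length xs + (length zs + pos (i - length xs))
    else length xs + jj (i - length xs))" for i
  have f'1: "set f' \<subseteq> A" using Ilt by (auto simp: f'_def)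
  have f'2: "f' \<in> tup M ys'" using f(2) Ilt by (auto simp: f'_def ys'_def tup_nth)
  have F1: "F i < length ((xs @ zs) @ ys') \<and> ((xs @ zs) @ ys') ! F i = (xs @ ys) ! i"
    if i: "i < length (xs @ ys)" for i
  proof (cases "i < length xs")
    case True
    then show ?thesis by (simp add: F_def nth_append)
  next
    case False
    define t where "t = i - length xs"
    have t: "i = length xs + t" "t < length ys" using False i by (auto simp: t_def)
    show ?thesis
    proof (cases "f ! t \<in> A")
      case True
      then show ?thesis using pos[OF t(2) True] t by (simp add: F_def ys'_def nth_append)
    next
      case False
      then show ?thesis using jj[OF t(2) False] sj[OF t(2) False] t by (simp add: F_def nth_append)
    qed
  qed
  have F2: "((x @ n) @ f') ! F i = (x @ f) ! i" if x: "x \<in> tup M xs" and i: "i < length (xs @ ys)" for x i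
  proof (cases "i < length xs")
    case True
    then show ?thesis using length_tup[OF x] by (simp add: F_def nth_append)
  next
    case False
    define t where "t = i - length xs"
    have t: "i = length xs + t" "t < length ys" using False i by (auto simp: t_def)
    show ?thesis
    proof (cases "f ! t \<in> A")
      case True
      then show ?thesis using pos[OF t(2) True] t length_tup[OF x] ln
        by (simp add: F_def f'_def nth_append)
    next
      case False
      then show ?thesis using jj[OF t(2) False] t length_tup[OF x] ln by (simp add: F_def nth_append)
    qed
  qed
  have w: "wf_fm L (xs @ ys) \<phi>" using f(3) by (simp add: formula_def)
  have "wf_fm L ((xs @ zs) @ ys') (ren F \<phi>)" using F1 by (intro wf_ren[OF w]) blast
  moreover have "set ys' \<subseteq> Sorts L" using ys(1) Ilt by (auto simp: ys'_def)
  ultimately have fm: "formula L ((xs @ zs) @ ys') (ren F \<phi>)" using ys(2) n(2) by (simp add: formula_def)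
  have "DS A (xs @ zs) (\<lambda>z. sat M (ren F \<phi>) (z @ f'))" by (rule dsetI[OF f'1 f'2 fm]) simp
  moreover have "X x \<longleftrightarrow> sat M (ren F \<phi>) ((x @ n) @ f')" if x: "x \<in> tup M xs" for x
    unfolding f(4)[OF x] using F2[OF x] by (intro sat_ren[OF w, symmetric]) blast
  ultimately show ?thesis by blast
qed

text \<open>Finite satisfiability gives, by saturation, a point satisfying \<open>p\<close>;
  completeness leaves no room for further formulas in its type.\<close>

lemma realize_type:
  assumes B: "sml B" and xs: "set xs \<subseteq> Sorts L" and p: "p \<in> complete_types L M xs B"
  obtains b where "b \<in> realizations M xs p" "p = tp L M xs b B"
proof -
  have pf: "p \<subseteq> pformulas L M xs B" and fs: "fin_sat M xs p"
    and cp: "\<And>\<phi> c. (\<phi>, c) \<in> pformulas L M xs B \<Longrightarrow> (\<phi>, c) \<in> p \<or> (Neg \<phi>, c) \<in> p"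
    using p by (auto simp: complete_types_def)
  let ?f = "\<lambda>(\<phi>, c) x. sat M \<phi> (x @ c)"
  have "\<exists>x\<in>tup M xs. \<forall>X\<in>?f ` p. X x"
  proof (rule realize[OF B xs])
    fix X assume "X \<in> ?f ` p"
    then show "DS B xs X" using pf unfolding dset_def by auto
  next
    fix F assume F: "F \<subseteq> ?f ` p" "finite F"
    then obtain F0 where F0: "F0 \<subseteq> p" "finite F0" "F = ?f ` F0" using finite_subset_image[of F ?f p] by auto
    then obtain x where "x \<in> realizations M xs F0" using fs unfolding fin_sat_def by blast
    then show "\<exists>x\<in>tup M xs. \<forall>X\<in>F. X x"
      unfolding F0(3) realizations_def by (intro bexI[of _ x]) auto
  qed
  then obtain b where b: "b \<in> tup M xs" "\<forall>X\<in>?f ` p. X b" by (rule bexE)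
  have bp: "sat M \<phi> (b @ c)" if "(\<phi>, c) \<in> p" for \<phi> c using bspec[OF b(2) imageI[OF that]] by simp
  have "p = tp L M xs b B"
  proof
    show "p \<subseteq> tp L M xs b B" using pf bp by (auto simp: tp_def)
    show "tp L M xs b B \<subseteq> p" using cp bp by (fastforce simp: tp_def)
  qed
  moreover have "b \<in> realizations M xs p" using b(1) bp by (auto simp: realizations_def)
  ultimately show ?thesis using that by blast
qed

lemma tp_D:
  "tp L M xs a A = tp L M xs a' A \<Longrightarrow> a \<in> tup M xs \<Longrightarrow> a' \<in> tup M xs \<Longrightarrow> DS A xs X \<Longrightarrow> X a \<longleftrightarrow> X a'"
  using tp_eq_iff by blast

lemma eeq_single:
  fixes \<rho> :: "nat \<Rightarrow> 'm list"
  assumes t: "tp L M xs (\<rho> 0) A = tp L M xs a A" and \<rho>: "\<rho> \<in> envs M \<sigma>" and a: "a \<in> tup M xs"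
    and \<sigma>: "\<sigma> 0 = xs" "set xs \<subseteq> Sorts L"
  shows "eeq A \<sigma> {0} \<rho> (\<rho>(0 := a))"
  unfolding eeq_def
proof (intro allI impI)
  fix P assume P: "D A \<sigma> {0} P"
  have "DS A xs (\<lambda>x. P (\<rho>(0 := x)))" by (rule dp_dset[OF P \<rho> \<sigma>]) simp_all
  moreover have "\<rho> 0 \<in> tup M xs" using envsD[OF \<rho>, of 0] \<sigma>(1) by simp
  ultimately have "P (\<rho>(0 := \<rho> 0)) \<longleftrightarrow> P (\<rho>(0 := a))" using tp_D[OF t _ a] by blast
  then show "P \<rho> \<longleftrightarrow> P (\<rho>(0 := a))" by (simp only: fun_upd_triv)
qed

text \<open>Stands in for an automorphism over \<open>A\<close> that takes \<open>a\<close> to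
  \<open>a'\<close>: it provides a sequence in the same relation to \<open>a'\<close> as
  \<open>g\<close> is to \<open>a\<close>, as far as conditions on finitely many entries go.
  Position 0 of the environment holds the tuple that is moved.\<close>

lemma lift_sequence:
  assumes t: "tp L M zs a A = tp L M zs a' A" and a: "a \<in> tup M zs" "a' \<in> tup M zs"
    and S: "set zs \<subseteq> Sorts L" "set xs \<subseteq> Sorts L" and A: "sml A" and g: "\<And>i. g i \<in> tup M xs"
  obtains g' where "\<And>i. g' i \<in> tup M xs"
    "\<And>P n. D A (case_nat zs (\<lambda>_. xs)) {..<n} P \<Longrightarrow> P (case_nat a g) \<longleftrightarrow> P (case_nat a' g')"
proof -
  let ?\<sigma> = "case_nat zs (\<lambda>_. xs)"
  have \<rho>: "case_nat a g \<in> envs M ?\<sigma>" using a(1) g by (auto simp: envs_def split: nat.split)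
  have e: "eeq A ?\<sigma> {0} (case_nat a g) ((case_nat a g)(0 := a'))"
    by (rule eeq_single[OF _ \<rho> a(2)]) (use t S in simp_all)
  have \<rho>1: "(case_nat a g)(0 := a') \<in> envs M ?\<sigma>" by (rule envs_upd[OF \<rho>]) (use a in simp)
  have sg: "set (?\<sigma> v) \<subseteq> Sorts L" for v using S by (cases v) simp_all
  obtain \<rho>' where \<rho>': "\<rho>' \<in> envs M ?\<sigma>" "\<rho>' 0 = ((case_nat a g)(0 := a')) 0 \<and>
      (\<forall>n. eeq A ?\<sigma> {..<n} (case_nat a g) \<rho>')"
    by (rule bexE[OF eeq_lift[OF e \<rho> \<rho>1 A sg]]) (rule that)
  have eq: "case_nat a' (\<lambda>i. \<rho>' (Suc i)) = \<rho>'"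
    using \<rho>'(2) by (intro ext) (simp split: nat.split)
  show ?thesis
  proof (rule that)
    show "\<rho>' (Suc i) \<in> tup M xs" for i using envsD[OF \<rho>'(1), of "Suc i"] by simp
    show "P (case_nat a g) \<longleftrightarrow> P (case_nat a' (\<lambda>i. \<rho>' (Suc i)))" if "D A ?\<sigma> {..<n} P" for P n
      unfolding eq by (rule \<rho>'(2)[THEN conjunct2, unfolded eeq_def, rule_format, OF that])
  qed
qed

lemma pat_lift:
  assumes \<phi>: "formula L (xs @ ys) \<phi>" and l: "strict_mono l"
    and g': "\<And>P n. D A (case_nat zs (\<lambda>_. xs)) {..<n} P \<Longrightarrow> P (case_nat a g) \<longleftrightarrow> P (case_nat a' g')"
    and p: "pat M ys \<phi> (g \<circ> l) k s"
  shows "pat M ys \<phi> (g' \<circ> l) k s"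
proof -
  let ?\<sigma> = "case_nat zs (\<lambda>_. xs)"
  have "D {} ?\<sigma> ((\<lambda>i. Suc (l i)) ` {..<k}) (\<lambda>\<rho>. pat M ys \<phi> (\<lambda>i. \<rho> (Suc (l i))) k s)"
  proof (rule dp_rename[OF dp_pat[OF \<phi>]])
    fix \<rho> assume \<rho>: "\<rho> \<in> envs M ?\<sigma>"
    have "\<rho> (Suc (l v)) \<in> tup M xs" for v using envsD[OF \<rho>, of "Suc (l v)"] by simp
    then have "(\<lambda>i. \<rho> (Suc (l i))) \<in> envs M (\<lambda>_. xs)" by (rule envsI)
    then show "\<exists>\<rho>'\<in>envs M (\<lambda>_. xs). (\<forall>v\<in>{..<k}. \<rho>' v = \<rho> (Suc (l v))) \<and>
      (pat M ys \<phi> \<rho>' k s \<longleftrightarrow> pat M ys \<phi> (\<lambda>i. \<rho> (Suc (l i))) k s)"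
      by (rule bexI[rotated]) simp
  qed simp
  moreover obtain n where "(\<lambda>i. Suc (l i)) ` {..<k} \<subseteq> {..<n}"
    using finite_nat_iff_bounded[of "(\<lambda>i. Suc (l i)) ` {..<k}"] by blast
  ultimately have "D A ?\<sigma> {..<n} (\<lambda>\<rho>. pat M ys \<phi> (\<lambda>i. \<rho> (Suc (l i))) k s)"
    by (rule dp_mono[OF _ empty_subsetI])
  from g'[OF this] show ?thesis using p by (simp add: comp_def)
qed

text \<open>A set over \<open>A\<close> and the \<open>al i\<close> uses finitely many of them, so
  it has the form \<open>Y (x @ concat (map al [0..<k]))\<close> with \<open>Y\<close> over
  \<open>A\<close>. Membership of \<open>b\<close> and of each \<open>al i\<close> is then a
  condition on finitely many entries of the lifted environment, with the same truth value as for
  \<open>h\<close> and \<open>al0 i\<close>. Hence the limits agree.\<close>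

lemma avg_lift:
  assumes h: "avg xs al0 (A \<union> (\<Union>i. set (al0 i))) h" and al0: "\<And>i. al0 i \<in> tup M xs"
    and xs: "set xs \<subseteq> Sorts L" and b: "b \<in> tup M xs" and al: "\<And>i. al i \<in> tup M xs"
    and lift: "\<And>P n. D A (case_nat xs (\<lambda>_. xs)) {..<n} P \<Longrightarrow> P (case_nat h al0) \<longleftrightarrow> P (case_nat b al)"
  shows "avg xs al (A \<union> (\<Union>i. set (al i))) b"
proof -
  have "X b \<longleftrightarrow> (\<forall>\<^sub>F i in ulim. X (al i))" if X: "DS (A \<union> (\<Union>i. set (al i))) xs X" for X
  proof -
    obtain \<phi> f ys where f: "set f \<subseteq> A \<union> (\<Union>i. set (al i))" "f \<in> tup M ys" "formula L (xs @ ys) \<phi>"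
      "\<And>x. x \<in> tup M xs \<Longrightarrow> X x \<longleftrightarrow> sat M \<phi> (x @ f)"
      by (rule dsetE[OF X]) (rule that)
    have "\<exists>k. set f \<subseteq> A \<union> set (concat (map al [0..<k]))"
      using f(1)
    proof (induction f)
      case (Cons e f)
      then obtain k where k: "set f \<subseteq> A \<union> set (concat (map al [0..<k]))" by auto
      show ?case
      proof (cases "e \<in> A")
        case False
        then obtain i where "e \<in> set (al i)" using Cons.prems by auto
        then have "set (e # f) \<subseteq> A \<union> set (concat (map al [0..<max k (Suc i)]))"
          using k by (fastforce simp: less_max_iff_disj)
        then show ?thesis by blast
      qed (use k in auto)
    qed simp
    then obtain k where "set f \<subseteq> A \<union> set (concat (map al [0..<k]))" by blast
    from dsetI[OF this f(2-4)] have X': "DS (A \<union> set (concat (map al [0..<k]))) xs X" by simp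
    let ?zs = "concat (map (\<lambda>_. xs) [0..<k])"
    have ct: "concat (map \<rho> [0..<k]) \<in> tup M ?zs" if "\<And>i. \<rho> i \<in> tup M xs" for \<rho>
      by (rule tup_concat) (rule that)
    have zs: "set ?zs \<subseteq> Sorts L" using xs by auto
    obtain Y where Y: "DS A (xs @ ?zs) Y" "\<forall>x\<in>tup M xs. X x \<longleftrightarrow> Y (x @ concat (map al [0..<k]))"
      using DS_param[OF X' ct[OF al] zs] by blast
    obtain \<psi> c ws where p: "set c \<subseteq> A" "c \<in> tup M ws" "formula L ((xs @ ?zs) @ ws) \<psi>"
      "\<And>x. x \<in> tup M (xs @ ?zs) \<Longrightarrow> Y x \<longleftrightarrow> sat M \<psi> (x @ c)"
      by (rule dsetE[OF Y(1)]) (rule that)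
    let ?\<sigma> = "case_nat xs (\<lambda>_. xs)"
    \<comment> \<open>One formula for both uses: with \<open>v\<close> equal to 0 the first block is
      the head of the environment, and with \<open>v\<close> equal to \<open>Suc i\<close> it is the
      entry \<open>i\<close> of the sequence.\<close>
    have "map ?\<sigma> (v # map Suc [0..<k]) = xs # map (\<lambda>_. xs) [0..<k]" for v by (simp split: nat.split)
    then have "D A ?\<sigma> (set (v # map Suc [0..<k])) (\<lambda>\<rho>. sat M \<psi> (concat (map \<rho> (v # map Suc [0..<k])) @ c))" for v
      using p(1-3) by (intro dp_formula[where ys = ws]) (simp_all del: map_map list.map(2))
    then have d: "D A ?\<sigma> {..<Suc (v + k)} (\<lambda>\<rho>. sat M \<psi> (concat (map \<rho> (v # map Suc [0..<k])) @ c))" for v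
      by (rule dp_mono) auto
    let ?Z = "\<lambda>x \<rho>. sat M \<psi> (x @ concat (map \<rho> [0..<k]) @ c)"
    have Yc: "Y (x @ concat (map \<rho> [0..<k])) \<longleftrightarrow> ?Z x \<rho>" if "x \<in> tup M xs" "\<And>i. \<rho> i \<in> tup M xs" for x \<rho>
      using p(4)[OF tup_appendI[OF that(1) ct[OF that(2)]]] by simp
    have Z0: "?Z h al0 \<longleftrightarrow> ?Z b al" using lift[OF d[of 0]] by (simp add: comp_def)
    have ZS: "?Z (al0 i) al0 \<longleftrightarrow> ?Z (al i) al" for i using lift[OF d[of "Suc i"]] by (simp add: comp_def)
    have "DS (A \<union> (\<Union>i. set (al0 i))) xs (\<lambda>x. Y (x @ concat (map al0 [0..<k])))"
      by (rule dset_plug[OF Y(1) ct[OF al0]]) auto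
    from avgD[OF h this] have "?Z h al0 \<longleftrightarrow> (\<forall>\<^sub>F i in ulim. ?Z (al0 i) al0)"
      using Yc[OF avg_tup[OF h] al0] Yc[OF al0 al0] by simp
    then have "?Z b al \<longleftrightarrow> (\<forall>\<^sub>F i in ulim. ?Z (al i) al)" unfolding Z0 ZS .
    then show ?thesis using Y(2) b al Yc[OF b al] Yc[OF al al] by simp
  qed
  with b show ?thesis by (simp add: avg_def)
qed

text \<open>The entries of \<open>g\<close> realize the type of \<open>b\<close> over
  \<open>A\<close> and \<open>n'\<close>, which is only a conjugate of the stable type. Lifting
  \<open>g\<close> along the conjugation of \<open>n'\<close> to \<open>n\<close> gives
  \<open>g'\<close> realizing the stable type itself: truth of \<open>Y\<close> passes from
  \<open>b @ n\<close> to \<open>b @ n'\<close>, to \<open>g i @ n'\<close>, and to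
  \<open>g' i @ n\<close>. Patterns of \<open>g\<close> pass to \<open>g'\<close> as well and would
  make the type unstable.\<close>

lemma no_pat_conjugate:
  assumes A: "sml A" and S: "set zs \<subseteq> Sorts L" "set xs \<subseteq> Sorts L"
    and n: "n \<in> tup M zs" "n' \<in> tup M zs" and b: "b \<in> tup M xs"
    and t: "tp L M zs n' (set b \<union> A) = tp L M zs n (set b \<union> A)"
    and st: "stable_type L M xs (tp L M xs b (A \<union> set n))"
    and g: "\<And>k. g k \<in> tup M xs" "\<And>k X. DS (A \<union> set n') xs X \<Longrightarrow> X (g k) \<longleftrightarrow> X b"
    and \<phi>: "formula L (xs @ ys) \<phi>"
  shows "\<exists>k s. \<not> pat M ys \<phi> g k s"
proof (rule ccontr)
  assume "\<not> ?thesis"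
  then have pt: "\<And>k s. pat M ys \<phi> g k s" by blast
  have t': "tp L M zs n' A = tp L M zs n A"
    unfolding tp_eq_iff[OF n(2,1)]
  proof (intro allI impI)
    fix X assume "DS A zs X"
    then have "DS (set b \<union> A) zs X" by (rule dset_mono) simp
    then show "X n' \<longleftrightarrow> X n" by (rule tp_D[OF t n(2,1)])
  qed
  obtain g' where g': "\<And>i. g' i \<in> tup M xs"
    "\<And>P m. D A (case_nat zs (\<lambda>_. xs)) {..<m} P \<Longrightarrow> P (case_nat n' g) \<longleftrightarrow> P (case_nat n g')"
    by (rule lift_sequence[OF t' n(2,1) S A g(1)]) (rule that)
  have "pat M ys \<phi> (g' \<circ> id) k s" for k s
    by (rule pat_lift[where l = id and zs = zs and a = n' and a' = n and g = g and g' = g', OF \<phi> _ g'(2)]) (use pt in \<open>simp_all add: strict_mono_def\<close>)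
  then have pt': "pat M ys \<phi> g' k s" for k s by simp
  have gr: "g' i \<in> realizations M xs (tp L M xs b (A \<union> set n))" for i
  proof -
    have "sat M \<theta> (g' i @ c)" if \<theta>: "(\<theta>, c) \<in> tp L M xs b (A \<union> set n)" for \<theta> c
    proof -
      have X: "DS (A \<union> set n) xs (\<lambda>x. sat M \<theta> (x @ c))" and Xb: "sat M \<theta> (b @ c)"
        using \<theta> by (auto simp: tp_def dset_def)
      obtain Y where Y: "DS A (xs @ zs) Y" "\<forall>x\<in>tup M xs. sat M \<theta> (x @ c) \<longleftrightarrow> Y (x @ n)"
        using DS_param[OF X n(1) S(1)] by blast
      obtain \<psi> d ws where p: "set d \<subseteq> A" "d \<in> tup M ws" "formula L ((xs @ zs) @ ws) \<psi>"
        "\<And>x. x \<in> tup M (xs @ zs) \<Longrightarrow> Y x \<longleftrightarrow> sat M \<psi> (x @ d)"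
        by (rule dsetE[OF Y(1)]) (rule that)
      have "D A (case_nat zs (\<lambda>_. xs)) {..<Suc (Suc i)} (\<lambda>\<rho>. sat M \<psi> (concat (map \<rho> [Suc i, 0]) @ d))"
        using p(1-3) by (intro dp_formula[where ys = ws]) auto
      from g'(2)[OF this] have "sat M \<psi> (g i @ n' @ d) \<longleftrightarrow> sat M \<psi> (g' i @ n @ d)" by simp
      then have 1: "Y (g i @ n') \<longleftrightarrow> Y (g' i @ n)"
        using p(4)[OF tup_appendI[OF g(1) n(2)]] p(4)[OF tup_appendI[OF g'(1) n(1)]] by simp
      have "DS (A \<union> set n') xs (\<lambda>x. Y (x @ n'))" by (rule dset_plug[OF Y(1) n(2)]) auto
      from g(2)[OF this] have 2: "Y (g i @ n') \<longleftrightarrow> Y (b @ n')" .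
      have "DS (set b \<union> A) zs (\<lambda>z. Y (b @ z))" by (rule dset_plug_left[OF Y(1) b]) auto
      from tp_D[OF t n(2,1) this] have 3: "Y (b @ n') \<longleftrightarrow> Y (b @ n)" .
      have "Y (b @ n)" using bspec[OF Y(2) b] Xb by blast
      then show ?thesis using 1 2 3 bspec[OF Y(2) g'(1)] by blast
    qed
    then show ?thesis using g'(1) unfolding realizations_def by blast
  qed
  have "\<not> stable_type L M xs (tp L M xs b (A \<union> set n))"
    by (rule pat_unstable[OF small_Un[OF A small_tup[OF n(1) S(1)]] _ \<phi> gr pt']) (auto simp: tp_def)
  then show False using st by blast
qed

end

section \<open>Construction of the generic sequence from a non-thorn-forking extension\<close>

context rosy_struct
begin

theorem stable_extension_thorn_forks:
  assumes A: "sml A" and S: "set zs \<subseteq> Sorts L" "set xs \<subseteq> Sorts L" and n: "n \<in> tup M zs"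
    and p: "p \<in> complete_types L M xs (A \<union> set n)" and st: "stable_type L M xs p"
    and unst: "\<not> stable_type L M xs (restrict_type L M xs p A)"
  shows "type_thorn_forks L M xs A p"
proof (rule ccontr)
  assume nf: "\<not> type_thorn_forks L M xs A p"
  have sn: "sml (set n)" by (rule small_tup[OF n S(1)])
  obtain b where b: "b \<in> realizations M xs p" "p = tp L M xs b (A \<union> set n)"
    by (rule realize_type[OF small_Un[OF A sn] S(2) p]) (rule that)
  have bt: "b \<in> tup M xs" using b(1) by (simp add: realizations_def)
  have sb: "sml (set b)" by (rule small_tup[OF bt S(2)])
  have ind0: "ind (set b) A (set n)"
    by (rule thorn_indepI[OF bt S(2)]) (use nf b(2) in \<open>simp add: Un_commute\<close>)
  obtain ys \<phi> r a c where u: "formula L (xs @ ys) \<phi>" "linear_order (r :: nat rel)"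
    "\<forall>i. a i \<in> realizations M xs (restrict_type L M xs p A)" "indiscernible L M ys r c"
    "\<forall>i j. sat M \<phi> (a i @ c j) \<longleftrightarrow> (i, j) \<in> r - Id"
    using unst unfolding stable_type_def not_not by (elim exE conjE)
  have ct: "c j \<in> tup M ys" for j using u(4) by (simp add: indiscernible_def)
  have "\<exists>\<psi>\<in>{\<phi>, Neg \<phi>}. \<exists>h :: nat \<Rightarrow> nat. \<forall>l. strict_mono l \<longrightarrow> (\<forall>k s. pat M ys \<psi> ((a \<circ> h) \<circ> l) k s)"
    by (rule order_pattern[OF u(2) ct u(5)[rule_format]])
  then obtain \<psi> and h :: "nat \<Rightarrow> nat" where \<psi>: "\<psi> \<in> {\<phi>, Neg \<phi>}"
    and inc': "\<forall>l. strict_mono l \<longrightarrow> (\<forall>k s. pat M ys \<psi> ((a \<circ> h) \<circ> l) k s)"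
    by (elim bexE exE)
  have inc: "pat M ys \<psi> ((a \<circ> h) \<circ> l) k s" if "strict_mono l" for l k s
    using inc' that by simp
  have \<psi>f: "formula L (xs @ ys) \<psi>" using \<psi> u(1) by (auto simp: formula_def)
  define al0 where "al0 = a \<circ> h"
  have al0r: "al0 i \<in> realizations M xs (restrict_type L M xs p A)" for i using u(3) by (simp add: al0_def)
  have al0t: "al0 i \<in> tup M xs" for i using al0r by (simp add: realizations_def)
  have al0b: "X (al0 i) \<longleftrightarrow> X b" if X: "DS A xs X" for X i
  proof -
    have *: "X (al0 i)" if X: "DS A xs X" and "X b" for X
    proof -
      obtain \<theta> d where f: "(\<theta>, d) \<in> pformulas L M xs A" "\<forall>x\<in>tup M xs. X x \<longleftrightarrow> sat M \<theta> (x @ d)"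
        using X unfolding dset_def by blast
      then have "(\<theta>, d) \<in> tp L M xs b (A \<union> set n)"
        using \<open>X b\<close> bt by (auto simp: tp_def pformulas_def)
      then have "(\<theta>, d) \<in> restrict_type L M xs p A" using f(1) b(2) by (simp add: restrict_type_def)
      then show ?thesis using al0r[of i] al0t[of i] f(2) unfolding realizations_def by blast
    qed
    show ?thesis using *[OF X] *[OF ev_not_DS[OF X]] by blast
  qed
  \<comment> \<open>All \<open>al0 i\<close> realize the restriction of \<open>p\<close>, as
    \<open>b\<close> does. So their average has the type of \<open>b\<close> over \<open>A\<close>
    and can be moved to \<open>b\<close>, carrying the sequence along.\<close>
  obtain h0 where h0: "avg xs al0 (A \<union> (\<Union>i. set (al0 i))) h0"
    using avg_exists[OF small_Un[OF A small_UN[OF al0t S(2)]] S(2) al0t] by (rule exE)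
  have h0t: "h0 \<in> tup M xs" by (rule avg_tup[OF h0])
  have t0: "tp L M xs h0 A = tp L M xs b A"
    unfolding tp_eq_iff[OF h0t bt]
  proof (intro allI impI)
    fix X assume X: "DS A xs X"
    then have "DS (A \<union> (\<Union>i. set (al0 i))) xs X" by (rule dset_mono) simp
    from avgD[OF h0 this] show "X h0 \<longleftrightarrow> X b" using al0b[OF X] by simp
  qed
  obtain al where al: "\<And>i. al i \<in> tup M xs"
    "\<And>P m. D A (case_nat xs (\<lambda>_. xs)) {..<m} P \<Longrightarrow> P (case_nat h0 al0) \<longleftrightarrow> P (case_nat b al)"
    by (rule lift_sequence[OF t0 h0t bt S(2) S(2) A al0t]) (rule that)
  define C where "C = A \<union> (\<Union>i. set (al i))"
  have b_avg: "avg xs al C b" unfolding C_def by (rule avg_lift[OF h0 al0t S(2) bt al])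
  have al_inc: "pat M ys \<psi> (al \<circ> l) k s" if "strict_mono l" for l k s
    by (rule pat_lift[where zs = xs and a = h0 and a' = b and g = al0 and g' = al, OF \<psi>f that al(2)]) (assumption, unfold al0_def, rule inc[OF that])
  have C: "sml C" "A \<subseteq> C" unfolding C_def using small_Un[OF A small_UN[OF al(1) S(2)]] by simp_all
  have alC: "set (al i) \<subseteq> C" for i by (auto simp: C_def)
  have "ind (set n) A (set b)" by (rule ind_sym[OF ind0 sb sn A])
  from ind_extend[OF S(1) n small_Un[OF sb C(1)] A Un_upper1 this]
  obtain n' where n': "n' \<in> tup M zs" "tp L M zs n' (set b \<union> A) = tp L M zs n (set b \<union> A)"
    "ind (set n') A (set b \<union> C)" by (elim bexE conjE)
  have sn': "sml (set n')" by (rule small_tup[OF n'(1) S(1)])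
  \<comment> \<open>Over \<open>A\<close> the conjugate \<open>n'\<close> is independent from
    \<open>b\<close> and \<open>C\<close> together; transitivity raises the base to
    \<open>C\<close>, and symmetry returns to a statement about \<open>b\<close>.\<close>
  have "ind (set n') C (set b \<union> C)"
    using ind_trans[OF sn' small_Un[OF sb C(1)] C(2)] n'(3) by blast
  then have "ind (set n') C (set b)" by (simp only: thorn_indep_Un_base)
  then have ind1: "ind (set b) C (set n')" by (rule ind_sym) (intro sn' sb C(1))+
  let ?B = "set n' \<union> C"
  have sB: "sml ?B" by (intro small_Un sn' C(1))
  \<comment> \<open>Copies of \<open>b\<close> over \<open>?B\<close>, each independent over
    \<open>C\<close> from \<open>?B\<close> and the copies before it. Extension provides them
    because \<open>b\<close> is independent from \<open>n'\<close> over \<open>C\<close>.\<close>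
  have "\<exists>f. \<forall>k :: nat. f k \<in> tup M xs \<and> tp L M xs (f k) ?B = tp L M xs b ?B \<and>
      ind (set (f k)) C (?B \<union> (\<Union>j<k. set (f j)))"
  proof (rule seq_choice[where P = "\<lambda>f k x. x \<in> tup M xs \<and> tp L M xs x ?B = tp L M xs b ?B \<and>
      ind (set x) C (?B \<union> (\<Union>j<k. set (f j)))"])
    fix f g :: "nat \<Rightarrow> 'm list" and k x
    assume "\<And>j. j < k \<Longrightarrow> f j = g j"
    then have "(\<Union>j<k. set (f j)) = (\<Union>j<k. set (g j))" by (intro SUP_cong) auto
    then show "(x \<in> tup M xs \<and> tp L M xs x ?B = tp L M xs b ?B \<and> ind (set x) C (?B \<union> (\<Union>j<k. set (f j)))) \<longleftrightarrow>
      (x \<in> tup M xs \<and> tp L M xs x ?B = tp L M xs b ?B \<and> ind (set x) C (?B \<union> (\<Union>j<k. set (g j))))"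
      by (simp only:)
  next
    fix k and f :: "nat \<Rightarrow> 'm list"
    assume f: "\<And>j. j < k \<Longrightarrow> f j \<in> tup M xs \<and> tp L M xs (f j) ?B = tp L M xs b ?B \<and>
      ind (set (f j)) C (?B \<union> (\<Union>i<j. set (f i)))"
    have "set (f j) \<subseteq> universe L M" if "j < k" for j
      by (rule set_tup[OF conjunct1[OF f[OF that]] S(2)])
    then have "sml (\<Union>j<k. set (f j))" by (intro small_countable) (auto intro: countable_finite)
    then have s: "sml (?B \<union> (\<Union>j<k. set (f j)))" by (intro small_Un sB)
    have sub: "set n' \<subseteq> ?B \<union> (\<Union>j<k. set (f j))" by blast
    show "\<exists>x. x \<in> tup M xs \<and> tp L M xs x ?B = tp L M xs b ?B \<and> ind (set x) C (?B \<union> (\<Union>j<k. set (f j)))"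
      using ind_extend[OF S(2) bt s C(1) sub ind1] by (simp only: Bex_def)
  qed
  then obtain bs where bs': "\<forall>k :: nat. bs k \<in> tup M xs \<and> tp L M xs (bs k) ?B = tp L M xs b ?B \<and>
      ind (set (bs k)) C (?B \<union> (\<Union>j<k. set (bs j)))" by (rule exE)
  have bs: "bs k \<in> tup M xs" "tp L M xs (bs k) ?B = tp L M xs b ?B"
    "ind (set (bs k)) C (?B \<union> (\<Union>j<k. set (bs j)))" for k
    using bs' by simp_all
  define E where "E = ?B \<union> (\<Union>i. set (bs i))"
  have sE: "sml E" unfolding E_def by (intro small_Un sn' C(1) small_UN[OF bs(1) S(2)])
  obtain g where g: "morley xs bs E g" using morley_exists[OF sE S(2) bs(1)] by (rule exE)
  have gt: "g k \<in> tup M xs" for k using g by (rule morley_tup)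
  have gk: "avg xs bs (E \<union> (\<Union>j<k. set (g j))) (g k)" for k using g by (simp add: morley_def)
  have sG: "sml (\<Union>j<k. set (g j))" for k by (rule small_UN[OF gt S(2)])
  \<comment> \<open>Two stages: independence from \<open>E\<close> over \<open>C\<close> is
    inherited from the \<open>bs i\<close>, and independence from the predecessors over
    \<open>E\<close> holds because the average is finitely satisfiable in \<open>E\<close>.
    Transitivity joins them.\<close>
  have g_ind: "ind (set (g k)) C (\<Union>j<k. set (g j))" for k
  proof -
    have "avg xs bs (?B \<union> (\<Union>i. set (bs i))) (g k)"
      by (rule avg_mono[OF gk[of k]]) (auto simp: E_def)
    then have "ind (set (g k)) C E"
      unfolding E_def by (rule avg_indep_seq[OF _ S(2) bs(1) _ bs(3)]) simp
    moreover have "ind (set (g k)) E (E \<union> (\<Union>j<k. set (g j)))"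
      by (rule avg_indep[OF gk S(2) bs(1)]) (auto simp: E_def)
    moreover have "C \<subseteq> E" by (auto simp: E_def)
    ultimately have "ind (set (g k)) C (E \<union> (\<Union>j<k. set (g j)))"
      using ind_trans[OF small_tup[OF gt S(2)] small_Un[OF sE sG], of C E] by blast
    then show ?thesis by (rule thorn_indep_mono) auto
  qed
  \<comment> \<open>Over \<open>?B\<close> the copies have the type of \<open>b\<close>, hence so do
    their averages. For sets over \<open>C\<close> this links \<open>g\<close> with the average of
    \<open>al\<close>, and for sets over \<open>A\<close> and \<open>n'\<close> with the conjugate
    of the stable type.\<close>
  have gB: "X (g k) \<longleftrightarrow> X b" if X: "DS ?B xs X" for X k
  proof -
    have "DS (E \<union> (\<Union>j<k. set (g j))) xs X" by (rule dset_mono[OF X]) (auto simp: E_def)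
    from avgD[OF gk this] show ?thesis using tp_D[OF bs(2) bs(1) bt X] by simp
  qed
  interpret generic_sequence L M \<kappa> xs C E al bs g
  proof
    show "set xs \<subseteq> Sorts L" "sml C" "\<And>i. al i \<in> tup M xs" "\<And>i. set (al i) \<subseteq> C"
      "\<And>i. bs i \<in> tup M xs" "morley xs bs E g" "\<And>k. ind (set (g k)) C (\<Union>j<k. set (g j))"
      by (fact S(2) C(1) al(1) alC bs(1) g g_ind)+
    show "C \<subseteq> E" "\<And>i. set (bs i) \<subseteq> E" by (auto simp: E_def)
    have "X (g 0) \<longleftrightarrow> (\<forall>\<^sub>F i in ulim. X (al i))" if X: "DS C xs X" for X
    proof -
      have "DS ?B xs X" by (rule dset_mono[OF X]) simp
      then show ?thesis using gB avgD[OF b_avg X] by blast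
    qed
    then show "avg xs al C (g 0)" using gt by (simp add: avg_def)
    fix ys \<phi> assume \<phi>: "formula L (xs @ ys) \<phi>"
    have "X (g k) \<longleftrightarrow> X b" if X: "DS (A \<union> set n') xs X" for k X
      by (rule gB[OF dset_mono[OF X]]) (use C(2) in auto)
    then show "\<exists>k s. \<not> pat M ys \<phi> g k s"
      using st unfolding b(2) by (intro no_pat_conjugate[OF A S n n'(1) bt n'(2) _ gt _ \<phi>])
  qed
  show False using no_increasing_pattern[OF \<psi>f] al_inc by blast
qed

end

section \<open>Saturation for tuples\<close>

text \<open>Saturation speaks of single elements, so a tuple is realized coordinate by coordinate.
  The first coordinate must keep every finite subfamily solvable in the others; these conditions are
  projections, hence definable, and finitely many of them follow from the union of their
  subfamilies. The chosen value then joins the parameters.\<close>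

lemma saturated_tuple:
  fixes L :: "('s, 'f, 'r) lang" and M :: "('s, 'f, 'r, 'm) struct" and \<kappa> :: "'k rel"
  assumes sat: "saturated L \<kappa> M" and \<kappa>: "Card_order \<kappa>" "infinite (Field \<kappa>)"
    and "small L \<kappa> M B" "set xs \<subseteq> Sorts L"
    and "\<And>X. X \<in> Xs \<Longrightarrow> dset L M B xs X"
    and "\<And>F. F \<subseteq> Xs \<Longrightarrow> finite F \<Longrightarrow> \<exists>x\<in>tup M xs. \<forall>X\<in>F. X x"
  shows "\<exists>x\<in>tup M xs. \<forall>X\<in>Xs. X x"
  using assms(4-)
proof (induction xs arbitrary: B Xs)
  case Nil
  have "X []" if "X \<in> Xs" for X using Nil(4)[of "{X}"] that by simp
  then show ?case by (intro bexI[of _ "[]"] ballI) simp_all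
next
  case (Cons s xs)
  have s: "s \<in> Sorts L" "set xs \<subseteq> Sorts L" using Cons.prems(2) by simp_all
  obtain z0 where "z0 \<in> tup M (s # xs)" using Cons.prems(4)[of "{}"] by auto
  then obtain m0 w0 where mw0: "m0 \<in> dom M s" "w0 \<in> tup M xs" by (auto simp: tup_Cons)
  let ?Y = "\<lambda>F m. \<exists>w\<in>tup M xs. \<forall>X\<in>F. X (m @ w)"
  have Y: "dset L M B [s] (?Y F)" if F: "F \<subseteq> Xs" "finite F" for F
  proof -
    let ?\<sigma> = "case_bool [s] xs"
    have "dp L M B ?\<sigma> UNIV (\<lambda>\<rho>. X (\<rho> True @ \<rho> False))" if X: "X \<in> F" for X
    proof -
      have "dset L M B (s # xs) X" using X F(1) Cons.prems(3) by blast
      then obtain \<phi> b ys where f: "set b \<subseteq> B" "b \<in> tup M ys" "formula L ((s # xs) @ ys) \<phi>"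
        "\<And>x. x \<in> tup M (s # xs) \<Longrightarrow> X x \<longleftrightarrow> sat M \<phi> (x @ b)"
        by (rule dsetE) (rule that)
      show ?thesis
      proof (rule dpI[where vs = "[True, False]", OF _ f(1,2)])
        show "formula L (concat (map ?\<sigma> [True, False]) @ ys) \<phi>" using f(3) by simp
        fix \<rho> :: "bool \<Rightarrow> 'm list" assume \<rho>: "\<rho> \<in> envs M ?\<sigma>"
        have "\<rho> True @ \<rho> False \<in> tup M ([s] @ xs)"
          using envsD[OF \<rho>, of True] envsD[OF \<rho>, of False] by (intro tup_appendI) simp_all
        then show "X (\<rho> True @ \<rho> False) \<longleftrightarrow> sat M \<phi> (concat (map \<rho> [True, False]) @ b)"
          using f(4) by simp
      qed simp
    qed
    then have "dp L M B ?\<sigma> UNIV (\<lambda>\<rho>. \<forall>X\<in>F. X (\<rho> True @ \<rho> False))" using F(2) by (intro dp_ball_finite)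
    from dp_ex[OF this, of False]
    have "dp L M B ?\<sigma> (UNIV - {False}) (\<lambda>\<rho>. \<exists>w\<in>tup M (?\<sigma> False).
        \<forall>X\<in>F. X ((\<rho>(False := w)) True @ (\<rho>(False := w)) False))" .
    then have "dset L M B [s] (\<lambda>m. \<exists>w\<in>tup M (?\<sigma> False). \<forall>X\<in>F.
        X ((((case_bool [m0] w0)(True := m))(False := w)) True @ (((case_bool [m0] w0)(True := m))(False := w)) False))"
      by (rule dp_dset) (use mw0 s in \<open>auto simp: envs_def tup_Cons split: bool.split\<close>)
    then show ?thesis by simp
  qed
  define fins where "fins = {F. F \<subseteq> Xs \<and> finite F}"
  \<comment> \<open>\<open>saturated\<close> is about sets of formulas, so a defining formula with
    parameters is chosen for each finite subfamily.\<close>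
  have "\<exists>d. d \<in> pformulas L M [s] B \<and> (\<forall>x\<in>tup M [s]. ?Y F x \<longleftrightarrow> sat M (fst d) (x @ snd d))"
    if F: "F \<in> fins" for F
  proof -
    obtain \<phi> b ys where f: "set b \<subseteq> B" "b \<in> tup M ys" "formula L ([s] @ ys) \<phi>"
      "\<And>x. x \<in> tup M [s] \<Longrightarrow> ?Y F x \<longleftrightarrow> sat M \<phi> (x @ b)"
    proof (rule dsetE)
      show "dset L M B [s] (?Y F)" using Y F by (simp add: fins_def)
    qed (rule that)
    then show ?thesis by (intro exI[of _ "(\<phi>, b)"]) (auto simp: pformulas_def)
  qed
  then obtain rp where rp: "\<And>F. F \<in> fins \<Longrightarrow> rp F \<in> pformulas L M [s] B \<and>
      (\<forall>x\<in>tup M [s]. ?Y F x \<longleftrightarrow> sat M (fst (rp F)) (x @ snd (rp F)))"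
    by metis
  have "fin_sat M [s] (rp ` fins)"
    unfolding fin_sat_def
  proof (intro allI impI)
    fix Q assume Q: "Q \<subseteq> rp ` fins" "finite Q"
    obtain G where G: "G \<subseteq> fins" "finite G" "Q = rp ` G"
      using finite_subset_image[OF Q(2,1)] by (elim exE conjE)
    have "\<Union>G \<subseteq> Xs" "finite (\<Union>G)" using G(1,2) by (auto simp: fins_def)
    from Cons.prems(4)[OF this] obtain x where x: "x \<in> tup M (s # xs)" "\<forall>X\<in>\<Union>G. X x" by (rule bexE)
    obtain m w where mw: "x = [m] @ w" "[m] \<in> tup M [s]" "w \<in> tup M xs"
      using x(1) by (auto simp: tup_Cons)
    have "sat M (fst (rp F)) ([m] @ snd (rp F))" if F: "F \<in> G" for F
    proof -
      have "\<forall>X\<in>F. X ([m] @ w)" using x(2) F unfolding mw(1) by (auto simp del: append_Cons)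
      then have "?Y F [m]" using mw(3) by (rule bexI)
      then show ?thesis using rp[of F] F G(1) mw(2) by blast
    qed
    then have "[m] \<in> realizations M [s] Q" unfolding G(3) using mw(2) by (auto simp: realizations_def split_def)
    then show "realizations M [s] Q \<noteq> {}" by blast
  qed
  moreover have "rp ` fins \<subseteq> pformulas L M [s] B" using rp by (intro image_subsetI) simp
  ultimately have "realizations M [s] (rp ` fins) \<noteq> {}"
    by (intro sat[unfolded saturated_def, rule_format] conjI) (use Cons.prems(1) s(1) in simp_all)
  then obtain m1 where m1: "m1 \<in> realizations M [s] (rp ` fins)" by (meson ex_in_conv)
  then have m1t: "m1 \<in> tup M [s]" by (simp add: realizations_def)
  have YF: "?Y F m1" if F: "F \<subseteq> Xs" "finite F" for F
  proof -
    have F': "F \<in> fins" using F by (simp add: fins_def)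
    have "sat M (fst (rp F)) (m1 @ snd (rp F))" using m1 F' by (auto simp: realizations_def)
    then show ?thesis using rp[OF F'] m1t by simp
  qed
  have "\<exists>w\<in>tup M xs. \<forall>Z\<in>(\<lambda>X w. X (m1 @ w)) ` Xs. Z w"
  proof (rule Cons.IH[of "B \<union> set m1"])
    have "set m1 \<subseteq> universe L M" using set_tup[OF m1t, of L] s(1) by simp
    moreover have "|set m1| <o \<kappa>"
    proof (rule finite_ordLess_infinite)
      show "Well_order |set m1|" by (rule card_of_Well_order)
      show "Well_order \<kappa>" using card_order_on_well_order_on[OF \<kappa>(1)] .
      show "finite (Field |set m1| )" by (simp add: Field_card_of)
      show "infinite (Field \<kappa>)" by (rule \<kappa>(2))
    qed
    ultimately show "small L \<kappa> M (B \<union> set m1)"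
      using Cons.prems(1) by (simp add: small_def card_of_Un_ordLess_infinite_Field[OF \<kappa>(2,1)])
    show "set xs \<subseteq> Sorts L" by (rule s(2))
    fix Z assume "Z \<in> (\<lambda>X w. X (m1 @ w)) ` Xs"
    then obtain X where X: "X \<in> Xs" "Z = (\<lambda>w. X (m1 @ w))" by (rule imageE)
    have "dset L M B ([s] @ xs) X" using Cons.prems(3)[OF X(1)] by simp
    then show "dset L M (B \<union> set m1) xs Z" unfolding X(2) by (rule dset_plug_left[OF _ m1t]) simp_all
  next
    fix F assume F: "F \<subseteq> (\<lambda>X w. X (m1 @ w)) ` Xs" "finite F"
    obtain F0 where F0: "F0 \<subseteq> Xs" "finite F0" "F = (\<lambda>X w. X (m1 @ w)) ` F0"
      using finite_subset_image[OF F(2,1)] by (elim exE conjE)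
    from YF[OF F0(1,2)] show "\<exists>w\<in>tup M xs. \<forall>Z\<in>F. Z w" unfolding F0(3) by simp
  qed
  then obtain w where w: "w \<in> tup M xs" "\<forall>Z\<in>(\<lambda>X w. X (m1 @ w)) ` Xs. Z w" by (rule bexE)
  have "m1 @ w \<in> tup M (s # xs)" using tup_appendI[OF m1t w(1)] by simp
  moreover have "X (m1 @ w)" if "X \<in> Xs" for X using bspec[OF w(2) imageI[OF that]] .
  ultimately show ?case by (intro bexI[of _ "m1 @ w"] ballI)
qed

section \<open>The structure of imaginaries\<close>

lemma Sorts_eq: "S \<in> Sorts (eq_lang L M) \<longleftrightarrow> defines_equiv L M (fst S) (snd S)"
  by (auto simp: eq_lang_def)

lemma dom_eq: "dom (eq_struct L M) S = eq_class M S ` tup M (fst S)"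
  by (simp add: eq_struct_def)

lemma eq_class_eq_iff:
  assumes "defines_equiv L M (fst S) (snd S)" "u \<in> tup M (fst S)" "v \<in> tup M (fst S)"
  shows "eq_class M S u = eq_class M S v \<longleftrightarrow> sat M (snd S) (u @ v)"
proof -
  let ?R = "{(a, b). a \<in> tup M (fst S) \<and> b \<in> tup M (fst S) \<and> sat M (snd S) (a @ b)}"
  have eqv: "equiv (tup M (fst S)) ?R" using assms(1) by (simp add: defines_equiv_def)
  have cl: "eq_class M S w = (S, ?R `` {w})" if "w \<in> tup M (fst S)" for w
    using that by (auto simp: eq_class_def)
  have "eq_class M S u = eq_class M S v \<longleftrightarrow> ?R `` {u} = ?R `` {v}" using cl assms by simp
  also have "\<dots> \<longleftrightarrow> (u, v) \<in> ?R" by (rule eq_equiv_class_iff[OF eqv assms(2,3)])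
  finally show ?thesis using assms by simp
qed

lemma home_equiv:
  fixes M :: "('s, 'f, 'r, 'm) struct"
  shows "s \<in> Sorts L \<Longrightarrow> defines_equiv L M (fst (home s)) (snd (home s))"
proof -
  assume s: "s \<in> Sorts L"
  have "tm_sort L [s, s] (Var 0) ([s, s] ! 0)" "tm_sort L [s, s] (Var 1) ([s, s] ! 1)"
    by (rule tm_sort.intros(1), simp)+
  then have "formula L ([s] @ [s]) (Eq (Var 0) (Var 1))" using s by (auto simp: formula_def)
  moreover have "{(a, b). a \<in> tup M [s] \<and> b \<in> tup M [s] \<and> sat M (Eq (Var 0) (Var 1)) (a @ b)} =
      Id_on (tup M [s])"
    by (auto simp: tup_Cons Id_on_def)
  moreover have "equiv A (Id_on A)" for A :: "'m list set"
    by (auto simp: equiv_def refl_on_def sym_def trans_def)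
  ultimately show ?thesis by (simp add: home_def defines_equiv_def)
qed

lemma fst_home: "fst (home s) = [s]"
  by (simp add: home_def)

lemma home_class: "m \<in> dom M s \<Longrightarrow> eq_class M (home s) [m] = (home s, {[m]})"
  by (auto simp: eq_class_def home_def tup_Cons)

lemma the_real_home [simp]: "the_real (S, {[m]}) = m"
  by (simp add: the_real_def)

lemma dom_home: "dom (eq_struct L M) (home s) = (\<lambda>m. (home s, {[m]})) ` dom M s"
proof -
  have "tup M [s] = (\<lambda>m. [m]) ` dom M s" by (auto simp: tup_Cons)
  then have "dom (eq_struct L M) (home s) = (\<lambda>m. eq_class M (home s) [m]) ` dom M s"
    unfolding dom_eq by (simp only: image_image fst_home)
  also have "\<dots> = (\<lambda>m. (home s, {[m]})) ` dom M s" by (rule image_cong[OF refl home_class])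
  finally show ?thesis .
qed

lemma the_real_tup: "w \<in> tup (eq_struct L M) (map home ss) \<Longrightarrow> map the_real w \<in> tup M ss"
  by (induction ss arbitrary: w) (auto simp: tup_Cons dom_home)

lemma home_tup:
  assumes "a \<in> tup M ss"
  obtains w where "w \<in> tup (eq_struct L M) (map home ss)" "map the_real w = a"
proof -
  have "\<exists>w. w \<in> tup (eq_struct L M) (map home ss) \<and> map the_real w = a"
    using assms
  proof (induction ss arbitrary: a)
    case (Cons s ss)
    then obtain m b where a: "a = m # b" "m \<in> dom M s" "b \<in> tup M ss" by (auto simp: tup_Cons)
    from Cons.IH[OF a(3)] obtain w where "w \<in> tup (eq_struct L M) (map home ss)" "map the_real w = b" by blast
    then show ?case using a by (intro exI[of _ "(home s, {[m]}) # w"]) (simp add: tup_Cons dom_home)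
  qed simp
  then show ?thesis using that by blast
qed

text \<open>Imaginaries are handled through lists of representing tuples, one for each sort in the
  context; concatenated, such a list is an environment for the original structure.\<close>

definition reps :: "('s, 'f, 'r, 'm) struct \<Rightarrow> ('s, 'f, 'r) eq_sort list \<Rightarrow> 'm list list \<Rightarrow> bool" where
  "reps M \<Gamma> us \<longleftrightarrow> list_all2 (\<lambda>u S. u \<in> tup M (fst S)) us \<Gamma>"

abbreviation classes :: "('s, 'f, 'r, 'm) struct \<Rightarrow> ('s, 'f, 'r) eq_sort list \<Rightarrow> 'm list list \<Rightarrow>
    ('s, 'f, 'r, 'm) eq_elem list" where
  "classes M \<Gamma> us \<equiv> map2 (eq_class M) \<Gamma> us"

lemma reps_concat: "reps M \<Gamma> us \<Longrightarrow> concat us \<in> tup M (concat (map fst \<Gamma>))"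
  unfolding reps_def by (induction rule: list_all2_induct) (auto intro: tup_appendI)

lemma reps_exists:
  "w \<in> tup M (concat (map fst \<Gamma>)) \<Longrightarrow> \<exists>us. reps M \<Gamma> us \<and> concat us = w"
proof (induction \<Gamma> arbitrary: w)
  case Nil
  then show ?case by (simp add: reps_def)
next
  case (Cons S \<Gamma>)
  then obtain u v where w: "w = u @ v" "u \<in> tup M (fst S)" "v \<in> tup M (concat (map fst \<Gamma>))"
    by (auto simp: tup_append)
  from Cons.IH[OF w(3)] obtain us where "reps M \<Gamma> us" "concat us = v" by blast
  then show ?case using w by (intro exI[of _ "u # us"]) (simp add: reps_def)
qed

lemma classes_tup: "reps M \<Gamma> us \<Longrightarrow> classes M \<Gamma> us \<in> tup (eq_struct L M) \<Gamma>"
  unfolding reps_def by (induction rule: list_all2_induct) (auto simp: tup_Cons dom_eq)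

lemma classes_append:
  "reps M \<Gamma> us \<Longrightarrow> classes M (\<Gamma> @ \<Delta>) (us @ vs) = classes M \<Gamma> us @ classes M \<Delta> vs"
  unfolding reps_def by (auto dest: list_all2_lengthD)

lemma reps_append: "reps M \<Gamma> us \<Longrightarrow> reps M \<Delta> vs \<Longrightarrow> reps M (\<Gamma> @ \<Delta>) (us @ vs)"
  unfolding reps_def by (rule list_all2_appendI)

text \<open>The sort is stored in the first component of an imaginary, so a representative can be
  chosen without naming the sort.\<close>

definition rep :: "('s, 'f, 'r, 'm) struct \<Rightarrow> ('s, 'f, 'r, 'm) eq_elem \<Rightarrow> 'm list" where
  "rep M e = (SOME u. u \<in> tup M (fst (fst e)) \<and> eq_class M (fst e) u = e)"

lemma rep:
  assumes "e \<in> dom (eq_struct L M) S"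
  shows "rep M e \<in> tup M (fst S)" "eq_class M S (rep M e) = e" "fst e = S"
proof -
  obtain u where u: "u \<in> tup M (fst S)" "e = eq_class M S u" using assms by (auto simp: dom_eq)
  then show S: "fst e = S" by (simp add: eq_class_def)
  then have "\<exists>u. u \<in> tup M (fst (fst e)) \<and> eq_class M (fst e) u = e" using u by auto
  from someI_ex[OF this] have "rep M e \<in> tup M (fst (fst e)) \<and> eq_class M (fst e) (rep M e) = e"
    by (simp only: rep_def)
  then show "rep M e \<in> tup M (fst S)" "eq_class M S (rep M e) = e" by (simp_all add: S)
qed

lemma reps_rep:
  "es \<in> tup (eq_struct L M) \<Gamma> \<Longrightarrow> reps M \<Gamma> (map (rep M) es) \<and> classes M \<Gamma> (map (rep M) es) = es"
proof (induction \<Gamma> arbitrary: es)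
  case (Cons S \<Gamma>)
  then obtain e es' where e: "es = e # es'" "e \<in> dom (eq_struct L M) S" "es' \<in> tup (eq_struct L M) \<Gamma>"
    by (auto simp: tup_Cons)
  then show ?case using Cons.IH[OF e(3)] rep[OF e(2)] by (simp add: reps_def)
qed (simp add: reps_def)

section \<open>Translation of formulas about imaginaries\<close>

text \<open>Composition of definable relations. It serves to eliminate a compound term by guessing
  the values \<open>a\<close> of its arguments.\<close>

lemma formula_ex_conj:
  assumes "formula L (ss @ \<Delta>) \<alpha>" "formula L (ts @ ss) \<beta>"
  obtains \<gamma> where "formula L (ts @ \<Delta>) \<gamma>"
    "\<And>v w. v \<in> tup M ts \<Longrightarrow> w \<in> tup M \<Delta> \<Longrightarrow>
      sat M \<gamma> (v @ w) \<longleftrightarrow> (\<exists>a\<in>tup M ss. sat M \<alpha> (a @ w) \<and> sat M \<beta> (v @ a))"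
proof -
  define \<sigma> :: "nat \<Rightarrow> 'a list" where "\<sigma> v = (if v = 0 then ss else if v = 1 then ts else \<Delta>)" for v
  have "dp L M {} \<sigma> {0, 1, 2} (\<lambda>\<rho>. sat M \<alpha> (concat (map \<rho> [0, 2])) \<and> sat M \<beta> (concat (map \<rho> [1, 0])))"
    using assms by (intro dp_conj dp_formula0) (simp_all add: \<sigma>_def)
  from dp_ex[OF this, of 0]
  have d: "dp L M {} \<sigma> ({0, 1, 2} - {0}) (\<lambda>\<rho>. \<exists>a\<in>tup M (\<sigma> 0). sat M \<alpha> (concat (map (\<rho>(0 := a)) [0, 2])) \<and>
      sat M \<beta> (concat (map (\<rho>(0 := a)) [1, 0])))" .
  have "finite ({0, 1, 2} - {0 :: nat})" "{0, 1, 2} - {0 :: nat} \<subseteq> set [1, 2]" by auto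
  moreover have "set (concat (map \<sigma> [1, 2])) \<subseteq> Sorts L" using assms by (simp add: \<sigma>_def formula_def)
  ultimately obtain \<gamma> where g: "formula L (concat (map \<sigma> [1, 2])) \<gamma>"
    "\<And>\<rho>. \<rho> \<in> envs M \<sigma> \<Longrightarrow> (\<exists>a\<in>tup M (\<sigma> 0). sat M \<alpha> (concat (map (\<rho>(0 := a)) [0, 2])) \<and>
      sat M \<beta> (concat (map (\<rho>(0 := a)) [1, 0]))) \<longleftrightarrow> sat M \<gamma> (concat (map \<rho> [1, 2]))"
    by (rule dp_obtain0[OF d]) (rule that)
  show ?thesis
  proof (cases "tup M ss = {}")
    case True
    show ?thesis
    proof (rule that[of Fls])
      show "formula L (ts @ \<Delta>) Fls" using assms by (simp add: formula_def)
    qed (simp add: True)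
  next
    case False
    then obtain a0 where a0: "a0 \<in> tup M ss" by blast
    show ?thesis
    proof (rule that)
      show "formula L (ts @ \<Delta>) \<gamma>" using g(1) by (simp add: \<sigma>_def)
      fix v w assume vw: "v \<in> tup M ts" "w \<in> tup M \<Delta>"
      have "(\<lambda>i. if i = 0 then a0 else if i = 1 then v else w) \<in> envs M \<sigma>"
        using a0 vw by (auto simp: envs_def \<sigma>_def)
      from g(2)[OF this] show "sat M \<gamma> (v @ w) \<longleftrightarrow> (\<exists>a\<in>tup M ss. sat M \<alpha> (a @ w) \<and> sat M \<beta> (v @ a))"
        by (simp add: \<sigma>_def)
    qed
  qed
qed

lemma formula_conj_blocks:
  assumes "formula L (ss @ \<Delta>) \<alpha>" "formula L (ts @ \<Delta>) \<beta>"
  obtains \<gamma> where "formula L ((ss @ ts) @ \<Delta>) \<gamma>"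
    "\<And>a b w. a \<in> tup M ss \<Longrightarrow> b \<in> tup M ts \<Longrightarrow> w \<in> tup M \<Delta> \<Longrightarrow>
      sat M \<gamma> ((a @ b) @ w) \<longleftrightarrow> sat M \<alpha> (a @ w) \<and> sat M \<beta> (b @ w)"
proof -
  define \<sigma> :: "nat \<Rightarrow> 'a list" where "\<sigma> v = (if v = 0 then ss else if v = 1 then ts else \<Delta>)" for v
  have d: "dp L M {} \<sigma> {0, 1, 2} (\<lambda>\<rho>. sat M \<alpha> (concat (map \<rho> [0, 2])) \<and> sat M \<beta> (concat (map \<rho> [1, 2])))"
    using assms by (intro dp_conj dp_formula0) (simp_all add: \<sigma>_def)
  have "finite {0, 1, 2 :: nat}" "{0, 1, 2 :: nat} \<subseteq> set [0, 1, 2]" by auto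
  moreover have "set (concat (map \<sigma> [0, 1, 2])) \<subseteq> Sorts L" using assms by (simp add: \<sigma>_def formula_def)
  ultimately obtain \<gamma> where g: "formula L (concat (map \<sigma> [0, 1, 2])) \<gamma>"
    "\<And>\<rho>. \<rho> \<in> envs M \<sigma> \<Longrightarrow> sat M \<alpha> (concat (map \<rho> [0, 2])) \<and> sat M \<beta> (concat (map \<rho> [1, 2]))
      \<longleftrightarrow> sat M \<gamma> (concat (map \<rho> [0, 1, 2]))"
    by (rule dp_obtain0[OF d]) (rule that)
  show ?thesis
  proof (rule that)
    show "formula L ((ss @ ts) @ \<Delta>) \<gamma>" using g(1) by (simp add: \<sigma>_def)
    fix a b w assume vw: "a \<in> tup M ss" "b \<in> tup M ts" "w \<in> tup M \<Delta>"
    have "(\<lambda>i. if i = 0 then a else if i = 1 then b else w) \<in> envs M \<sigma>"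
      using vw by (auto simp: envs_def \<sigma>_def)
    from g(2)[OF this] show "sat M \<gamma> ((a @ b) @ w) \<longleftrightarrow> sat M \<alpha> (a @ w) \<and> sat M \<beta> (b @ w)"
      by (simp add: \<sigma>_def)
  qed
qed

text \<open>A term over imaginaries need not have a counterpart among the terms of \<open>L\<close>;
  what can be translated is its graph, read on representatives of the arguments and of the
  value.\<close>

definition definable_graph :: "('s, 'f, 'r) lang \<Rightarrow> ('s, 'f, 'r, 'm) struct \<Rightarrow> ('s, 'f, 'r) eq_sort list \<Rightarrow>
    ('s, 'f, 'r) eq_fun tm \<Rightarrow> ('s, 'f, 'r) eq_sort \<Rightarrow> bool" where
  "definable_graph L M \<Gamma> t S \<longleftrightarrow>
     (\<forall>us. reps M \<Gamma> us \<longrightarrow> eval_tm (eq_struct L M) (classes M \<Gamma> us) t \<in> dom (eq_struct L M) S) \<and>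
     (\<exists>\<gamma>. formula L (fst S @ concat (map fst \<Gamma>)) \<gamma> \<and> (\<forall>us v. reps M \<Gamma> us \<longrightarrow> v \<in> tup M (fst S) \<longrightarrow>
       (sat M \<gamma> (v @ concat us) \<longleftrightarrow> eval_tm (eq_struct L M) (classes M \<Gamma> us) t = eq_class M S v)))"

lemma sorts_fst: "S \<in> Sorts (eq_lang L M) \<Longrightarrow> set (fst S) \<subseteq> Sorts L"
  by (simp add: Sorts_eq defines_equiv_def formula_def)

lemma sorts_concat: "set \<Gamma> \<subseteq> Sorts (eq_lang L M) \<Longrightarrow> set (concat (map fst \<Gamma>)) \<subseteq> Sorts L"
  using sorts_fst by fastforce

text \<open>Function and relation symbols take arguments of home sorts only, so the values of the
  arguments are real elements, and their joint graph has variables of the original sorts.\<close>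

lemma definable_graph_args:
  assumes "list_all2 (definable_graph L M \<Gamma>) ts (map home ss)" "set ss \<subseteq> Sorts L"
    and \<Gamma>: "set \<Gamma> \<subseteq> Sorts (eq_lang L M)"
  shows "(\<forall>us. reps M \<Gamma> us \<longrightarrow>
      map (eval_tm (eq_struct L M) (classes M \<Gamma> us)) ts \<in> tup (eq_struct L M) (map home ss)) \<and>
    (\<exists>\<gamma>. formula L (ss @ concat (map fst \<Gamma>)) \<gamma> \<and> (\<forall>us a. reps M \<Gamma> us \<longrightarrow> a \<in> tup M ss \<longrightarrow>
      (sat M \<gamma> (a @ concat us) \<longleftrightarrow> map the_real (map (eval_tm (eq_struct L M) (classes M \<Gamma> us)) ts) = a)))"
  using assms(1,2)
proof (induction ss arbitrary: ts)
  case Nil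
  have "formula L ([] @ concat (map fst \<Gamma>)) (Neg Fls)" using sorts_concat[OF \<Gamma>] by (simp add: formula_def)
  with Nil show ?case by (intro conjI exI[of _ "Neg Fls"]) simp_all
next
  case (Cons s ss)
  then obtain t ts' where ts: "ts = t # ts'" "definable_graph L M \<Gamma> t (home s)" "list_all2 (definable_graph L M \<Gamma>) ts' (map home ss)"
    by (auto simp: list_all2_Cons2)
  let ?ev = "\<lambda>us. eval_tm (eq_struct L M) (classes M \<Gamma> us)"
  have IH: "(\<forall>us. reps M \<Gamma> us \<longrightarrow> map (?ev us) ts' \<in> tup (eq_struct L M) (map home ss)) \<and>
    (\<exists>\<gamma>. formula L (ss @ concat (map fst \<Gamma>)) \<gamma> \<and> (\<forall>us a. reps M \<Gamma> us \<longrightarrow> a \<in> tup M ss \<longrightarrow>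
      (sat M \<gamma> (a @ concat us) \<longleftrightarrow> map the_real (map (?ev us) ts') = a)))"
    using ts(3) Cons.prems(2) by (intro Cons.IH) simp_all
  obtain \<beta> where \<beta>: "formula L (ss @ concat (map fst \<Gamma>)) \<beta>"
    "\<And>us a. reps M \<Gamma> us \<Longrightarrow> a \<in> tup M ss \<Longrightarrow>
      sat M \<beta> (a @ concat us) \<longleftrightarrow> map the_real (map (?ev us) ts') = a"
    using IH by blast
  have tdom: "?ev us t \<in> dom (eq_struct L M) (home s)" if "reps M \<Gamma> us" for us
    using ts(2) that by (simp add: definable_graph_def)
  obtain \<alpha> where \<alpha>1: "formula L ([s] @ concat (map fst \<Gamma>)) \<alpha>"
    and \<alpha>: "\<forall>us v. reps M \<Gamma> us \<longrightarrow> v \<in> tup M [s] \<longrightarrow>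
      (sat M \<alpha> (v @ concat us) \<longleftrightarrow> ?ev us t = eq_class M (home s) v)"
    using ts(2) unfolding definable_graph_def fst_home by (elim conjE exE)
  have \<alpha>2: "sat M \<alpha> ([m] @ concat us) \<longleftrightarrow> the_real (?ev us t) = m" if us: "reps M \<Gamma> us" and m: "m \<in> dom M s" for us m
  proof -
    obtain m' where m': "m' \<in> dom M s" "?ev us t = (home s, {[m']})"
      using tdom[OF us] unfolding dom_home by blast
    have "[m] \<in> tup M [s]" using m by (simp add: tup_Cons)
    then have "sat M \<alpha> ([m] @ concat us) \<longleftrightarrow> ?ev us t = eq_class M (home s) [m]" using \<alpha> us by blast
    also have "\<dots> \<longleftrightarrow> m' = m" unfolding home_class[OF m] m'(2) by simp
    finally show ?thesis by (simp add: m'(2))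
  qed
  obtain \<gamma> where \<gamma>: "formula L (([s] @ ss) @ concat (map fst \<Gamma>)) \<gamma>"
    "\<And>a b w. a \<in> tup M [s] \<Longrightarrow> b \<in> tup M ss \<Longrightarrow> w \<in> tup M (concat (map fst \<Gamma>)) \<Longrightarrow>
      sat M \<gamma> ((a @ b) @ w) \<longleftrightarrow> sat M \<alpha> (a @ w) \<and> sat M \<beta> (b @ w)"
    by (rule formula_conj_blocks[OF \<alpha>1 \<beta>(1)]) (rule that)
  have "sat M \<gamma> (a @ concat us) \<longleftrightarrow> map the_real (map (?ev us) ts) = a"
    if us: "reps M \<Gamma> us" and a: "a \<in> tup M (s # ss)" for us a
  proof -
    obtain m b where mb: "a = [m] @ b" "m \<in> dom M s" "b \<in> tup M ss" using a by (auto simp: tup_Cons)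
    have m1: "[m] \<in> tup M [s]" using mb(2) by (simp add: tup_Cons)
    show ?thesis unfolding mb(1) \<gamma>(2)[OF m1 mb(3) reps_concat[OF us]] \<alpha>2[OF us mb(2)] \<beta>(2)[OF us mb(3)]
      by (simp add: ts(1))
  qed
  moreover have "map (?ev us) ts \<in> tup (eq_struct L M) (map home (s # ss))" if "reps M \<Gamma> us" for us
    using tdom[OF that] IH that by (simp add: ts(1) tup_Cons)
  moreover have "formula L ((s # ss) @ concat (map fst \<Gamma>)) \<gamma>" using \<gamma>(1) by simp
  ultimately show ?case by blast
qed

lemma eval_vars: "length a = n \<Longrightarrow> map (eval_tm M (v @ a)) (map Var [length v..<length v + n]) = a"
  by (rule nth_equalityI) (simp_all add: nth_append)

lemma sorts_vars:
  "list_all2 (tm_sort L (ts @ ss)) (map Var [length ts..<length ts + length ss]) ss"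
proof -
  have "tm_sort L (ts @ ss) (Var (length ts + i)) (ss ! i)" if "i < length ss" for i
    using tm_sort.intros(1)[of "length ts + i" "ts @ ss" L] that by (simp add: nth_append)
  then show ?thesis by (simp add: list_all2_conv_all_nth)
qed

text \<open>For a variable, a tuple represents the value iff the equivalence formula of the sort
  relates it to the given representative. For other terms the graphs of the arguments are composed
  with the graph of the function symbol, or with the equivalence relation in the case of a
  projection.\<close>

lemma definable_graph_term:
  fixes L :: "('s, 'f, 'r) lang" and M :: "('s, 'f, 'r, 'm) struct"
  assumes st: "struct_of L M" and \<Gamma>: "set \<Gamma> \<subseteq> Sorts (eq_lang L M)"
    and t: "tm_sort (eq_lang L M) \<Gamma> t S"
  shows "definable_graph L M \<Gamma> t S"
  using t
proof (induction rule: tm_sort.induct)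
  case (1 i)
  let ?S = "\<Gamma> ! i"
  have S: "defines_equiv L M (fst ?S) (snd ?S)" using \<Gamma> 1 nth_mem Sorts_eq by blast
  define n where "n = length \<Gamma>"
  define \<sigma> where "\<sigma> = case_option (fst ?S) (\<lambda>j. if j < n then fst (\<Gamma> ! j) else [])"
  have c: "concat (map \<sigma> (None # map Some [0..<n])) = fst ?S @ concat (map fst \<Gamma>)"
  proof -
    have "map \<sigma> (map Some [0..<n]) = map fst \<Gamma>"
      by (rule nth_equalityI) (simp_all add: \<sigma>_def n_def)
    then show ?thesis by (simp add: \<sigma>_def del: map_map)
  qed
  have f1: "formula L (concat (map \<sigma> [None, Some i])) (snd ?S)"
    using S 1 by (simp add: \<sigma>_def n_def defines_equiv_def)
  have f2: "set [None, Some i] \<subseteq> set (None # map Some [0..<n])" using 1 by (simp add: n_def)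
  have f3: "set (concat (map \<sigma> (None # map Some [0..<n]))) \<subseteq> Sorts L"
    unfolding c using sorts_concat[OF \<Gamma>] S by (auto simp: defines_equiv_def formula_def)
  obtain \<gamma> where \<gamma>: "formula L (concat (map \<sigma> (None # map Some [0..<n]))) \<gamma>"
    "\<And>\<rho>. (\<And>v. \<rho> v \<in> tup M (\<sigma> v)) \<Longrightarrow> sat M \<gamma> (concat (map \<rho> (None # map Some [0..<n])))
      \<longleftrightarrow> sat M (snd ?S) (concat (map \<rho> [None, Some i]))"
    using formula_blocks[where M = M, OF f1 f2 f3] by blast
  have ev: "eval_tm (eq_struct L M) (classes M \<Gamma> us) (Var i) = eq_class M ?S (us ! i)" and ui: "us ! i \<in> tup M (fst ?S)"
    if "reps M \<Gamma> us" for us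
    using that 1 by (simp_all add: reps_def list_all2_conv_all_nth)
  have "sat M \<gamma> (v @ concat us) \<longleftrightarrow> eval_tm (eq_struct L M) (classes M \<Gamma> us) (Var i) = eq_class M ?S v"
    if us: "reps M \<Gamma> us" and v: "v \<in> tup M (fst ?S)" for us v
  proof -
    let ?\<rho> = "case_option v (\<lambda>j. if j < n then us ! j else [])"
    have lu: "length us = n" using us by (simp add: reps_def n_def list_all2_lengthD)
    have "?\<rho> w \<in> tup M (\<sigma> w)" for w
      using us v by (auto simp: \<sigma>_def n_def reps_def list_all2_conv_all_nth split: option.split)
    from \<gamma>(2)[OF this] have "sat M \<gamma> (concat (map ?\<rho> (None # map Some [0..<n]))) \<longleftrightarrow> sat M (snd ?S) (v @ us ! i)"
      using 1[folded n_def] by (simp del: map_map)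
    moreover have "map ?\<rho> (map Some [0..<n]) = us" using lu by (intro nth_equalityI) simp_all
    ultimately have "sat M \<gamma> (v @ concat us) \<longleftrightarrow> sat M (snd ?S) (v @ us ! i)" by (simp del: map_map)
    also have "\<dots> \<longleftrightarrow> eq_class M ?S v = eq_class M ?S (us ! i)" by (rule eq_class_eq_iff[OF S v ui[OF us], symmetric])
    finally show ?thesis unfolding ev[OF us] by (simp only: eq_commute)
  qed
  moreover have "eval_tm (eq_struct L M) (classes M \<Gamma> us) (Var i) \<in> dom (eq_struct L M) ?S" if "reps M \<Gamma> us" for us
    unfolding ev[OF that] dom_eq using ui[OF that] by (rule imageI)
  moreover have "formula L (fst ?S @ concat (map fst \<Gamma>)) \<gamma>" using \<gamma>(1) unfolding c .
  ultimately show ?case unfolding definable_graph_def by blast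
next
  case (2 g ts)
  let ?ev = "\<lambda>us. eval_tm (eq_struct L M) (classes M \<Gamma> us)"
  have args: "list_all2 (definable_graph L M \<Gamma>) ts (fst (farity (eq_lang L M) g))"
    using 2(2) by (rule list_all2_mono) blast
  consider (Old) f where "g = Old f" "f \<in> Funs L" | (Proj) ss E where "g = Proj ss E" "defines_equiv L M ss E"
    using 2(1) by (auto simp: eq_lang_def)
  then show ?case
  proof cases
    case Old
    define ss where "ss = fst (farity L f)"
    define s where "s = snd (farity L f)"
    have ar: "farity (eq_lang L M) g = (map home ss, home s)" by (simp add: Old(1) eq_lang_def ss_def s_def)
    have S: "set ss \<subseteq> Sorts L" "s \<in> Sorts L" and fI: "\<And>as. as \<in> tup M ss \<Longrightarrow> funI M f as \<in> dom M s"
      using st Old(2) by (simp_all add: struct_of_def ss_def s_def)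
    from definable_graph_args[OF _ S(1) \<Gamma>, of ts] args ar
    obtain \<alpha> where at: "\<And>us. reps M \<Gamma> us \<Longrightarrow> map (?ev us) ts \<in> tup (eq_struct L M) (map home ss)"
      and \<alpha>: "formula L (ss @ concat (map fst \<Gamma>)) \<alpha>"
      "\<And>us a. reps M \<Gamma> us \<Longrightarrow> a \<in> tup M ss \<Longrightarrow> sat M \<alpha> (a @ concat us) \<longleftrightarrow> map the_real (map (?ev us) ts) = a"
      by auto
    let ?\<beta> = "Eq (Var 0) (App f (map Var [length [s]..<length [s] + length ss]))"
    have "tm_sort L ([s] @ ss) (App f (map Var [length [s]..<length [s] + length ss])) (snd (farity L f))"
      by (rule tm_sort.intros(2)[OF Old(2)]) (use sorts_vars[of L "[s]" ss] in \<open>simp only: ss_def\<close>)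
    moreover have "tm_sort L ([s] @ ss) (Var 0) s" using tm_sort.intros(1)[of 0 "[s] @ ss" L] by simp
    ultimately have \<beta>: "formula L ([s] @ ss) ?\<beta>" using S by (auto simp: formula_def s_def)
    obtain \<gamma> where \<gamma>: "formula L ([s] @ concat (map fst \<Gamma>)) \<gamma>"
      "\<And>v w. v \<in> tup M [s] \<Longrightarrow> w \<in> tup M (concat (map fst \<Gamma>)) \<Longrightarrow>
        sat M \<gamma> (v @ w) \<longleftrightarrow> (\<exists>a\<in>tup M ss. sat M \<alpha> (a @ w) \<and> sat M ?\<beta> (v @ a))"
      by (rule formula_ex_conj[OF \<alpha>(1) \<beta>]) (rule that)
    have ev: "?ev us (App g ts) = (home s, {[funI M f (map the_real (map (?ev us) ts))]})" for us
      by (simp add: Old(1) eq_struct_def s_def)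
    have rt: "map the_real (map (?ev us) ts) \<in> tup M ss" if "reps M \<Gamma> us" for us
      by (rule the_real_tup[OF at[OF that]])
    have "sat M \<gamma> (v @ concat us) \<longleftrightarrow> ?ev us (App g ts) = eq_class M (home s) v"
      if us: "reps M \<Gamma> us" and v: "v \<in> tup M [s]" for us v
    proof -
      obtain m where m: "v = [m]" "m \<in> dom M s" using v by (auto simp: tup_Cons)
      have b: "sat M ?\<beta> (v @ a) \<longleftrightarrow> m = funI M f a" if "a \<in> tup M ss" for a
        using eval_vars[of a "length ss" M "[m]"] length_tup[OF that] m(1) by simp
      have "sat M \<gamma> (v @ concat us) \<longleftrightarrow> (\<exists>a\<in>tup M ss. map the_real (map (?ev us) ts) = a \<and> m = funI M f a)"
        unfolding \<gamma>(2)[OF v reps_concat[OF us]] using \<alpha>(2)[OF us] b by (intro bex_cong refl) simp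
      also have "\<dots> \<longleftrightarrow> m = funI M f (map the_real (map (?ev us) ts))" using rt[OF us] by blast
      also have "\<dots> \<longleftrightarrow> ?ev us (App g ts) = eq_class M (home s) v"
        unfolding ev m(1) home_class[OF m(2)] by auto
      finally show ?thesis .
    qed
    moreover have "?ev us (App g ts) \<in> dom (eq_struct L M) (home s)" if "reps M \<Gamma> us" for us
      unfolding ev dom_home using fI[OF rt[OF that]] by (rule imageI)
    ultimately show ?thesis unfolding definable_graph_def ar snd_conv fst_home using \<gamma>(1) by blast
  next
    case Proj
    let ?S = "(ss, E)"
    have ar: "farity (eq_lang L M) g = (map home ss, ?S)" by (simp add: Proj(1) eq_lang_def)
    have S: "set ss \<subseteq> Sorts L" and E: "formula L (ss @ ss) E" using Proj(2) by (auto simp: defines_equiv_def formula_def)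
    from definable_graph_args[OF _ S \<Gamma>, of ts] args ar
    obtain \<alpha> where at: "\<And>us. reps M \<Gamma> us \<Longrightarrow> map (?ev us) ts \<in> tup (eq_struct L M) (map home ss)"
      and \<alpha>: "formula L (ss @ concat (map fst \<Gamma>)) \<alpha>"
      "\<And>us a. reps M \<Gamma> us \<Longrightarrow> a \<in> tup M ss \<Longrightarrow> sat M \<alpha> (a @ concat us) \<longleftrightarrow> map the_real (map (?ev us) ts) = a"
      by auto
    obtain \<gamma> where \<gamma>: "formula L (ss @ concat (map fst \<Gamma>)) \<gamma>"
      "\<And>v w. v \<in> tup M ss \<Longrightarrow> w \<in> tup M (concat (map fst \<Gamma>)) \<Longrightarrow>
        sat M \<gamma> (v @ w) \<longleftrightarrow> (\<exists>a\<in>tup M ss. sat M \<alpha> (a @ w) \<and> sat M E (v @ a))"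
      by (rule formula_ex_conj[OF \<alpha>(1) E]) (rule that)
    have ev: "?ev us (App g ts) = eq_class M ?S (map the_real (map (?ev us) ts))" for us
      by (simp add: Proj(1) eq_struct_def)
    have rt: "map the_real (map (?ev us) ts) \<in> tup M ss" if "reps M \<Gamma> us" for us
      by (rule the_real_tup[OF at[OF that]])
    have eqc: "eq_class M ?S u = eq_class M ?S v \<longleftrightarrow> sat M E (u @ v)" if "u \<in> tup M ss" "v \<in> tup M ss" for u v
      using eq_class_eq_iff[of L M ?S u v] Proj(2) that by simp
    have "sat M \<gamma> (v @ concat us) \<longleftrightarrow> ?ev us (App g ts) = eq_class M ?S v"
      if us: "reps M \<Gamma> us" and v: "v \<in> tup M ss" for us v
    proof -
      have "sat M \<gamma> (v @ concat us) \<longleftrightarrow> (\<exists>a\<in>tup M ss. map the_real (map (?ev us) ts) = a \<and> sat M E (v @ a))"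
        unfolding \<gamma>(2)[OF v reps_concat[OF us]] using \<alpha>(2)[OF us] by (intro bex_cong refl) simp
      also have "\<dots> \<longleftrightarrow> sat M E (v @ map the_real (map (?ev us) ts))" using rt[OF us] by blast
      also have "\<dots> \<longleftrightarrow> ?ev us (App g ts) = eq_class M ?S v"
        unfolding ev eqc[OF v rt[OF us], symmetric] by (rule eq_commute)
      finally show ?thesis .
    qed
    moreover have "?ev us (App g ts) \<in> dom (eq_struct L M) ?S" if "reps M \<Gamma> us" for us
      unfolding ev dom_eq fst_conv using rt[OF that] by (rule imageI)
    ultimately show ?thesis unfolding definable_graph_def ar snd_conv fst_conv using \<gamma>(1) by blast
  qed
qed

text \<open>A quantifier over an imaginary sort becomes a block of quantifiers over representatives.
  Independence of the choice of representatives is built in, since the left side mentions only their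
  classes.\<close>

lemma formula_translate:
  fixes L :: "('s, 'f, 'r) lang" and M :: "('s, 'f, 'r, 'm) struct"
  assumes st: "struct_of L M"
  shows "set \<Gamma> \<subseteq> Sorts (eq_lang L M) \<Longrightarrow> wf_fm (eq_lang L M) \<Gamma> \<phi> \<Longrightarrow>
    \<exists>\<phi>'. formula L (concat (map fst \<Gamma>)) \<phi>' \<and>
      (\<forall>us. reps M \<Gamma> us \<longrightarrow> (sat (eq_struct L M) \<phi> (classes M \<Gamma> us) \<longleftrightarrow> sat M \<phi>' (concat us)))"
proof (induction \<phi> arbitrary: \<Gamma>)
  case Fls
  have "formula L (concat (map fst \<Gamma>)) Fls" using sorts_concat[OF Fls(1)] by (simp add: formula_def)
  then show ?case by (intro exI[of _ Fls]) simp
next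
  case (Eq t u)
  let ?ev = "\<lambda>us. eval_tm (eq_struct L M) (classes M \<Gamma> us)"
  from Eq(2) obtain S where S: "tm_sort (eq_lang L M) \<Gamma> t S" "tm_sort (eq_lang L M) \<Gamma> u S" by auto
  have t: "?ev us t \<in> dom (eq_struct L M) S" if "reps M \<Gamma> us" for us
    using definable_graph_term[OF st Eq(1) S(1)] that by (simp add: definable_graph_def)
  obtain \<alpha> where \<alpha>: "formula L (fst S @ concat (map fst \<Gamma>)) \<alpha>"
    "\<forall>us v. reps M \<Gamma> us \<longrightarrow> v \<in> tup M (fst S) \<longrightarrow> (sat M \<alpha> (v @ concat us) \<longleftrightarrow> ?ev us t = eq_class M S v)"
    using definable_graph_term[OF st Eq(1) S(1)] unfolding definable_graph_def by (elim conjE exE)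
  obtain \<beta> where \<beta>: "formula L (fst S @ concat (map fst \<Gamma>)) \<beta>"
    "\<forall>us v. reps M \<Gamma> us \<longrightarrow> v \<in> tup M (fst S) \<longrightarrow> (sat M \<beta> (v @ concat us) \<longleftrightarrow> ?ev us u = eq_class M S v)"
    using definable_graph_term[OF st Eq(1) S(2)] unfolding definable_graph_def by (elim conjE exE)
  \<comment> \<open>Two values are equal iff some tuple represents both.\<close>
  let ?\<gamma> = "Exs (fst S) (Neg (Imp \<alpha> (Neg \<beta>)))"
  have "formula L (concat (map fst \<Gamma>)) ?\<gamma>"
    using \<alpha>(1) \<beta>(1) by (intro formula_Exs) (simp add: formula_def)
  moreover have "sat (eq_struct L M) (Eq t u) (classes M \<Gamma> us) \<longleftrightarrow> sat M ?\<gamma> (concat us)"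
    if us: "reps M \<Gamma> us" for us
  proof -
    have "sat M ?\<gamma> (concat us) \<longleftrightarrow> (\<exists>v\<in>tup M (fst S). ?ev us t = eq_class M S v \<and> ?ev us u = eq_class M S v)"
      using \<alpha>(2) \<beta>(2) us by (simp add: sat_Exs)
    also have "\<dots> \<longleftrightarrow> ?ev us t = ?ev us u" using t[OF us] by (auto simp: dom_eq)
    finally show ?thesis by simp
  qed
  ultimately show ?case by blast
next
  case (Rel r ts)
  let ?ev = "\<lambda>us. eval_tm (eq_struct L M) (classes M \<Gamma> us)"
  define ss where "ss = rarity L r"
  have r: "r \<in> Rels L" and ts: "list_all2 (tm_sort (eq_lang L M) \<Gamma>) ts (map home ss)"
    using Rel(2) by (simp_all add: eq_lang_def ss_def)
  have S: "set ss \<subseteq> Sorts L" using st r by (simp add: struct_of_def ss_def)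
  have "list_all2 (definable_graph L M \<Gamma>) ts (map home ss)"
    using ts by (rule list_all2_mono) (rule definable_graph_term[OF st Rel(1)])
  from definable_graph_args[OF this S Rel(1)]
  obtain \<alpha> where at: "\<forall>us. reps M \<Gamma> us \<longrightarrow> map (?ev us) ts \<in> tup (eq_struct L M) (map home ss)"
    and \<alpha>: "formula L (ss @ concat (map fst \<Gamma>)) \<alpha>"
    "\<forall>us a. reps M \<Gamma> us \<longrightarrow> a \<in> tup M ss \<longrightarrow> (sat M \<alpha> (a @ concat us) \<longleftrightarrow> map the_real (map (?ev us) ts) = a)"
    by (elim conjE exE)
  let ?\<beta> = "Rel r (map Var [0..<length ss])"
  have "formula L ([] @ ss) ?\<beta>"
    using sorts_vars[of L "[]" ss] r S by (simp add: formula_def ss_def)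
  from \<alpha>(1) this obtain \<gamma> where \<gamma>: "formula L ([] @ concat (map fst \<Gamma>)) \<gamma>"
    "\<And>v w. v \<in> tup M [] \<Longrightarrow> w \<in> tup M (concat (map fst \<Gamma>)) \<Longrightarrow>
      sat M \<gamma> (v @ w) \<longleftrightarrow> (\<exists>a\<in>tup M ss. sat M \<alpha> (a @ w) \<and> sat M ?\<beta> (v @ a))"
    by (rule formula_ex_conj) (rule that)
  have "sat (eq_struct L M) (Rel r ts) (classes M \<Gamma> us) \<longleftrightarrow> sat M \<gamma> (concat us)" if us: "reps M \<Gamma> us" for us
  proof -
    have a: "map the_real (map (?ev us) ts) \<in> tup M ss" using the_real_tup at us by blast
    have b: "sat M ?\<beta> ([] @ a) \<longleftrightarrow> relI M r a" if "a \<in> tup M ss" for a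
      using eval_vars[of a "length ss" M "[]"] length_tup[OF that] by simp
    have "sat M \<gamma> ([] @ concat us) \<longleftrightarrow> (\<exists>a\<in>tup M ss. map the_real (map (?ev us) ts) = a \<and> relI M r a)"
      unfolding \<gamma>(2)[OF _ reps_concat[OF us], of "[]", simplified tup_Nil singleton_iff, OF refl]
      using \<alpha>(2) us b by (intro bex_cong refl) simp
    also have "\<dots> \<longleftrightarrow> relI M r (map the_real (map (?ev us) ts))" using a by blast
    finally show ?thesis by (simp add: eq_struct_def)
  qed
  with \<gamma>(1) show ?case by (intro exI[of _ \<gamma>]) simp
next
  case (Imp \<phi> \<psi>)
  obtain \<phi>' where \<phi>': "formula L (concat (map fst \<Gamma>)) \<phi>'"
    "\<forall>us. reps M \<Gamma> us \<longrightarrow> (sat (eq_struct L M) \<phi> (classes M \<Gamma> us) \<longleftrightarrow> sat M \<phi>' (concat us))"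
    using Imp.IH(1)[OF Imp.prems(1)] Imp.prems(2) by auto
  obtain \<psi>' where \<psi>': "formula L (concat (map fst \<Gamma>)) \<psi>'"
    "\<forall>us. reps M \<Gamma> us \<longrightarrow> (sat (eq_struct L M) \<psi> (classes M \<Gamma> us) \<longleftrightarrow> sat M \<psi>' (concat us))"
    using Imp.IH(2)[OF Imp.prems(1)] Imp.prems(2) by auto
  show ?case using \<phi>' \<psi>' by (intro exI[of _ "Imp \<phi>' \<psi>'"]) (simp add: formula_def)
next
  case (Ex S \<phi>)
  have S: "set (S # \<Gamma>) \<subseteq> Sorts (eq_lang L M)" using Ex.prems by simp
  obtain \<phi>' where \<phi>': "formula L (concat (map fst (S # \<Gamma>))) \<phi>'"
    "\<forall>us. reps M (S # \<Gamma>) us \<longrightarrow> (sat (eq_struct L M) \<phi> (classes M (S # \<Gamma>) us) \<longleftrightarrow> sat M \<phi>' (concat us))"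
    using Ex.IH[OF S] Ex.prems(2) by auto
  have "formula L (concat (map fst \<Gamma>)) (Exs (fst S) \<phi>')" using \<phi>'(1) by (intro formula_Exs) simp
  moreover have "sat (eq_struct L M) (Ex S \<phi>) (classes M \<Gamma> us) \<longleftrightarrow> sat M (Exs (fst S) \<phi>') (concat us)"
    if us: "reps M \<Gamma> us" for us
  proof -
    have "sat (eq_struct L M) \<phi> (eq_class M S u # classes M \<Gamma> us) \<longleftrightarrow> sat M \<phi>' (u @ concat us)"
      if u: "u \<in> tup M (fst S)" for u
    proof -
      have "reps M (S # \<Gamma>) (u # us)" using u us by (simp add: reps_def)
      then show ?thesis using \<phi>'(2)[rule_format, of "u # us"] by simp
    qed
    then show ?thesis by (simp add: sat_Exs dom_eq)
  qed
  ultimately show ?case by blast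
qed

lemma dset_translate:
  fixes L :: "('s, 'f, 'r) lang" and M :: "('s, 'f, 'r, 'm) struct"
  assumes st: "struct_of L M" and X: "dset (eq_lang L M) (eq_struct L M) B xs X"
  shows "\<exists>Y. dset L M (\<Union>e\<in>B. set (rep M e)) (concat (map fst xs)) Y \<and>
    (\<forall>us. reps M xs us \<longrightarrow> (X (classes M xs us) \<longleftrightarrow> Y (concat us)))"
proof -
  obtain \<phi> b ys where b: "set b \<subseteq> B" "b \<in> tup (eq_struct L M) ys"
    and \<phi>: "formula (eq_lang L M) (xs @ ys) \<phi>"
    and X': "\<And>x. x \<in> tup (eq_struct L M) xs \<Longrightarrow> X x \<longleftrightarrow> sat (eq_struct L M) \<phi> (x @ b)"
    using X by (rule dsetE) (rule that)
  have "set (xs @ ys) \<subseteq> Sorts (eq_lang L M)" "wf_fm (eq_lang L M) (xs @ ys) \<phi>"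
    using \<phi> by (simp_all only: formula_def)
  from formula_translate[OF st this] obtain \<phi>' where \<phi>': "formula L (concat (map fst (xs @ ys))) \<phi>'"
    "\<forall>us. reps M (xs @ ys) us \<longrightarrow> (sat (eq_struct L M) \<phi> (classes M (xs @ ys) us) \<longleftrightarrow> sat M \<phi>' (concat us))"
    by (elim exE conjE)
  let ?b = "map (rep M) b"
  have rb: "reps M ys ?b" "classes M ys ?b = b" using reps_rep[OF b(2)] by simp_all
  let ?Y = "\<lambda>x. sat M \<phi>' (x @ concat ?b)"
  have "dset L M (\<Union>e\<in>B. set (rep M e)) (concat (map fst xs)) ?Y"
  proof (rule dsetI)
    show "set (concat ?b) \<subseteq> (\<Union>e\<in>B. set (rep M e))" using b(1) by auto
    show "concat ?b \<in> tup M (concat (map fst ys))" by (rule reps_concat[OF rb(1)])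
    show "formula L (concat (map fst xs) @ concat (map fst ys)) \<phi>'" using \<phi>'(1) by simp
  qed simp
  moreover have "X (classes M xs us) \<longleftrightarrow> ?Y (concat us)" if us: "reps M xs us" for us
    using X'[OF classes_tup[OF us]] \<phi>'(2)[rule_format, OF reps_append[OF us rb(1)]]
    unfolding classes_append[OF us] rb(2) by simp
  ultimately show ?thesis by blast
qed

section \<open>Saturation of the structure of imaginaries\<close>

lemma small_reps:
  fixes L :: "('s, 'f, 'r) lang" and M :: "('s, 'f, 'r, 'm) struct" and \<kappa> :: "'k rel"
  assumes \<kappa>: "Card_order \<kappa>" "infinite (Field \<kappa>)" and B: "small (eq_lang L M) \<kappa> (eq_struct L M) B"
  shows "small L \<kappa> M (\<Union>e\<in>B. set (rep M e))"
proof -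
  have "set (rep M e) \<subseteq> universe L M" if e: "e \<in> B" for e
  proof -
    obtain S where S: "S \<in> Sorts (eq_lang L M)" "e \<in> dom (eq_struct L M) S"
      using B e unfolding small_def universe_def by blast
    show ?thesis by (rule set_tup[OF rep(1)[OF S(2)] sorts_fst[OF S(1)]])
  qed
  moreover have "|\<Union>e\<in>B. set (rep M e)| <o \<kappa>"
  \<comment> \<open>Representatives are finite tuples. So the union is finite if \<open>B\<close>
    is, and otherwise it is no larger than \<open>B\<close>.\<close>
  proof (cases "finite B")
    case True
    then show ?thesis
      using card_order_on_well_order_on[OF \<kappa>(1)] \<kappa>(2)
      by (intro finite_ordLess_infinite card_of_Well_order) (simp_all add: Field_card_of)
  next
    case False
    have "|set (rep M e)| \<le>o |B|" for e
      using False by (intro ordLess_imp_ordLeq finite_ordLess_infinite card_of_Well_order) (simp_all add: Field_card_of)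
    then have "|\<Union>e\<in>B. set (rep M e)| \<le>o |B|"
      using False by (intro card_of_UNION_ordLeq_infinite ballI) (simp_all add: card_of_mono1)
    moreover have "|B| <o \<kappa>" using B by (simp add: small_def)
    ultimately show ?thesis by (rule ordLeq_ordLess_trans)
  qed
  ultimately show ?thesis by (auto simp: small_def)
qed

text \<open>A family over imaginaries becomes one over their representatives, which is realized in
  the original structure; the classes of a solution solve the given family.\<close>

lemma eq_struct_realize:
  fixes L :: "('s, 'f, 'r) lang" and M :: "('s, 'f, 'r, 'm) struct" and \<kappa> :: "'k rel"
  assumes st: "struct_of L M" and sat: "saturated L \<kappa> M" and \<kappa>: "Card_order \<kappa>" "infinite (Field \<kappa>)"
    and B: "small (eq_lang L M) \<kappa> (eq_struct L M) B" and xs: "set xs \<subseteq> Sorts (eq_lang L M)"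
    and Xs: "\<And>X. X \<in> Xs \<Longrightarrow> dset (eq_lang L M) (eq_struct L M) B xs X"
    and fs: "\<And>F. F \<subseteq> Xs \<Longrightarrow> finite F \<Longrightarrow> \<exists>x\<in>tup (eq_struct L M) xs. \<forall>X\<in>F. X x"
  shows "\<exists>x\<in>tup (eq_struct L M) xs. \<forall>X\<in>Xs. X x"
proof -
  let ?B = "\<Union>e\<in>B. set (rep M e)" and ?xs = "concat (map fst xs)"
  have "\<forall>X\<in>Xs. \<exists>Y. dset L M ?B ?xs Y \<and> (\<forall>us. reps M xs us \<longrightarrow> (X (classes M xs us) \<longleftrightarrow> Y (concat us)))"
    using dset_translate[OF st Xs] by (rule ballI)
  from bchoice[OF this] obtain tr where tr: "\<forall>X\<in>Xs. dset L M ?B ?xs (tr X) \<and>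
      (\<forall>us. reps M xs us \<longrightarrow> (X (classes M xs us) \<longleftrightarrow> tr X (concat us)))" by (rule exE)
  have "\<exists>w\<in>tup M ?xs. \<forall>Y\<in>tr ` Xs. Y w"
  proof (rule saturated_tuple[OF sat \<kappa> small_reps[OF \<kappa> B] sorts_concat[OF xs]])
    fix Y assume "Y \<in> tr ` Xs"
    then show "dset L M ?B ?xs Y" using tr by (elim imageE) simp
  next
    fix G assume G: "G \<subseteq> tr ` Xs" "finite G"
    obtain F where F: "F \<subseteq> Xs" "finite F" "G = tr ` F"
      using finite_subset_image[OF G(2,1)] by (elim exE conjE)
    obtain x where x: "x \<in> tup (eq_struct L M) xs" "\<forall>X\<in>F. X x" using fs[OF F(1,2)] by (rule bexE)
    note rx = reps_rep[OF x(1), THEN conjunct1] reps_rep[OF x(1), THEN conjunct2]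
    have "tr X (concat (map (rep M) x))" if X: "X \<in> F" for X
      using bspec[OF tr subsetD[OF F(1) X], THEN conjunct2, rule_format, OF rx(1)] bspec[OF x(2) X]
      unfolding rx(2) by (rule iffD1)
    then show "\<exists>w\<in>tup M ?xs. \<forall>Y\<in>G. Y w"
      unfolding F(3) using reps_concat[OF rx(1)] by (intro bexI[of _ "concat (map (rep M) x)"]) simp_all
  qed
  then obtain w where w: "w \<in> tup M ?xs" "\<forall>Y\<in>tr ` Xs. Y w" by (rule bexE)
  obtain us where us: "reps M xs us" "concat us = w" using reps_exists[OF w(1)] by (elim exE conjE)
  have "X (classes M xs us)" if X: "X \<in> Xs" for X
    using bspec[OF tr X, THEN conjunct2, rule_format, OF us(1)] bspec[OF w(2) imageI[OF X]]
    unfolding us(2) by (rule iffD2)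
  then show ?thesis using classes_tup[OF us(1)] by (intro bexI[of _ "classes M xs us"] ballI)
qed

section \<open>Imaginaries of imaginaries\<close>

lemma equiv_pullback:
  assumes "equiv A {(a, b). a \<in> A \<and> b \<in> A \<and> P a b}" "\<And>x. x \<in> B \<Longrightarrow> f x \<in> A"
    and "\<And>x y. x \<in> B \<Longrightarrow> y \<in> B \<Longrightarrow> Q x y \<longleftrightarrow> P (f x) (f y)"
  shows "equiv B {(x, y). x \<in> B \<and> y \<in> B \<and> Q x y}"
proof -
  have r: "P a a" if "a \<in> A" for a using equivE[OF assms(1)] that by (auto dest: refl_onD)
  have s: "P b a" if "P a b" "a \<in> A" "b \<in> A" for a b using equivE[OF assms(1)] that by (auto dest: symD)
  have t: "P a c" if "P a b" "P b c" "a \<in> A" "b \<in> A" "c \<in> A" for a b c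
    using equivE[OF assms(1)] that by (auto dest: transD)
  show ?thesis
  proof (rule equivI)
    show "sym {(x, y). x \<in> B \<and> y \<in> B \<and> Q x y}"
      by (rule symI) (use s assms(2) in \<open>auto simp: assms(3)\<close>)
    show "trans {(x, y). x \<in> B \<and> y \<in> B \<and> Q x y}"
      by (rule transI) (use t assms(2) in \<open>auto simp: assms(3)\<close>)
  qed (auto simp: refl_on_def assms(2,3) r)
qed

text \<open>The projections relate an imaginary to its real representatives inside the structure of
  imaginaries. The induction collects this for a list of imaginaries, so that representatives can be
  quantified over there.\<close>

lemma representatives_formula:
  fixes L :: "('s, 'f, 'r) lang" and M :: "('s, 'f, 'r, 'm) struct"
  assumes "set ws \<subseteq> Sorts (eq_lang L M)"
  shows "\<exists>\<delta>. formula (eq_lang L M) (ws @ map home (concat (map fst ws))) \<delta> \<and>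
    (\<forall>x\<in>tup (eq_struct L M) ws. \<forall>w\<in>tup (eq_struct L M) (map home (concat (map fst ws))).
      sat (eq_struct L M) \<delta> (x @ w) \<longleftrightarrow> (\<exists>us. reps M ws us \<and> concat us = map the_real w \<and> classes M ws us = x))"
  using assms
proof (induction ws)
  case Nil
  have "formula (eq_lang L M) [] (Neg Fls)" by (simp add: formula_def)
  then show ?case by (intro exI[of _ "Neg Fls"]) (simp add: reps_def)
next
  case (Cons W ws)
  let ?L = "eq_lang L M" and ?M = "eq_struct L M"
  let ?zs = "concat (map fst ws)"
  have W: "W \<in> Sorts ?L" and ws: "set ws \<subseteq> Sorts ?L" using Cons.prems by simp_all
  obtain \<beta> where \<beta>: "formula ?L (ws @ map home ?zs) \<beta>"
    "\<forall>x\<in>tup ?M ws. \<forall>w\<in>tup ?M (map home ?zs).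
      sat ?M \<beta> (x @ w) \<longleftrightarrow> (\<exists>us. reps M ws us \<and> concat us = map the_real w \<and> classes M ws us = x)"
    using Cons.IH[OF ws] by (elim exE conjE)
  have hs: "set (map home ss) \<subseteq> Sorts ?L" if "set ss \<subseteq> Sorts L" for ss
  proof
    fix S :: "('s, 'f, 'r) eq_sort" assume "S \<in> set (map home ss)"
    then obtain s where s: "s \<in> set ss" "S = home s" by auto
    show "S \<in> Sorts ?L" unfolding Sorts_eq s(2) by (rule home_equiv) (use that s(1) in blast)
  qed
  let ?k = "length (map home (fst W) :: ('s, 'f, 'r) eq_sort list)"
  \<comment> \<open>The graph of the projection to \<open>W\<close>: variable 0 is the imaginary,
    and the following ones are its representative.\<close>
  let ?\<theta> = "Eq (Var 0) (App (Proj (fst W) (snd W)) (map Var [length [W]..<length [W] + ?k]))"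
  have ar: "farity ?L (Proj (fst W) (snd W)) = (map home (fst W), W)" by (simp add: eq_lang_def)
  have "Proj (fst W) (snd W) \<in> Funs ?L" using W unfolding Sorts_eq by (auto simp: eq_lang_def)
  from tm_sort.intros(2)[OF this, of "[W] @ map home (fst W)" "map Var [length [W]..<length [W] + ?k]"]
  have "tm_sort ?L ([W] @ map home (fst W)) (App (Proj (fst W) (snd W)) (map Var [length [W]..<length [W] + ?k])) W"
    unfolding ar fst_conv snd_conv using sorts_vars[of ?L "[W]" "map home (fst W)"] by blast
  moreover have "tm_sort ?L ([W] @ map home (fst W)) (Var 0) W"
    using tm_sort.intros(1)[of 0 "[W] @ map home (fst W)" ?L] by simp
  moreover have "set ([W] @ map home (fst W)) \<subseteq> Sorts ?L" using W hs[OF sorts_fst[OF W]] by simp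
  ultimately have \<theta>: "formula ?L ([W] @ map home (fst W)) ?\<theta>" unfolding formula_def wf_fm.simps by blast
  have \<theta>_sat: "sat ?M ?\<theta> ([x] @ h) \<longleftrightarrow> x = eq_class M W (map the_real h)"
    if h: "h \<in> tup ?M (map home (fst W))" for x h
  proof -
    have "map (eval_tm ?M ([x] @ h)) (map Var [length [x]..<length [x] + ?k]) = h"
      by (rule eval_vars) (rule length_tup[OF h])
    then have "funI ?M (Proj (fst W) (snd W)) (map (eval_tm ?M ([x] @ h)) (map Var [length [x]..<length [x] + ?k]))
        = eq_class M W (map the_real h)"
      by (simp add: eq_struct_def del: map_map)
    then show ?thesis by simp
  qed
  define \<sigma> :: "nat \<Rightarrow> ('s, 'f, 'r) eq_sort list" where
    "\<sigma> v = (if v = 0 then [W] else if v = 1 then ws else if v = 2 then map home (fst W) else map home ?zs)" for v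
  have d: "dp ?L ?M {} \<sigma> {0, 1, 2, 3} (\<lambda>\<rho>. sat ?M ?\<theta> (concat (map \<rho> [0, 2])) \<and> sat ?M \<beta> (concat (map \<rho> [1, 3])))"
    by (intro dp_conj dp_formula0) (use \<theta> \<beta>(1) in \<open>simp_all add: \<sigma>_def\<close>)
  have "finite {0, 1, 2, 3 :: nat}" "{0, 1, 2, 3 :: nat} \<subseteq> set [0, 1, 2, 3]" by auto
  moreover have "set (concat (map \<sigma> [0, 1, 2, 3])) \<subseteq> Sorts ?L" using \<theta> \<beta>(1) by (simp add: \<sigma>_def formula_def)
  ultimately obtain \<gamma> where \<gamma>: "formula ?L (concat (map \<sigma> [0, 1, 2, 3])) \<gamma>"
    "\<And>\<rho>. \<rho> \<in> envs ?M \<sigma> \<Longrightarrow> sat ?M ?\<theta> (concat (map \<rho> [0, 2])) \<and> sat ?M \<beta> (concat (map \<rho> [1, 3]))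
      \<longleftrightarrow> sat ?M \<gamma> (concat (map \<rho> [0, 1, 2, 3]))"
    by (rule dp_obtain0[OF d]) (rule that)
  have "formula ?L ((W # ws) @ map home (concat (map fst (W # ws)))) \<gamma>" using \<gamma>(1) by (simp add: \<sigma>_def)
  moreover have "sat ?M \<gamma> (y @ v) \<longleftrightarrow>
      (\<exists>us. reps M (W # ws) us \<and> concat us = map the_real v \<and> classes M (W # ws) us = y)"
    if y: "y \<in> tup ?M (W # ws)" and v: "v \<in> tup ?M (map home (concat (map fst (W # ws))))" for y v
  proof -
    obtain x x' where x: "y = [x] @ x'" "x \<in> dom ?M W" "x' \<in> tup ?M ws" using y by (auto simp: tup_Cons)
    have "v \<in> tup ?M (map home (fst W) @ map home ?zs)" using v by simp
    then obtain h w where h: "v = h @ w" "h \<in> tup ?M (map home (fst W))" "w \<in> tup ?M (map home ?zs)"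
      unfolding tup_append by (elim exE conjE)
    have "(\<lambda>i :: nat. if i = 0 then [x] else if i = 1 then x' else if i = 2 then h else w) \<in> envs ?M \<sigma>"
      using x h by (simp add: envs_def \<sigma>_def tup_Cons)
    from \<gamma>(2)[OF this] have "sat ?M \<gamma> (y @ v) \<longleftrightarrow> sat ?M ?\<theta> ([x] @ h) \<and> sat ?M \<beta> (x' @ w)"
      by (simp add: x(1) h(1))
    also have "\<dots> \<longleftrightarrow> x = eq_class M W (map the_real h) \<and>
        (\<exists>us. reps M ws us \<and> concat us = map the_real w \<and> classes M ws us = x')"
      unfolding \<theta>_sat[OF h(2)] using \<beta>(2) x(3) h(3) by simp
    also have "\<dots> \<longleftrightarrow> (\<exists>us. reps M (W # ws) us \<and> concat us = map the_real v \<and> classes M (W # ws) us = y)"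
    proof
      assume "x = eq_class M W (map the_real h) \<and>
        (\<exists>us. reps M ws us \<and> concat us = map the_real w \<and> classes M ws us = x')"
      then obtain us where us: "x = eq_class M W (map the_real h)" "reps M ws us" "concat us = map the_real w"
        "classes M ws us = x'" by (elim exE conjE)
      then show "\<exists>us. reps M (W # ws) us \<and> concat us = map the_real v \<and> classes M (W # ws) us = y"
        using the_real_tup[OF h(2)] by (intro exI[of _ "map the_real h # us"]) (simp add: reps_def x(1) h(1))
    next
      assume "\<exists>us. reps M (W # ws) us \<and> concat us = map the_real v \<and> classes M (W # ws) us = y"
      then obtain us where us: "reps M (W # ws) us" "concat us = map the_real v" "classes M (W # ws) us = y"
        by (elim exE conjE)
      then obtain u us' where u: "us = u # us'" "u \<in> tup M (fst W)" "reps M ws us'"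
        by (auto simp: reps_def list_all2_Cons2)
      have "length u = length (map the_real h)" using length_tup[OF u(2)] length_tup[OF h(2)] by simp
      then have "u = map the_real h" "concat us' = map the_real w" using us(2) by (simp_all add: u(1) h(1))
      then show "x = eq_class M W (map the_real h) \<and>
        (\<exists>us. reps M ws us \<and> concat us = map the_real w \<and> classes M ws us = x')"
        using us(3) u(3) by (auto simp: u(1) x(1))
    qed
    finally show ?thesis .
  qed
  ultimately show ?case by blast
qed

text \<open>An equivalence relation on tuples of imaginaries pulls back to one on their
  representatives, which the translation defines in the original structure. Its classes already form
  a sort, so imaginaries of imaginaries are imaginaries. The graph of the quotient map is defined by
  guessing representatives and projecting them.\<close>

lemma eq_struct_quotient:
  fixes L :: "('s, 'f, 'r) lang" and M :: "('s, 'f, 'r, 'm) struct"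
  assumes st: "struct_of L M" and E: "defines_equiv (eq_lang L M) (eq_struct L M) ws E"
  shows "\<exists>S\<in>Sorts (eq_lang L M). \<exists>\<pi> \<delta>. formula (eq_lang L M) (ws @ [S]) \<delta> \<and>
    (\<forall>x\<in>tup (eq_struct L M) ws. \<pi> x \<in> dom (eq_struct L M) S) \<and>
    (\<forall>x\<in>tup (eq_struct L M) ws. \<forall>z\<in>dom (eq_struct L M) S.
      sat (eq_struct L M) \<delta> (x @ [z]) \<longleftrightarrow> \<pi> x = z) \<and>
    (\<forall>x\<in>tup (eq_struct L M) ws. \<forall>y\<in>tup (eq_struct L M) ws.
      \<pi> x = \<pi> y \<longleftrightarrow> sat (eq_struct L M) E (x @ y))"
proof -
  let ?L = "eq_lang L M" and ?M = "eq_struct L M"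
  let ?zs = "concat (map fst ws)"
  have eqv: "equiv (tup ?M ws) {(a, b). a \<in> tup ?M ws \<and> b \<in> tup ?M ws \<and> sat ?M E (a @ b)}"
    and Ef: "set (ws @ ws) \<subseteq> Sorts ?L" "wf_fm ?L (ws @ ws) E"
    using E by (simp_all only: defines_equiv_def formula_def)
  then have ws: "set ws \<subseteq> Sorts ?L" by simp
  from formula_translate[OF st Ef] obtain E' where E': "formula L (concat (map fst (ws @ ws))) E'"
    "\<forall>us. reps M (ws @ ws) us \<longrightarrow> (sat ?M E (classes M (ws @ ws) us) \<longleftrightarrow> sat M E' (concat us))"
    by (elim exE conjE)
  have E'_sat: "sat M E' (concat us @ concat vs) \<longleftrightarrow> sat ?M E (classes M ws us @ classes M ws vs)"
    if us: "reps M ws us" and vs: "reps M ws vs" for us vs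
    using E'(2)[rule_format, OF reps_append[OF us vs]] unfolding classes_append[OF us] by simp
  have "\<forall>w\<in>tup M ?zs. \<exists>us. reps M ws us \<and> concat us = w" using reps_exists by (rule ballI)
  from bchoice[OF this] obtain f where f: "\<forall>w\<in>tup M ?zs. reps M ws (f w) \<and> concat (f w) = w" by (rule exE)
  have "equiv (tup M ?zs) {(a, b). a \<in> tup M ?zs \<and> b \<in> tup M ?zs \<and> sat M E' (a @ b)}"
  proof (rule equiv_pullback[OF eqv])
    fix a assume a: "a \<in> tup M ?zs"
    show "classes M ws (f a) \<in> tup ?M ws" using f a by (simp add: classes_tup)
    fix b assume b: "b \<in> tup M ?zs"
    show "sat M E' (a @ b) \<longleftrightarrow> sat ?M E (classes M ws (f a) @ classes M ws (f b))"
      using E'_sat[of "f a" "f b"] f a b by simp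
  qed
  then have de: "defines_equiv L M ?zs E'" using E'(1) by (simp add: defines_equiv_def)
  define S where "S = (?zs, E')"
  have S: "S \<in> Sorts ?L" using de by (simp add: Sorts_eq S_def)
  \<comment> \<open>Defined with chosen representatives; \<open>\<pi>_eq\<close> below shows that
    any others give the same class.\<close>
  define \<pi> where "\<pi> x = eq_class M S (concat (map (rep M) x))" for x
  have cc: "concat us \<in> tup M (fst S)" if "reps M ws us" for us using reps_concat[OF that] by (simp add: S_def)
  have eqc: "eq_class M S (concat us) = eq_class M S (concat vs) \<longleftrightarrow> sat ?M E (classes M ws us @ classes M ws vs)"
    if us: "reps M ws us" and vs: "reps M ws vs" for us vs
    using eq_class_eq_iff[of L M S, OF _ cc[OF us] cc[OF vs]] de E'_sat[OF us vs] by (simp add: S_def)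
  have Eref: "sat ?M E (x @ x)" if "x \<in> tup ?M ws" for x using equivE[OF eqv] that by (auto dest: refl_onD)
  have \<pi>_eq: "\<pi> (classes M ws us) = eq_class M S (concat us)" if us: "reps M ws us" for us
  proof -
    have x: "classes M ws us \<in> tup ?M ws" by (rule classes_tup[OF us])
    note r = reps_rep[OF x, THEN conjunct1] reps_rep[OF x, THEN conjunct2]
    show ?thesis unfolding \<pi>_def eqc[OF r(1) us] r(2) by (rule Eref[OF x])
  qed
  obtain \<beta> where \<beta>: "formula ?L (ws @ map home ?zs) \<beta>"
    "\<forall>x\<in>tup ?M ws. \<forall>w\<in>tup ?M (map home ?zs).
      sat ?M \<beta> (x @ w) \<longleftrightarrow> (\<exists>us. reps M ws us \<and> concat us = map the_real w \<and> classes M ws us = x)"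
    using representatives_formula[OF ws] by (elim exE conjE)
  obtain \<alpha> where \<alpha>: "formula ?L ([S] @ map home ?zs) \<alpha>"
    "\<forall>x\<in>tup ?M [S]. \<forall>w\<in>tup ?M (map home ?zs).
      sat ?M \<alpha> (x @ w) \<longleftrightarrow> (\<exists>us. reps M [S] us \<and> concat us = map the_real w \<and> classes M [S] us = x)"
    using representatives_formula[of "[S]" L M] S by (auto simp: S_def)
  \<comment> \<open>\<open>\<alpha>\<close> has the imaginary in front of its representative; for
    the composition these blocks must change places.\<close>
  define \<sigma> :: "bool \<Rightarrow> ('s, 'f, 'r) eq_sort list" where "\<sigma> v = (if v then map home ?zs else [S])" for v
  have "formula ?L (concat (map \<sigma> [False, True])) \<alpha>" using \<alpha>(1) by (simp add: \<sigma>_def)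
  moreover have "set [False, True] \<subseteq> set [True, False]" by auto
  moreover have "set (concat (map \<sigma> [True, False])) \<subseteq> Sorts ?L" using \<alpha>(1) by (simp add: \<sigma>_def formula_def)
  ultimately obtain \<alpha>' where \<alpha>': "formula ?L (concat (map \<sigma> [True, False])) \<alpha>'"
    "\<And>\<rho>. (\<And>v. \<rho> v \<in> tup ?M (\<sigma> v)) \<Longrightarrow> sat ?M \<alpha>' (concat (map \<rho> [True, False])) \<longleftrightarrow> sat ?M \<alpha> (concat (map \<rho> [False, True]))"
    using formula_blocks[where M = ?M] by blast
  have \<alpha>'_sat: "sat ?M \<alpha>' (w @ [z]) \<longleftrightarrow> eq_class M S (map the_real w) = z"
    if w: "w \<in> tup ?M (map home ?zs)" and z: "z \<in> dom ?M S" for w z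
  proof -
    have "(if v then w else [z]) \<in> tup ?M (\<sigma> v)" for v using w z by (simp add: \<sigma>_def tup_Cons)
    from \<alpha>'(2)[OF this] have "sat ?M \<alpha>' (w @ [z]) \<longleftrightarrow> sat ?M \<alpha> ([z] @ w)" by simp
    also have "\<dots> \<longleftrightarrow> (\<exists>us. reps M [S] us \<and> concat us = map the_real w \<and> classes M [S] us = [z])"
      using \<alpha>(2)[rule_format, of "[z]" w] w z by (simp add: tup_Cons)
    also have "\<dots> \<longleftrightarrow> eq_class M S (map the_real w) = z"
      using the_real_tup[OF w] by (auto simp: reps_def list_all2_Cons2 S_def)
    finally show ?thesis .
  qed
  have "formula ?L (map home ?zs @ [S]) \<alpha>'" using \<alpha>'(1) by (simp add: \<sigma>_def)
  from this \<beta>(1) obtain \<delta> where \<delta>: "formula ?L (ws @ [S]) \<delta>"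
    "\<And>v w. v \<in> tup ?M ws \<Longrightarrow> w \<in> tup ?M [S] \<Longrightarrow> sat ?M \<delta> (v @ w) \<longleftrightarrow>
      (\<exists>a\<in>tup ?M (map home ?zs). sat ?M \<alpha>' (a @ w) \<and> sat ?M \<beta> (v @ a))"
    by (rule formula_ex_conj) (rule that)
  have "\<pi> x \<in> dom ?M S" if x: "x \<in> tup ?M ws" for x
    unfolding \<pi>_def dom_eq using cc[OF reps_rep[OF x, THEN conjunct1]] by (rule imageI)
  moreover have "sat ?M \<delta> (x @ [z]) \<longleftrightarrow> \<pi> x = z" if x: "x \<in> tup ?M ws" and z: "z \<in> dom ?M S" for x z
  proof -
    have "[z] \<in> tup ?M [S]" using z by (simp add: tup_Cons)
    then have "sat ?M \<delta> (x @ [z]) \<longleftrightarrow> (\<exists>a\<in>tup ?M (map home ?zs). eq_class M S (map the_real a) = z \<and>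
        (\<exists>us. reps M ws us \<and> concat us = map the_real a \<and> classes M ws us = x))"
      unfolding \<delta>(2)[OF x \<open>[z] \<in> tup ?M [S]\<close>] using \<alpha>'_sat z \<beta>(2) x by (intro bex_cong refl) simp
    also have "\<dots> \<longleftrightarrow> \<pi> x = z"
    proof
      assume "\<exists>a\<in>tup ?M (map home ?zs). eq_class M S (map the_real a) = z \<and>
        (\<exists>us. reps M ws us \<and> concat us = map the_real a \<and> classes M ws us = x)"
      then show "\<pi> x = z" using \<pi>_eq by auto
    next
      assume p: "\<pi> x = z"
      note r = reps_rep[OF x, THEN conjunct1] reps_rep[OF x, THEN conjunct2]
      obtain a where a: "a \<in> tup ?M (map home ?zs)" "map the_real a = concat (map (rep M) x)"
        by (rule home_tup[OF reps_concat[OF r(1)]]) (rule that)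
      show "\<exists>a\<in>tup ?M (map home ?zs). eq_class M S (map the_real a) = z \<and>
        (\<exists>us. reps M ws us \<and> concat us = map the_real a \<and> classes M ws us = x)"
      proof (rule bexI[OF conjI a(1)])
        show "eq_class M S (map the_real a) = z" unfolding a(2) using p by (simp add: \<pi>_def)
        show "\<exists>us. reps M ws us \<and> concat us = map the_real a \<and> classes M ws us = x"
          by (rule exI[of _ "map (rep M) x"]) (simp only: r a(2) simp_thms)
      qed
    qed
    finally show ?thesis .
  qed
  moreover have "\<pi> x = \<pi> y \<longleftrightarrow> sat ?M E (x @ y)" if x: "x \<in> tup ?M ws" and y: "y \<in> tup ?M ws" for x y
    using eqc[OF reps_rep[OF x, THEN conjunct1] reps_rep[OF y, THEN conjunct1]]
    unfolding reps_rep[OF x, THEN conjunct2] reps_rep[OF y, THEN conjunct2] \<pi>_def .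
  ultimately show ?thesis using \<delta>(1) by (intro bexI[OF _ S] exI[of _ \<pi>] exI[of _ \<delta>]) simp
qed

text \<open>Iterated implications are pairwise different sentences even in a language without
  symbols. So \<open>\<kappa>\<close>, which exceeds the power set of the formulas, is
  uncountable.\<close>

lemma formulas_infinite: "|UNIV :: nat set| \<le>o |formulas L|"
proof -
  let ?f = "\<lambda>n. ((Imp Fls) ^^ n) Fls :: ('a, 'b, 'c) fm"
  have "m = n" if "?f m = ?f n" for m n using that
  proof (induction m arbitrary: n)
    case 0 then show ?case by (cases n) simp_all
  next
    case (Suc m) then show ?case by (cases n) simp_all
  qed
  then have "inj ?f" by (rule injI)
  moreover have "formula L [] (?f n)" for n by (induction n) (simp_all add: formula_def)
  then have "range ?f \<subseteq> formulas L" by (auto simp: formulas_def)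
  ultimately show ?thesis using card_of_ordLeq[of UNIV "formulas L"] by blast
qed

lemma rosy_struct_eq:
  fixes L :: "('s, 'f, 'r) lang" and M :: "('s, 'f, 'r, 'm) struct" and \<kappa> :: "'k rel"
  assumes "monster_model L T \<kappa> M" "rosy L \<kappa> M"
  shows "rosy_struct (eq_lang L M) (eq_struct L M) \<kappa>"
proof -
  have st: "struct_of L M" and \<kappa>: "Card_order \<kappa>" and sat: "saturated L \<kappa> M"
    and le: "|Pow (formulas L)| <o \<kappa>"
    using assms(1) by (simp_all add: monster_model_def)
  have nat: "|UNIV :: nat set| <o \<kappa>"
    using formulas_infinite card_of_Pow le by (rule ordLeq_ordLess_trans[OF _ ordLess_transitive])
  have inf: "infinite (Field \<kappa>)" by (rule infinite_Field[OF \<kappa> nat])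
  show ?thesis
  proof
    show "s = t" if "x \<in> dom (eq_struct L M) s" "x \<in> dom (eq_struct L M) t" for s t x
      using that by (auto simp: dom_eq eq_class_def)
  qed (use \<kappa> nat eq_struct_realize[OF st sat \<kappa> inf] eq_struct_quotient[OF st] assms(2)[unfolded rosy_def Let_def] in blast)+
qed

theorem theorem2p15:
  fixes L :: "('s, 'f, 'r) lang"
    and T :: "('s, 'f, 'r) fm set"
    and \<kappa> :: "'k rel"
    and M :: "('s, 'f, 'r, 'm) struct"
    and Leq :: "(('s, 'f, 'r) eq_sort, ('s, 'f, 'r) eq_fun, 'r) lang"
    and Meq :: "(('s, 'f, 'r) eq_sort, ('s, 'f, 'r) eq_fun, 'r, ('s, 'f, 'r, 'm) eq_elem) struct"
    and A :: "('s, 'f, 'r, 'm) eq_elem set"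
    and a :: "('s, 'f, 'r, 'm) eq_elem list"
    and xs :: "('s, 'f, 'r) eq_sort list"
  defines "Leq \<equiv> eq_lang L M" and "Meq \<equiv> eq_struct L M"
  assumes "monster_model L T \<kappa> M"
    and "dependent L M" and "rosy L \<kappa> M"
    and "small Leq \<kappa> Meq A" and "set a \<subseteq> universe Leq Meq"
    and "set xs \<subseteq> Sorts Leq" and "p \<in> complete_types Leq Meq xs (A \<union> set a)"
    and "stable_type Leq Meq xs p"
    and "\<not> stable_type Leq Meq xs (restrict_type Leq Meq xs p A)"
  shows "type_thorn_forks Leq Meq xs A p"
proof -
  interpret rosy_struct Leq Meq \<kappa>
    using rosy_struct_eq[OF assms(3,5)] by (simp add: Leq_def Meq_def)
  \<comment> \<open>The sorts of \<open>a\<close> are not given; each entry lies in some sort, and a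
    choice of these makes \<open>a\<close> a tuple.\<close>
  have "\<exists>S\<in>Sorts Leq. e \<in> dom Meq S" if "e \<in> set a" for e
    using assms(7) that by (auto simp: universe_def)
  then obtain s where s: "\<And>e. e \<in> set a \<Longrightarrow> s e \<in> Sorts Leq \<and> e \<in> dom Meq (s e)" by metis
  have "a \<in> tup Meq (map s a)" using s by (simp add: tup_nth)
  moreover have "set (map s a) \<subseteq> Sorts Leq" using s by auto
  ultimately show ?thesis
    using assms(6,8-11) by (intro stable_extension_thorn_forks)
qed

end
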